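(* Let $p\in(1,\infty)$, let $(X,\mathcal{X},\mu,\mathcal{E}_p,\mathcal{F}_p,\Gamma_p)$ be a $p$-Dirichlet structure and let $n\in\mathbb{N}$. Let $\phi=(\phi_1,\dots,\phi_n):X\to\mathbb{R}^n$ be such that $\phi_i\in\mathcal{F}_p$ for each $i$, and suppose $\phi$ is $p$-independent on a measurable set $A\in\mathcal{X}$. Then $$\phi_*(\mathbf{1}_A\cdot\Lambda_\phi)\ll\mathcal{L}_n,$$ where $\Lambda_\phi=\sum_{i=1}^n\Gamma_p\langle\phi_i\rangle$ and $\mathcal{L}_n$ is the Lebesgue measure on $\mathbb{R}^n$.
   Context: For a Lipschitz function $g$ on $\mathbb{R}$, $\mathrm{LIP}[g|_E]$ is the smallest Lipschitz constant of $g$ on $E$ and $\mathrm{Lip}_a[g](y)=\lim_{r\to0}\mathrm{LIP}[g|_{B(y,r)}]$ is the asymptotic Lipschitz constant. $\mathrm{Lip}(\mathbb{R})$ is the space of real-valued Lipschitz functions on $\mathbb{R}$. Inequalities between measures are setwise, and $u\cdot\nu$ (or $u\,\nu$) is the measure with density $u$ with respect to $\nu$. A $p$-Dirichlet structure $(X,\mathcal{X},\mu,\mathcal{E}_p,\mathcal{F}_p,\Gamma_p)$ satisfies: (1) $(X,\mathcal{X},\mu)$ is a probability space and $\mathcal{F}_p$ is a linear subspace of $L^p(X,\mu)$ with $\mathbf{1}_X\in\mathcal{F}_p$. (2) $\mathcal{E}_p:\mathcal{F}_p\to[0,\infty)$, $\mathcal{E}_p^{1/p}$ is a seminorm on $\mathcal{F}_p$,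 and $\mathcal{F}_p$ is a Banach space with norm $\|f\|_{\mathcal{F}_p}=(\|f\|_{L^p}^p+\mathcal{E}_p(f))^{1/p}$. (3) For each $f\in\mathcal{F}_p$ there is a finite nonnegative measure $\Gamma_p\langle f\rangle$ on $(X,\mathcal{X})$ with $\Gamma_p\langle f\rangle(X)=\mathcal{E}_p(f)$ and $\Gamma_p\langle\lambda f\rangle=|\lambda|^p\Gamma_p\langle f\rangle$ for all $\lambda\in\mathbb{R}$. (4) $\Gamma_p\langle f\rangle\ll\mu$ for all $f\in\mathcal{F}_p$. (5) $\Gamma_p\langle f+g\rangle(A)^{1/p}\le\Gamma_p\langle f\rangle(A)^{1/p}+\Gamma_p\langle g\rangle(A)^{1/p}$ for all $f,g\in\mathcal{F}_p$, $A\in\mathcal{X}$. (6) For all $f\in\mathcal{F}_p$ and $g\in\mathrm{Lip}(\mathbb{R})$ with $g(0)=0$: $g\circ f\in\mathcal{F}_p$ and $\Gamma_p\langle g\circ f\rangle\le(\mathrm{Lip}_a[g]\circ f)^p\,\Gamma_p\langle f\rangle$. (7) If $f\in\mathcal{F}_p$, $A\in\mathcal{X}$ and $f|_A$ equals a constant $\mu$-a.e., then $\Gamma_p\langle f\rangle(A)=0$. (8) If $f\in L^p(X,\mu)$, $f_i\in\mathcal{F}_p$, $f_i\to f$ in $L^p$ and $\sup_i\mathcal{E}_p(f_i)<\infty$, then $f\in\mathcal{F}_p$ and $\Gamma_p\langle f\rangle(A)\le\liminf_i\Gamma_p\langle f_i\rangle(A)$ for every $A\in\mathcal{X}$. Lattice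 infimum: for a $\sigma$-finite measure $\Lambda$ and a family $\mathcal{G}$ of measurable functions, $\bigwedge^{\Lambda}_{f\in\mathcal{G}}f$ is the ($\Lambda$-a.e. unique) measurable $G$ with $G\le f$ $\Lambda$-a.e. for each $f\in\mathcal{G}$ and such that any other measurable $\widetilde G$ with this property satisfies $\widetilde G\le G$ $\Lambda$-a.e. $\phi=(\phi_1,\dots,\phi_n)\in\mathcal{F}_p^n$ is $p$-independent in a measurable set $A$ if, with $\Lambda_\phi=\sum_{i=1}^n\Gamma_p\langle\phi_i\rangle$ and $\mathbb{S}^{n-1}$ the Euclidean unit sphere in $\mathbb{R}^n$, $$\bigwedge^{\Lambda_\phi}_{\lambda\in\mathbb{S}^{n-1}}\frac{d\Gamma_p\langle\sum_{i=1}^n\lambda_i\phi_i\rangle}{d\Lambda_\phi}>0\qquad\Lambda_\phi\text{-a.e. in }A.$$ $\phi_*$ denotes pushforward of measures. *)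

theory Defs
  imports "HOL-Probability.Probability"
begin

definition Lp_space :: "real \<Rightarrow> 'a measure \<Rightarrow> ('a \<Rightarrow> real) set" where
  "Lp_space p M = {f \<in> borel_measurable M. integrable M (\<lambda>x. \<bar>f x\<bar> powr p)}"

definition Lp_norm :: "real \<Rightarrow> 'a measure \<Rightarrow> ('a \<Rightarrow> real) \<Rightarrow> real" where
  "Lp_norm p M f = (\<integral>x. \<bar>f x\<bar> powr p \<partial>M) powr (1 / p)"

definition LIP :: "(real \<Rightarrow> real) \<Rightarrow> real set \<Rightarrow> real" where
  "LIP g S = Inf {C. C-lipschitz_on S g}"

definition Lip_a :: "(real \<Rightarrow> real) \<Rightarrow> real \<Rightarrow> real" where
  "Lip_a g y = Lim (at_right 0) (\<lambda>r. LIP g (ball y r))"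

lemma LIP_lipschitz_on:
  assumes "C-lipschitz_on S g"
  shows "(LIP g S)-lipschitz_on S g"
proof -
  let ?L = "{C. C-lipschitz_on S g}"
  have ne: "?L \<noteq> {}" using assms by auto
  show ?thesis
  proof (rule lipschitz_onI)
    fix x y assume xy: "x \<in> S" "y \<in> S"
    show "dist (g x) (g y) \<le> LIP g S * dist x y"
    proof (cases "x = y")
      case False
      have "dist (g x) (g y) / dist x y \<le> Inf ?L"
        using ne False xy by (intro cInf_greatest) (auto simp: lipschitz_on_def divide_simps)
      then show ?thesis using False by (simp add: LIP_def divide_simps)
    qed simp
  next
    show "0 \<le> LIP g S"
      unfolding LIP_def using ne by (intro cInf_greatest) (auto simp: lipschitz_on_def)
  qed
qed

lemma LIP_le:
  assumes "C-lipschitz_on S g"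
  shows "LIP g S \<le> C"
  unfolding LIP_def using assms
  by (intro cInf_lower) (auto simp: bdd_below_def lipschitz_on_def)

lemma LIP_tendsto_Lip_a:
  assumes "C-lipschitz_on UNIV g"
  shows "((\<lambda>r. LIP g (ball y r)) \<longlongrightarrow> Lip_a g y) (at_right 0)"
proof -
  define h where "h r = LIP g (ball y r)" for r
  have lip: "(h r)-lipschitz_on (ball y r) g" for r
    unfolding h_def using assms by (intro LIP_lipschitz_on) (auto intro: lipschitz_on_subset)
  have h0: "h r \<ge> 0" for r using lip by (auto simp: lipschitz_on_def)
  have mono: "h r \<le> h s" if "r \<le> s" for r s
    unfolding h_def[of r]
    by (rule LIP_le) (rule lipschitz_on_subset[OF lip], simp add: that subset_ball)
  define l where "l = Inf (h ` {0<..})"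
  have bdd: "bdd_below (h ` {0<..})" using h0 by (auto simp: bdd_below_def)
  have "(h \<longlongrightarrow> l) (at_right 0)"
  proof (rule order_tendstoI)
    fix a assume "a < l"
    moreover have "l \<le> h r" if "r > 0" for r
      unfolding l_def using that bdd by (intro cInf_lower) auto
    ultimately show "\<forall>\<^sub>F r in at_right 0. a < h r"
      by (intro eventually_mono[OF eventually_at_right_less[of "0::real"]])
        (blast intro: less_le_trans)
  next
    fix a assume "l < a"
    then obtain s where s: "s > 0" "h s < a"
      unfolding l_def using bdd by (subst (asm) cInf_less_iff) auto
    then have "h r < a" if "r < s" for r using mono[of r s] that by auto
    with s show "\<forall>\<^sub>F r in at_right 0. h r < a"
      by (auto simp: eventually_at_right_field)
  qed
  then show ?thesis
    unfolding Lip_a_def h_def[symmetric] by (metis tendsto_Lim trivial_limit_at_right_real)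
qed

text \<open>
  Elements of \<open>L\<^sup>p\<close> are represented by measurable functions rather than by
  equivalence classes; \<open>ae_invariant\<close> says that \<open>F\<close>, \<open>E\<close> and
  \<open>\<Gamma>\<close> are well defined on classes modulo \<open>\<mu>\<close>-a.e. equality.
\<close>

locale dirichlet_structure = prob_space M
  for p :: real
    and M :: "'a measure"
    and E :: "('a \<Rightarrow> real) \<Rightarrow> real"
    and F :: "('a \<Rightarrow> real) set"
    and \<Gamma> :: "('a \<Rightarrow> real) \<Rightarrow> 'a measure" +
  assumes F_subset: "F \<subseteq> Lp_space p M"
    and ae_invariant:
      "\<And>f g. f \<in> F \<Longrightarrow> g \<in> borel_measurable M \<Longrightarrow> (AE x in M. f x = g x) \<Longrightarrow>
        g \<in> F \<and> E g = E f \<and> \<Gamma> g = \<Gamma> f"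
    and F_one: "(\<lambda>x. 1) \<in> F"
    and F_add: "\<And>f g. f \<in> F \<Longrightarrow> g \<in> F \<Longrightarrow> (\<lambda>x. f x + g x) \<in> F"
    and F_scale: "\<And>c f. f \<in> F \<Longrightarrow> (\<lambda>x. c * f x) \<in> F"
    and E_nonneg: "\<And>f. f \<in> F \<Longrightarrow> 0 \<le> E f"
    and E_triangle:
      "\<And>f g. f \<in> F \<Longrightarrow> g \<in> F \<Longrightarrow>
        E (\<lambda>x. f x + g x) powr (1 / p) \<le> E f powr (1 / p) + E g powr (1 / p)"
    and E_scale:
      "\<And>c f. f \<in> F \<Longrightarrow> E (\<lambda>x. c * f x) powr (1 / p) = \<bar>c\<bar> * E f powr (1 / p)"
    and F_complete:
      "\<And>u. (\<And>i::nat. u i \<in> F) \<Longrightarrow>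
        (\<And>e. e > 0 \<Longrightarrow> \<exists>N. \<forall>i\<ge>N. \<forall>j\<ge>N.
          (Lp_norm p M (\<lambda>x. u i x - u j x) powr p + E (\<lambda>x. u i x - u j x)) powr (1 / p) < e) \<Longrightarrow>
        \<exists>f\<in>F. (\<lambda>i. (Lp_norm p M (\<lambda>x. u i x - f x) powr p + E (\<lambda>x. u i x - f x)) powr (1 / p))
                 \<longlonglongrightarrow> 0"
    and sets_\<Gamma>: "\<And>f. f \<in> F \<Longrightarrow> sets (\<Gamma> f) = sets M"
    and finite_\<Gamma>: "\<And>f. f \<in> F \<Longrightarrow> finite_measure (\<Gamma> f)"
    and \<Gamma>_total: "\<And>f. f \<in> F \<Longrightarrow> measure (\<Gamma> f) (space M) = E f"
    and \<Gamma>_scale: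
      "\<And>c f B. f \<in> F \<Longrightarrow> B \<in> sets M \<Longrightarrow>
        emeasure (\<Gamma> (\<lambda>x. c * f x)) B = ennreal (\<bar>c\<bar> powr p) * emeasure (\<Gamma> f) B"
    and \<Gamma>_ac: "\<And>f. f \<in> F \<Longrightarrow> absolutely_continuous M (\<Gamma> f)"
    and \<Gamma>_triangle:
      "\<And>f g B. f \<in> F \<Longrightarrow> g \<in> F \<Longrightarrow> B \<in> sets M \<Longrightarrow>
        measure (\<Gamma> (\<lambda>x. f x + g x)) B powr (1 / p)
          \<le> measure (\<Gamma> f) B powr (1 / p) + measure (\<Gamma> g) B powr (1 / p)"
    and chain_closed:
      "\<And>f g C. f \<in> F \<Longrightarrow> C-lipschitz_on UNIV g \<Longrightarrow> g 0 = 0 \<Longrightarrow> g \<circ> f \<in> F"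
    and chain_le:
      "\<And>f g C B. f \<in> F \<Longrightarrow> C-lipschitz_on UNIV g \<Longrightarrow> g 0 = 0 \<Longrightarrow> B \<in> sets M \<Longrightarrow>
        emeasure (\<Gamma> (g \<circ> f)) B
          \<le> emeasure (density (\<Gamma> f) (\<lambda>x. ennreal (Lip_a g (f x) powr p))) B"
    and locality:
      "\<And>f B c. f \<in> F \<Longrightarrow> B \<in> sets M \<Longrightarrow> (AE x in M. x \<in> B \<longrightarrow> f x = c) \<Longrightarrow>
        emeasure (\<Gamma> f) B = 0"
    and lsc_closed:
      "\<And>f u. f \<in> Lp_space p M \<Longrightarrow> (\<And>i::nat. u i \<in> F) \<Longrightarrow>
        (\<lambda>i. Lp_norm p M (\<lambda>x. u i x - f x)) \<longlonglongrightarrow> 0 \<Longrightarrow>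
        bdd_above (range (\<lambda>i. E (u i))) \<Longrightarrow> f \<in> F"
    and lsc_le:
      "\<And>f u B. f \<in> Lp_space p M \<Longrightarrow> (\<And>i::nat. u i \<in> F) \<Longrightarrow>
        (\<lambda>i. Lp_norm p M (\<lambda>x. u i x - f x)) \<longlonglongrightarrow> 0 \<Longrightarrow>
        bdd_above (range (\<lambda>i. E (u i))) \<Longrightarrow> B \<in> sets M \<Longrightarrow>
        emeasure (\<Gamma> f) B \<le> liminf (\<lambda>i. emeasure (\<Gamma> (u i)) B)"

definition is_lattice_inf ::
    "'a measure \<Rightarrow> ('a \<Rightarrow> ennreal) set \<Rightarrow> ('a \<Rightarrow> ennreal) \<Rightarrow> bool" where
  "is_lattice_inf N \<G> G \<longleftrightarrow>
     G \<in> borel_measurable N \<and>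
     (\<forall>f\<in>\<G>. AE x in N. G x \<le> f x) \<and>
     (\<forall>H\<in>borel_measurable N. (\<forall>f\<in>\<G>. AE x in N. H x \<le> f x) \<longrightarrow> (AE x in N. H x \<le> G x))"

lemma is_lattice_inf_unique:
  assumes "is_lattice_inf N \<G> G" "is_lattice_inf N \<G> H"
  shows "AE x in N. G x = H x"
proof -
  have "AE x in N. G x \<le> H x" "AE x in N. H x \<le> G x"
    using assms unfolding is_lattice_inf_def by blast+
  then show ?thesis by eventually_elim simp
qed

text \<open>\<open>energy_sum M \<Gamma> \<phi>\<close> is the measure \<open>\<Lambda>\<^sub>\<phi> = \<Sum>i. \<Gamma>\<langle>\<phi>\<^sub>i\<rangle>\<close>.\<close>

definition energy_sum ::
    "'a measure \<Rightarrow> (('a \<Rightarrow> real) \<Rightarrow> 'a measure) \<Rightarrow> ('a \<Rightarrow> real ^ 'n) \<Rightarrow> 'a measure" where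
  "energy_sum M \<Gamma> \<phi> =
     measure_of (space M) (sets M) (\<lambda>B. \<Sum>i\<in>UNIV. emeasure (\<Gamma> (\<lambda>x. \<phi> x $ i)) B)"

lemma sets_energy_sum [simp]: "sets (energy_sum M \<Gamma> \<phi>) = sets M"
  and space_energy_sum [simp]: "space (energy_sum M \<Gamma> \<phi>) = space M"
  by (simp_all add: energy_sum_def)

lemma emeasure_energy_sum:
  fixes \<phi> :: "'a \<Rightarrow> real ^ 'n"
  assumes "\<And>i. sets (\<Gamma> (\<lambda>x. \<phi> x $ i)) = sets M" "B \<in> sets M"
  shows "emeasure (energy_sum M \<Gamma> \<phi>) B = (\<Sum>i\<in>UNIV. emeasure (\<Gamma> (\<lambda>x. \<phi> x $ i)) B)"
proof (rule emeasure_measure_of[OF energy_sum_def])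
  show "sets M \<subseteq> Pow (space M)" by (rule sets.space_closed)
  show "B \<in> sets (energy_sum M \<Gamma> \<phi>)" using assms by simp
  show "positive (sets (energy_sum M \<Gamma> \<phi>)) (\<lambda>B. \<Sum>i\<in>UNIV. emeasure (\<Gamma> (\<lambda>x. \<phi> x $ i)) B)"
    by (simp add: positive_def)
  show "countably_additive (sets (energy_sum M \<Gamma> \<phi>))
      (\<lambda>B. \<Sum>i\<in>UNIV. emeasure (\<Gamma> (\<lambda>x. \<phi> x $ i)) B)"
    unfolding countably_additive_def
  proof (intro allI impI)
    fix A :: "nat \<Rightarrow> 'a set"
    assume A: "range A \<subseteq> sets (energy_sum M \<Gamma> \<phi>)" "disjoint_family A"
    have "(\<Sum>k. \<Sum>i\<in>UNIV. emeasure (\<Gamma> (\<lambda>x. \<phi> x $ i)) (A k))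
        = (\<Sum>i\<in>UNIV. \<Sum>k. emeasure (\<Gamma> (\<lambda>x. \<phi> x $ i)) (A k))"
      by (rule suminf_sum) simp
    also have "\<dots> = (\<Sum>i\<in>UNIV. emeasure (\<Gamma> (\<lambda>x. \<phi> x $ i)) (\<Union>k. A k))"
      using A assms(1) by (intro sum.cong refl suminf_emeasure) auto
    finally show "(\<Sum>k. \<Sum>i\<in>UNIV. emeasure (\<Gamma> (\<lambda>x. \<phi> x $ i)) (A k))
        = (\<Sum>i\<in>UNIV. emeasure (\<Gamma> (\<lambda>x. \<phi> x $ i)) (\<Union>k. A k))" .
  qed
qed

text \<open>
  The lattice infimum is only determined a.e. (\<open>is_lattice_inf_unique\<close>), so the
  condition is stated for a representative \<open>G\<close>.
\<close>

definition p_independent ::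
    "'a measure \<Rightarrow> (('a \<Rightarrow> real) \<Rightarrow> 'a measure) \<Rightarrow> ('a \<Rightarrow> real ^ 'n) \<Rightarrow> 'a set \<Rightarrow> bool" where
  "p_independent M \<Gamma> \<phi> A \<longleftrightarrow>
     (\<exists>G. is_lattice_inf (energy_sum M \<Gamma> \<phi>)
            ((\<lambda>l. RN_deriv (energy_sum M \<Gamma> \<phi>) (\<Gamma> (\<lambda>x. \<Sum>i\<in>UNIV. l $ i * \<phi> x $ i)))
               ` sphere (0 :: real ^ 'n) 1) G \<and>
          (AE x in energy_sum M \<Gamma> \<phi>. x \<in> A \<longrightarrow> 0 < G x))"

end

theory Submission
  imports Defs
begin

text \<open>
  Let \<open>\<nu>\<close> be a probability measure on \<open>\<real>\<^sup>n\<close> concentrated on a compact Lebesgue null set.  The key point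
  (\<open>singular_test_field\<close>) is the existence of periodic trigonometric vector fields \<open>F\<close> with \<open>\<bar>DF\<bar> \<le> 1\<close>
  whose divergence has \<open>\<nu>\<close>-integral at least a constant depending only on \<open>n\<close>.  Otherwise the
  Hahn-Banach theorem gives a small matrix-valued functional \<open>V\<close> on the torus with
  \<open>\<nabla>\<nu> = div V\<close>.  Under the heat flow \<open>\<nu>\<^sub>t\<close> stays differentially subordinate to \<open>V\<^sub>t\<close>, so for a
  Bellman function of Burkholder type \<open>\<integral> B(V\<^sub>t, \<nu>\<^sub>t - 1) dx\<close> is nondecreasing in \<open>t\<close>; it tends to a
  nonpositive limit, while at time \<open>0\<close> it is bounded away from \<open>0\<close> because \<open>\<nu>\<close> has density \<open>0\<close> at
  almost every point and \<open>V\<close> is small in total variation.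

  Rescaling makes such fields uniformly small without changing the bound on the derivative, and almost
  minimising \<open>\<integral> \<bar>DF\<bar>\<^sup>2 d\<nu>\<close> makes their derivatives Cauchy in \<open>L\<^sup>2(\<nu>)\<close>.  If \<open>\<phi>\<^sub>*(1\<^sub>A \<Lambda>)\<close> charged a
  compact null set, composing these fields with \<open>\<phi>\<close> would give functions whose energies tend to \<open>0\<close>
  by lower semicontinuity, whereas \<open>p\<close>-independence bounds the same energies away from \<open>0\<close>.
\<close>

section \<open>Hahn-Banach extension\<close>

text \<open>Recovering \<nu> from V in \<nabla>\<nu> = div V is a singular integral of order zero.
  Such operators are unbounded on L1, while total variation is all that Hahn-Banach controls; so the
  estimate has to be of weak type. The Bellman integral at time 0 dominates the integral of the
  bounded quantity \<open>y\<^sup>2 / (1 + y\<^sup>2)\<close> up to a multiple of the total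
  variation of V. Singularity enters through y, the smoothed \<nu> minus its mean 1: it tends to -1
  almost everywhere, and the bounded quantity to 1/2. On the Dirichlet side \<Gamma> need not come
  from a bilinear form and satisfies a chain rule for functions of one real variable only. Plane
  waves \<open>cos (k \<bullet> x + \<beta>) *\<^sub>R a\<close> suit both sides: the heat flow is
  diagonal on them, and composed with \<phi> each is a function of the single element
  \<open>k \<bullet> \<phi>\<close> of \<open>F\<close>. Linearising a field on a small cell costs
  an error proportional to the cell size, with a constant that depends on the field without control;
  since the cells may shrink for a fixed field, energies end up bounded by the pointwise size of the
  derivative alone.\<close>

lemma hahn_banach_norm:
  fixes W :: "'a::real_normed_vector set" and f :: "'a \<Rightarrow> real"
  assumes W: "subspace W" and add: "\<And>x y. x \<in> W \<Longrightarrow> y \<in> W \<Longrightarrow> f (x + y) = f x + f y"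
    and scale: "\<And>r x. x \<in> W \<Longrightarrow> f (r *\<^sub>R x) = r * f x"
    and bd: "\<And>x. x \<in> W \<Longrightarrow> f x \<le> c * norm x" and c: "0 \<le> c"
  obtains g where "linear g" "\<And>x. x \<in> W \<Longrightarrow> g x = f x" "\<And>x. \<bar>g x\<bar> \<le> c * norm x"
proof -
  \<comment> \<open>Zorn's lemma runs over graphs: subspaces of \<open>'a \<times> real\<close>
    whose second coordinate is at most \<open>c\<close> times the norm of the first. They are
    automatically single-valued, since a pair \<open>(0, r)\<close> and its negative force
    \<open>r = 0\<close>.\<close>
  define \<G> where "\<G> = {G :: ('a \<times> real) set. subspace G \<and> (\<forall>(x, r)\<in>G. r \<le> c * norm x)
    \<and> (\<lambda>x. (x, f x)) ` W \<subseteq> G}"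
  have f0: "f 0 = 0" using scale[of 0 0] W by (simp add: subspace_0)
  have G0: "(\<lambda>x. (x, f x)) ` W \<in> \<G>"
    unfolding \<G>_def using W bd f0
    by (auto simp: subspace_def zero_prod_def add scale image_iff split: prod.splits)
  have "\<exists>G\<in>\<G>. \<forall>X\<in>\<G>. G \<subseteq> X \<longrightarrow> X = G"
  proof (rule subset_Zorn_nonempty)
    show "\<G> \<noteq> {}" using G0 by auto
    fix C assume C: "C \<noteq> {}" "subset.chain \<G> C"
    have sub: "\<And>G. G \<in> C \<Longrightarrow> G \<in> \<G>" using C(2) by (auto simp: subset.chain_def)
    have "subspace (\<Union>C)"
      unfolding subspace_def
    proof (intro conjI ballI allI)
      show "0 \<in> \<Union>C" using C(1) sub by (auto simp: \<G>_def subspace_def)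
      fix x y assume "x \<in> \<Union>C" "y \<in> \<Union>C"
      then obtain G H where "G \<in> C" "H \<in> C" "x \<in> G" "y \<in> H" by auto
      moreover from this have "G \<subseteq> H \<or> H \<subseteq> G" using C(2) by (auto simp: subset.chain_def)
      ultimately obtain L where "L \<in> C" "x \<in> L" "y \<in> L" by blast
      then show "x + y \<in> \<Union>C" using sub[of L] by (auto simp: \<G>_def subspace_def)
    next
      fix r :: real and x assume "x \<in> \<Union>C"
      then obtain G where "G \<in> C" "x \<in> G" by auto
      then show "r *\<^sub>R x \<in> \<Union>C"
        using sub[of G] subspace_scale by (fastforce simp: \<G>_def)
    qed
    then show "\<Union>C \<in> \<G>" using C(1) sub by (fastforce simp: \<G>_def)
  qed
  then obtain G where G: "G \<in> \<G>" and max: "\<And>X. X \<in> \<G> \<Longrightarrow> G \<subseteq> X \<Longrightarrow> X = G" by blast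
  have sG: "subspace G" and bG: "\<And>x r. (x, r) \<in> G \<Longrightarrow> r \<le> c * norm x"
    and WG: "\<And>x. x \<in> W \<Longrightarrow> (x, f x) \<in> G"
    using G by (auto simp: \<G>_def)
  have bG': "\<bar>r\<bar> \<le> c * norm x" if "(x, r) \<in> G" for x r
    using bG[OF that] bG[of "- x" "- r"] subspace_neg[OF sG that] by simp
  have uniq: "r = r'" if "(x, r) \<in> G" "(x, r') \<in> G" for x r r'
    using bG'[of 0 "r - r'"] subspace_diff[OF sG that] by simp
  have total: "\<exists>r. (x, r) \<in> G" for x
  proof (rule ccontr)
    assume no: "\<nexists>r. (x, r) \<in> G"
    \<comment> \<open>A value \<alpha> at the new vector \<open>x\<close> has to lie between
      \<open>- c * norm (y + x) - r\<close> and \<open>c * norm (y + x) - r\<close> for all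
      \<open>(y, r)\<close> in \<open>G\<close>. The triangle inequality puts every lower bound
      below every upper one, so the supremum of the lower bounds serves.\<close>
    define lo where "lo = (\<lambda>(y, r). - c * norm (y + x) - r) ` G"
    have key: "- c * norm (y + x) - r \<le> c * norm (z + x) - s"
      if "(y, r) \<in> G" "(z, s) \<in> G" for y r z s
    proof -
      have "s - r \<le> c * norm (z - y)" using bG[of "z - y" "s - r"] subspace_diff[OF sG that(2,1)] by simp
      also have "\<dots> \<le> c * (norm (z + x) + norm (y + x))"
        using norm_triangle_ineq4[of "z + x" "y + x"] c by (intro mult_left_mono) auto
      finally show ?thesis by (simp add: algebra_simps)
    qed
    have ne: "lo \<noteq> {}" using subspace_0[OF sG] by (auto simp: lo_def)
    have z: "(0, 0) \<in> G" using subspace_0[OF sG] by (simp add: zero_prod_def)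
    have bdd: "bdd_above lo"
      unfolding bdd_above_def lo_def using key[OF _ z] by fastforce
    define \<alpha> where "\<alpha> = Sup lo"
    have up: "\<alpha> \<le> c * norm (z + x) - s" if "(z, s) \<in> G" for z s
      unfolding \<alpha>_def using ne key[OF _ that] by (intro cSup_least) (auto simp: lo_def)
    have low: "- c * norm (z + x) - s \<le> \<alpha>" if "(z, s) \<in> G" for z s
      unfolding \<alpha>_def using bdd that by (intro cSup_upper) (auto simp: lo_def)
    define H where "H = (\<lambda>(u, t). u + t *\<^sub>R (x, \<alpha>)) ` (G \<times> UNIV)"
    have GH: "G \<subseteq> H" unfolding H_def
    proof
      fix u assume "u \<in> G"
      then show "u \<in> (\<lambda>(u, t). u + t *\<^sub>R (x, \<alpha>)) ` (G \<times> UNIV)"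
        by (intro image_eqI[of _ _ "(u, 0)"]) (auto simp: zero_prod_def[symmetric])
    qed
    have sH: "subspace H"
      unfolding subspace_def
    proof (intro conjI ballI allI)
      show "0 \<in> H" using GH subspace_0[OF sG] by auto
      fix a b assume "a \<in> H" "b \<in> H"
      then obtain u t v s where "u \<in> G" "v \<in> G" "a = u + t *\<^sub>R (x, \<alpha>)" "b = v + s *\<^sub>R (x, \<alpha>)"
        unfolding H_def by fast
      then show "a + b \<in> H" unfolding H_def using subspace_add[OF sG]
        by (intro image_eqI[of _ _ "(u + v, t + s)"]) (auto simp: algebra_simps)
    next
      fix r :: real and a assume "a \<in> H"
      then obtain u t where "u \<in> G" "a = u + t *\<^sub>R (x, \<alpha>)"
        unfolding H_def by fast
      then show "r *\<^sub>R a \<in> H" unfolding H_def using subspace_scale[OF sG]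
        by (intro image_eqI[of _ _ "(r *\<^sub>R u, r * t)"]) (auto simp: algebra_simps)
    qed
    \<comment> \<open>Dividing by \<open>t\<close> reduces the bound to the constraints on \<alpha>:
      the upper one for \<open>t > 0\<close>, the lower one for \<open>t < 0\<close>.\<close>
    have bH: "r + t * \<alpha> \<le> c * norm (y + t *\<^sub>R x)" if yr: "(y, r) \<in> G" for y r t
    proof (cases t "0::real" rule: linorder_cases)
      case equal then show ?thesis using bG yr by simp
    next
      case greater
      have "((1/t) *\<^sub>R y, r / t) \<in> G" using subspace_scale[OF sG yr, of "1/t"] by simp
      from up[OF this] have "\<alpha> \<le> c * norm ((1 / t) *\<^sub>R y + x) - r / t" .
      moreover have "norm (y + t *\<^sub>R x) = t * norm ((1 / t) *\<^sub>R y + x)"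
        using greater norm_scaleR[of t "(1 / t) *\<^sub>R y + x"] by (simp add: scaleR_add_right)
      ultimately show ?thesis using greater by (simp add: field_simps)
    next
      case less
      have "((1/t) *\<^sub>R y, r / t) \<in> G" using subspace_scale[OF sG yr, of "1/t"] by simp
      from low[OF this] have "- c * norm ((1 / t) *\<^sub>R y + x) - r / t \<le> \<alpha>" .
      moreover have "norm (y + t *\<^sub>R x) = - t * norm ((1 / t) *\<^sub>R y + x)"
        using less norm_scaleR[of t "(1 / t) *\<^sub>R y + x"] by (simp add: scaleR_add_right)
      ultimately show ?thesis using less by (simp add: field_simps)
    qed
    have "H \<in> \<G>"
      using sH GH WG bH by (fastforce simp: \<G>_def H_def)
    then have "H = G" using max GH by blast
    moreover have "(x, \<alpha>) \<in> H" unfolding H_def using z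
      by (intro image_eqI[of _ _ "((0,0), 1)"]) (auto simp: zero_prod_def)
    ultimately show False using no by blast
  qed
  define g where "g x = (THE r. (x, r) \<in> G)" for x
  have gG: "(x, g x) \<in> G" for x
    unfolding g_def using total[of x] uniq by (metis (mono_tags, lifting) theI)
  have "linear g"
  proof (rule linearI)
    show "g (x + y) = g x + g y" for x y
      using uniq[OF gG[of "x + y"]] subspace_add[OF sG gG[of x] gG[of y]] by auto
    show "g (r *\<^sub>R x) = r *\<^sub>R g x" for r x
      using uniq[OF gG[of "r *\<^sub>R x"]] subspace_scale[OF sG gG[of x]] by auto
  qed
  moreover have "g x = f x" if "x \<in> W" for x using uniq[OF gG WG[OF that]] .
  moreover have "\<bar>g x\<bar> \<le> c * norm x" for x using bG'[OF gG] .
  ultimately show thesis using that by blast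
qed

section \<open>Periodic integration and the Bellman function\<close>

text \<open>The cube and its translate by \<open>\<tau> *\<^sub>R u\<close> share one slab; the two
  remaining slabs differ by the period \<open>u\<close> and contribute equally.\<close>

lemma integral_periodic_translate:
  fixes g :: "'a::euclidean_space \<Rightarrow> real"
  assumes u: "u \<in> Basis" and per: "\<And>x. g (x + u) = g x" and cont: "continuous_on UNIV g"
    and \<tau>: "0 \<le> \<tau>" "\<tau> \<le> 1"
  shows "integral (cbox 0 One) (\<lambda>x. g (x + \<tau> *\<^sub>R u)) = integral (cbox 0 One) g"
proof -
  have int: "g integrable_on cbox a b" for a b
    using cont by (intro integrable_continuous) (auto intro: continuous_on_subset)
  have uB: "u \<bullet> i = (if i = u then 1 else 0)" if "i \<in> Basis" for i
    using u that by (auto simp: inner_Basis)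
  define I1 where "I1 = integral (cbox 0 (One - (1 - \<tau>) *\<^sub>R u)) g"
  define I2 where "I2 = integral (cbox (\<tau> *\<^sub>R u) One) g"
  have P1: "cbox 0 One \<inter> {x. x \<bullet> u \<le> \<tau>} = cbox 0 (One - (1 - \<tau>) *\<^sub>R u)"
    using \<tau> u by (auto simp: mem_box inner_diff_left uB split: if_splits) (metis order_trans)
  have P2: "cbox 0 One \<inter> {x. x \<bullet> u \<ge> \<tau>} = cbox (\<tau> *\<^sub>R u) One"
    using \<tau> u by (auto simp: mem_box uB split: if_splits) (metis order_trans)
  have Q1: "cbox (\<tau> *\<^sub>R u) (One + \<tau> *\<^sub>R u) \<inter> {x. x \<bullet> u \<le> 1} = cbox (\<tau> *\<^sub>R u) One"
    using \<tau> u by (auto simp: mem_box inner_add_left uB split: if_splits) (smt (verit))+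
  have Q2: "cbox (\<tau> *\<^sub>R u) (One + \<tau> *\<^sub>R u) \<inter> {x. x \<bullet> u \<ge> 1} = cbox (0 + u) ((One - (1 - \<tau>) *\<^sub>R u) + u)"
    using \<tau> u by (auto simp: mem_box inner_add_left inner_diff_left uB split: if_splits) (smt (verit))+
  have shift: "(g has_integral I1) (cbox (0 + u) ((One - (1 - \<tau>) *\<^sub>R u) + u))"
    unfolding has_integral_shift_cbox_iff[symmetric] I1_def
    using int[of 0 "One - (1 - \<tau>) *\<^sub>R u"] per by (simp add: o_def add.commute integrable_integral)
  have "(g has_integral (I1 + I2)) (cbox 0 One)"
    by (rule has_integral_split[where k = u and c = \<tau>])
      (use u int in \<open>simp_all only: P1 P2 I1_def I2_def integrable_integral\<close>)
  moreover have "(g has_integral (I2 + I1)) (cbox (\<tau> *\<^sub>R u) (One + \<tau> *\<^sub>R u))"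
    by (rule has_integral_split[where k = u and c = 1])
      (use u int shift in \<open>simp_all only: Q1 Q2 I2_def integrable_integral\<close>)
  then have "((\<lambda>x. g (x + \<tau> *\<^sub>R u)) has_integral (I2 + I1)) (cbox 0 One)"
    using has_integral_shift_cbox[of g _ "\<tau> *\<^sub>R u" "One + \<tau> *\<^sub>R u" "\<tau> *\<^sub>R u"] by simp
  ultimately show ?thesis by (simp add: integral_unique add.commute)
qed

lemma DERIV_unique_within:
  assumes "(f has_real_derivative D) (at x within S)" "(f has_real_derivative D') (at x within S)"
    and "at x within S \<noteq> bot"
  shows "D = D'"
  using assms by (auto simp: has_field_derivative_iff intro: tendsto_unique)

text \<open>The integral of the translates \<open>g (x + \<tau> *\<^sub>R u)\<close> is constant in
  \<tau>, and differentiating under the integral gives \<open>g'\<close>. This serves as integration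
  by parts without boundary terms. The derivative is taken within \<open>{0..1}\<close>, the range
  of the translation lemma.\<close>

lemma integral_periodic_derivative:
  fixes g g' :: "'a::euclidean_space \<Rightarrow> real"
  assumes u: "u \<in> Basis" and per: "\<And>x. g (x + u) = g x"
    and cont: "continuous_on UNIV g" and cont': "continuous_on UNIV g'"
    and deriv: "\<And>x \<tau>. ((\<lambda>\<tau>. g (x + \<tau> *\<^sub>R u)) has_real_derivative g' (x + \<tau> *\<^sub>R u)) (at \<tau>)"
  shows "integral (cbox 0 One) g' = 0"
proof -
  define \<Phi> where "\<Phi> \<tau> = integral (cbox 0 One) (\<lambda>x. g (x + \<tau> *\<^sub>R u))" for \<tau>
  have "(\<Phi> has_real_derivative integral (cbox 0 One) (\<lambda>x. g' (x + 0 *\<^sub>R u))) (at 0 within {0..1})"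
    unfolding \<Phi>_def
  proof (rule leibniz_rule_field_derivative)
    show "((\<lambda>\<tau>. g (x + \<tau> *\<^sub>R u)) has_field_derivative g' (x + \<tau> *\<^sub>R u)) (at \<tau> within {0..1})" for \<tau> x
      using deriv by (rule has_field_derivative_at_within)
    show "(\<lambda>x. g (x + \<tau> *\<^sub>R u)) integrable_on cbox 0 One" for \<tau>
      by (intro integrable_continuous continuous_on_compose2[OF cont] continuous_intros) auto
    show "continuous_on ({0..1} \<times> cbox 0 One) (\<lambda>(\<tau>, x). g' (x + \<tau> *\<^sub>R u))"
      by (auto simp: split_beta intro!: continuous_on_compose2[OF cont'] continuous_intros)
  qed auto
  moreover have "(\<Phi> has_real_derivative 0) (at 0 within {0..1})"
  proof -
    have "\<Phi> \<tau> = integral (cbox 0 One) g" if "\<tau> \<in> {0..1}" for \<tau>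
      using integral_periodic_translate[OF u per cont, of \<tau>] that by (simp add: \<Phi>_def)
    then show ?thesis
      by (subst has_field_derivative_cong_eventually[where g = "\<lambda>_. integral (cbox 0 One) g"])
        (auto simp: eventually_at_filter)
  qed
  moreover have "at (0::real) within {0..1} \<noteq> bot"
    by (simp add: at_within_Icc_at_right)
  ultimately have "integral (cbox 0 One) (\<lambda>x. g' (x + 0 *\<^sub>R u)) = 0"
    by (rule DERIV_unique_within)
  then show ?thesis by simp
qed

text \<open>A smooth substitute for Burkholder's function in the weak-type inequality for differentially
  subordinate martingales: for large \<open>c\<close> the Hessian is nonpositive on pairs \<open>(h, k)\<close> with \<open>\<bar>k\<bar>\<close>
  controlled by \<open>\<bar>h\<bar>\<close>, although the function grows only linearly in \<open>x\<close>.\<close>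

definition bellman :: "real \<Rightarrow> 'v::real_inner \<Rightarrow> real \<Rightarrow> real" where
  "bellman c x y = y\<^sup>2 / (1 + x \<bullet> x + y\<^sup>2) - c * (2 * sqrt (1 + x \<bullet> x) - ln (1 + x \<bullet> x) / 2 - 2)"

definition bellman_deriv :: "real \<Rightarrow> 'v::real_inner \<Rightarrow> real \<Rightarrow> 'v \<Rightarrow> real \<Rightarrow> real" where
  "bellman_deriv c x y h k = 2 * y * k / (1 + x \<bullet> x + y\<^sup>2)
     - y\<^sup>2 * (2 * (x \<bullet> h) + 2 * y * k) / (1 + x \<bullet> x + y\<^sup>2)\<^sup>2
     - c * (2 * (x \<bullet> h) / sqrt (1 + x \<bullet> x) - (x \<bullet> h) / (1 + x \<bullet> x))"

definition bellman_hess :: "real \<Rightarrow> 'v::real_inner \<Rightarrow> real \<Rightarrow> 'v \<Rightarrow> real \<Rightarrow> real" where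
  "bellman_hess c x y h k = 2 * k\<^sup>2 / (1 + x \<bullet> x + y\<^sup>2)
     - 8 * (y * k) * (x \<bullet> h + y * k) / (1 + x \<bullet> x + y\<^sup>2)\<^sup>2
     - 2 * y\<^sup>2 * (h \<bullet> h + k\<^sup>2) / (1 + x \<bullet> x + y\<^sup>2)\<^sup>2
     + 8 * y\<^sup>2 * (x \<bullet> h + y * k)\<^sup>2 / (1 + x \<bullet> x + y\<^sup>2) ^ 3
     - c * (2 * (h \<bullet> h) / sqrt (1 + x \<bullet> x) - 2 * (x \<bullet> h)\<^sup>2 / ((1 + x \<bullet> x) * sqrt (1 + x \<bullet> x))
        - (h \<bullet> h) / (1 + x \<bullet> x) + 2 * (x \<bullet> h)\<^sup>2 / (1 + x \<bullet> x)\<^sup>2)"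

section \<open>Derivatives, concavity and growth of the Bellman function\<close>

lemma one_plus_inner_pos [simp]: "0 < 1 + x \<bullet> (x::'v::real_inner)"
  by (simp add: add_pos_nonneg)

lemma one_plus_inner_square_pos [simp]: "0 < 1 + x \<bullet> (x::'v::real_inner) + (y::real)\<^sup>2"
  by (simp add: add_pos_nonneg)

lemma one_plus_inner_nz [simp]: "1 + x \<bullet> (x::'v::real_inner) \<noteq> 0" "1 + x \<bullet> (x::'v::real_inner) + (y::real)\<^sup>2 \<noteq> 0"
  using one_plus_inner_pos[of x] one_plus_inner_square_pos[of x y] by linarith+

lemma has_real_derivative_inner:
  fixes f g :: "real \<Rightarrow> 'v::real_inner"
  assumes "(f has_vector_derivative f') (at t within S)" "(g has_vector_derivative g') (at t within S)"
  shows "((\<lambda>t. f t \<bullet> g t) has_real_derivative (f' \<bullet> g t + f t \<bullet> g')) (at t within S)"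
proof -
  have "((\<lambda>t. f t \<bullet> g t) has_derivative (\<lambda>h. f t \<bullet> (h *\<^sub>R g') + (h *\<^sub>R f') \<bullet> g t)) (at t within S)"
    using assms unfolding has_vector_derivative_def by (rule has_derivative_inner)
  then show ?thesis
    unfolding has_field_derivative_def by (rule has_derivative_eq_rhs) (auto simp: fun_eq_iff algebra_simps)
qed

lemma sqrt_one_plus_inner_has_derivative:
  fixes x :: "real \<Rightarrow> 'v::real_inner"
  assumes x: "(x has_vector_derivative h) (at t within S)"
  shows "((\<lambda>t. sqrt (1 + x t \<bullet> x t)) has_real_derivative (x t \<bullet> h) / sqrt (1 + x t \<bullet> x t)) (at t within S)"
    and "((\<lambda>t. ln (1 + x t \<bullet> x t)) has_real_derivative 2 * (x t \<bullet> h) / (1 + x t \<bullet> x t)) (at t within S)"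
proof -
  have e: "((\<lambda>t. 1 + x t \<bullet> x t) has_real_derivative 2 * (x t \<bullet> h)) (at t within S)"
    using DERIV_add[OF DERIV_const has_real_derivative_inner[OF x x], of 1] by (simp add: inner_commute)
  show "((\<lambda>t. sqrt (1 + x t \<bullet> x t)) has_real_derivative (x t \<bullet> h) / sqrt (1 + x t \<bullet> x t)) (at t within S)"
    using DERIV_chain2[OF DERIV_real_sqrt[OF one_plus_inner_pos] e] by (simp add: field_simps)
  show "((\<lambda>t. ln (1 + x t \<bullet> x t)) has_real_derivative 2 * (x t \<bullet> h) / (1 + x t \<bullet> x t)) (at t within S)"
    using DERIV_chain2[OF DERIV_ln[OF one_plus_inner_pos] e] by (simp add: field_simps)
qed

lemma bellman_has_derivative:
  assumes x: "(x has_vector_derivative h) (at t within S)" and y: "(y has_real_derivative k) (at t within S)"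
  shows "((\<lambda>t. bellman c (x t) (y t)) has_real_derivative bellman_deriv c (x t) (y t) h k) (at t within S)"
proof -
  have e: "((\<lambda>t. 1 + x t \<bullet> x t + (y t)\<^sup>2) has_real_derivative 2 * (x t \<bullet> h) + 2 * y t * k) (at t within S)"
    by (rule derivative_eq_intros has_real_derivative_inner[OF x x] y refl | simp add: inner_commute)+
  have n: "((\<lambda>t. (y t)\<^sup>2) has_real_derivative 2 * y t * k) (at t within S)"
    by (rule derivative_eq_intros y refl | simp)+
  note d = sqrt_one_plus_inner_has_derivative[OF x]
  have pre: "((\<lambda>t. bellman c (x t) (y t)) has_real_derivative
     (2 * y t * k * (1 + x t \<bullet> x t + (y t)\<^sup>2) - (y t)\<^sup>2 * (2 * (x t \<bullet> h) + 2 * y t * k))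
       / ((1 + x t \<bullet> x t + (y t)\<^sup>2) * (1 + x t \<bullet> x t + (y t)\<^sup>2))
     - c * (2 * ((x t \<bullet> h) / sqrt (1 + x t \<bullet> x t)) - 2 * (x t \<bullet> h) / (1 + x t \<bullet> x t) / 2 - 0)) (at t within S)"
    unfolding bellman_def
    by (rule DERIV_diff[OF DERIV_divide[OF n e one_plus_inner_nz(2)]
      DERIV_cmult[OF DERIV_diff[OF DERIV_diff[OF DERIV_cmult[OF d(1)] DERIV_cdivide[OF d(2)]] DERIV_const]]])
  have alg: "(m * E - n) / (E * E) - c * (2 * (a / b) - 2 * a / d / 2 - 0)
      = m / E - n / E\<^sup>2 - c * (2 * a / b - a / d)" if "E \<noteq> 0" for m n E a b d :: real
    using that by (simp add: diff_divide_distrib power2_eq_square)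
  show ?thesis
    unfolding bellman_deriv_def by (rule DERIV_cong[OF pre alg[OF one_plus_inner_nz(2)]])
qed

text \<open>The quotient rule for
  \<open>2 * (x \<bullet> h) / s - (x \<bullet> h) / s\<^sup>2\<close> with
  \<open>s = sqrt (1 + x \<bullet> x)\<close>, in scalars: \<open>a\<close>, \<open>q\<close>,
  \<open>r\<close> stand for \<open>h \<bullet> h\<close>, \<open>x \<bullet> h\<close>,
  \<open>x \<bullet> h'\<close>. The right-hand side separates the Hessian from the part linear in
  the acceleration \<open>h'\<close>.\<close>

lemma bellman_hess_identity:
  fixes s a q r :: real
  assumes s: "s \<noteq> 0"
  shows "(2 * (a + r) * s - 2 * q * (q / s)) / (s * s) - ((a + r) * s\<^sup>2 - q * (2 * q)) / (s\<^sup>2 * s\<^sup>2)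
    = (2 * a / s - 2 * q\<^sup>2 / s ^ 3 - a / s\<^sup>2 + 2 * q\<^sup>2 / s ^ 4) + (2 * r / s - r / s\<^sup>2)"
proof -
  have "(2 * (a + r) * s - 2 * q * (q / s)) / (s * s) = 2 * a / s + 2 * r / s - 2 * q\<^sup>2 / s ^ 3"
    using s by (simp add: diff_divide_distrib add_divide_distrib distrib_left distrib_right power2_eq_square power3_eq_cube mult_ac)
  moreover have "((a + r) * s\<^sup>2 - q * (2 * q)) / (s\<^sup>2 * s\<^sup>2) = a / s\<^sup>2 + r / s\<^sup>2 - 2 * q\<^sup>2 / s ^ 4"
    using s by (simp add: diff_divide_distrib add_divide_distrib distrib_right power2_eq_square power4_eq_xxxx mult_ac)
  ultimately show ?thesis by simp
qed

text \<open>Along a curve with velocity \<open>(h, k)\<close> and acceleration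
  \<open>(h', k')\<close> the second derivative splits into the Hessian form and the gradient
  applied to the acceleration. Summed over the coordinate directions the acceleration becomes a
  Laplacian, which under the heat flow is the time derivative.\<close>

lemma bellman_deriv_has_derivative:
  assumes x: "(x has_vector_derivative h t) (at t within S)" and y: "(y has_real_derivative k t) (at t within S)"
    and h: "(h has_vector_derivative h') (at t within S)" and k: "(k has_real_derivative k') (at t within S)"
  shows "((\<lambda>t. bellman_deriv c (x t) (y t) (h t) (k t)) has_real_derivative
    bellman_hess c (x t) (y t) (h t) (k t) + bellman_deriv c (x t) (y t) h' k') (at t within S)"
proof -
  have e: "((\<lambda>t. x t \<bullet> x t) has_real_derivative 2 * (x t \<bullet> h t)) (at t within S)"
    using has_real_derivative_inner[OF x x] by (simp add: inner_commute)
  have f: "((\<lambda>t. x t \<bullet> h t) has_real_derivative h t \<bullet> h t + x t \<bullet> h') (at t within S)"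
    by (rule has_real_derivative_inner[OF x h])
  define s where "s = sqrt (1 + x t \<bullet> x t)"
  have s: "s > 0" "1 + x t \<bullet> x t = s\<^sup>2" by (simp_all add: s_def)
  have D: "1 + x t \<bullet> x t + (y t)\<^sup>2 \<noteq> 0" by simp
  have 1: "((\<lambda>t. 2 * y t * k t / (1 + x t \<bullet> x t + (y t)\<^sup>2) -
       (y t)\<^sup>2 * (2 * (x t \<bullet> h t) + 2 * y t * k t) / (1 + x t \<bullet> x t + (y t)\<^sup>2)\<^sup>2) has_real_derivative
    (2 * (k t)\<^sup>2 / (1 + x t \<bullet> x t + (y t)\<^sup>2)
     - 8 * (y t * k t) * (x t \<bullet> h t + y t * k t) / (1 + x t \<bullet> x t + (y t)\<^sup>2)\<^sup>2
     - 2 * (y t)\<^sup>2 * (h t \<bullet> h t + (k t)\<^sup>2) / (1 + x t \<bullet> x t + (y t)\<^sup>2)\<^sup>2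
     + 8 * (y t)\<^sup>2 * (x t \<bullet> h t + y t * k t)\<^sup>2 / (1 + x t \<bullet> x t + (y t)\<^sup>2) ^ 3)
   + (2 * y t * k' / (1 + x t \<bullet> x t + (y t)\<^sup>2) -
       (y t)\<^sup>2 * (2 * (x t \<bullet> h') + 2 * y t * k') / (1 + x t \<bullet> x t + (y t)\<^sup>2)\<^sup>2)) (at t within S)"
    apply (rule derivative_eq_intros e f y k refl | simp)+
    apply (simp add: divide_simps D)
    apply algebra
    done
  define R where "R t = sqrt (1 + x t \<bullet> x t)" for t
  note RL = sqrt_one_plus_inner_has_derivative(1)[OF x, folded R_def]
  have Rn: "R t \<noteq> 0" using s(1) by (simp add: R_def s_def)
  have xx: "((\<lambda>t. 1 + x t \<bullet> x t) has_real_derivative 2 * (x t \<bullet> h t)) (at t within S)"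
    using DERIV_add[OF DERIV_const e, of 1] by simp
  have RR: "1 + x t \<bullet> x t = (R t)\<^sup>2" "s = R t" by (simp_all add: R_def s_def)
  have 2: "((\<lambda>t. 2 * (x t \<bullet> h t) / R t - (x t \<bullet> h t) / (1 + x t \<bullet> x t))
     has_real_derivative
     (2 * (h t \<bullet> h t) / s - 2 * (x t \<bullet> h t)\<^sup>2 / (s ^ 3)
        - (h t \<bullet> h t) / s\<^sup>2 + 2 * (x t \<bullet> h t)\<^sup>2 / s ^ 4)
      + (2 * (x t \<bullet> h') / s - (x t \<bullet> h') / s\<^sup>2)) (at t within S)"
    unfolding RR(2)
    by (rule DERIV_cong[OF DERIV_diff[OF DERIV_divide[OF DERIV_cmult[OF f, of 2] RL Rn]
        DERIV_divide[OF f xx one_plus_inner_nz(1)]]])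
      (simp only: RR(1) bellman_hess_identity[OF Rn])
  have "s ^ 3 = (1 + x t \<bullet> x t) * s" "s ^ 4 = (1 + x t \<bullet> x t)\<^sup>2"
    unfolding s(2) by (simp_all add: power_numeral_reduce)
  note two = 2[unfolded this s(2)[symmetric], unfolded s_def R_def]
  have "(a + b) - c * (d + e) = (a - c * d) + (b - c * e)" for a b d e :: real
    by (simp add: algebra_simps)
  then show ?thesis
    unfolding bellman_deriv_def bellman_hess_def by (rule DERIV_cong[OF DERIV_diff[OF 1 DERIV_cmult[OF two, of c]]])
qed

text \<open>The first summand of \<open>bellman\<close> has Hessian at most \<open>(14 * k\<^sup>2 +
  12 * (h \<bullet> h)) / (1 + x \<bullet> x)\<close>, with 14 = 2 + 4 + 8 then relaxed to 20. With
  \<open>s = sqrt (1 + x \<bullet> x)\<close> the second summand is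
  \<open>- c * (2 * s - ln s - 2)\<close>. In radial directions the Hessian of \<open>s\<close>
  alone decays like the cube of \<open>1 / s\<close>; the logarithm raises the lower bound to
  \<open>(h \<bullet> h) / s\<^sup>2\<close>, which matches the first summand, and keeps the growth
  linear.\<close>

lemma bellman_hess_le:
  fixes x h :: "'v::real_inner"
  assumes c: "c \<ge> 0"
  shows "bellman_hess c x y h k \<le> (20 * k\<^sup>2 + (12 - c) * (h \<bullet> h)) / (1 + x \<bullet> x)"
proof -
  define s where "s = sqrt (1 + x \<bullet> x)"
  define D where "D = 1 + x \<bullet> x + y\<^sup>2"
  define a where "a = h \<bullet> h"
  define q where "q = x \<bullet> h"
  have s: "s > 0" "1 + x \<bullet> x = s\<^sup>2" "s \<ge> 1" by (simp_all add: s_def)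
  have D: "D > 0" "D = s\<^sup>2 + y\<^sup>2" by (simp_all add: D_def s(2)[symmetric])
  have q: "q\<^sup>2 \<le> (s\<^sup>2 - 1) * a"
  proof -
    have "x \<bullet> x = s\<^sup>2 - 1" using s(2) by simp
    then show ?thesis using Cauchy_Schwarz_ineq[of x h] by (simp add: q_def a_def)
  qed
  have a: "a \<ge> 0" by (simp add: a_def)
  have "bellman_hess c x y h k = 2 * k\<^sup>2 / D - 8 * (y * k) * (q + y * k) / D\<^sup>2
     - 2 * y\<^sup>2 * (a + k\<^sup>2) / D\<^sup>2 + 8 * y\<^sup>2 * (q + y * k)\<^sup>2 / D ^ 3
     - c * (2 * a / s - 2 * q\<^sup>2 / (s\<^sup>2 * s) - a / s\<^sup>2 + 2 * q\<^sup>2 / (s\<^sup>2)\<^sup>2)"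
    using s(1) by (simp add: bellman_hess_def D_def a_def q_def s(2))
  moreover have "- 8 * (y * k) * (q + y * k) / D\<^sup>2 \<le> (4 * k\<^sup>2 + 4 * a) / D"
  proof -
    have "- 8 * (y * k) * (q + y * k) \<le> 4 * y\<^sup>2 * k\<^sup>2 * 0 + 4 * q\<^sup>2 + 4 * y\<^sup>2 * k\<^sup>2 "
      using zero_le_power2[of "q + y * k"] zero_le_power2[of "y * k"] by (simp add: power2_eq_square algebra_simps)
    also have "\<dots> \<le> 4 * (D * a) + 4 * (D * k\<^sup>2)"
    proof -
      have "q\<^sup>2 \<le> D * a" using q a D by (simp add: algebra_simps) (smt (verit) mult_nonneg_nonneg zero_le_power2)
      moreover have "y\<^sup>2 * k\<^sup>2 \<le> D * k\<^sup>2" using D by (intro mult_right_mono) auto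
      ultimately show ?thesis by simp
    qed
    finally have le: "- 8 * (y * k) * (q + y * k) \<le> 4 * (D * a) + 4 * (D * k\<^sup>2)" .
    have "- 8 * (y * k) * (q + y * k) / D\<^sup>2 \<le> (4 * (D * a) + 4 * (D * k\<^sup>2)) / D\<^sup>2"
      using le by (rule divide_right_mono) simp
    moreover have "4 * (D * a) + 4 * (D * k\<^sup>2) = D * (4 * k\<^sup>2 + 4 * a)" by algebra
    moreover have "D * (4 * k\<^sup>2 + 4 * a) / D\<^sup>2 = (4 * k\<^sup>2 + 4 * a) / D"
      unfolding power2_eq_square[of D] using D(1) by (intro mult_divide_mult_cancel_left) simp
    ultimately show ?thesis by (simp only:)
  qed
  moreover have "8 * y\<^sup>2 * (q + y * k)\<^sup>2 / D ^ 3 \<le> 8 * (a + k\<^sup>2) / D"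
  proof -
    \<comment> \<open>Cauchy-Schwarz for the pairs \<open>(x, y)\<close> and \<open>(h, k)\<close>,
      as \<open>x \<bullet> x + y\<^sup>2 \<le> D\<close>.\<close>
    have "(q + y * k)\<^sup>2 \<le> D * (a + k\<^sup>2)"
    proof -
      have "2 * (q * (y * k)) \<le> y\<^sup>2 * a + s\<^sup>2 * k\<^sup>2"
      proof -
        have qs: "\<bar>q\<bar> \<le> s * sqrt a"
        proof (rule power2_le_imp_le)
          have "q\<^sup>2 \<le> s\<^sup>2 * a" using q a by (simp add: left_diff_distrib)
          then show "\<bar>q\<bar>\<^sup>2 \<le> (s * sqrt a)\<^sup>2" using a by (simp add: power_mult_distrib)
          show "0 \<le> s * sqrt a" using a s by simp
        qed
        have "2 * (q * (y * k)) \<le> 2 * (\<bar>q\<bar> * \<bar>y * k\<bar>)" by (simp flip: abs_mult)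
        also have "\<dots> \<le> 2 * ((s * sqrt a) * \<bar>y * k\<bar>)" using qs by (simp add: mult_right_mono)
        also have "\<dots> = 2 * ((\<bar>y\<bar> * sqrt a) * (s * \<bar>k\<bar>))" by (simp add: abs_mult)
        also have "\<dots> \<le> (\<bar>y\<bar> * sqrt a)\<^sup>2 + (s * \<bar>k\<bar>)\<^sup>2"
          using sum_squares_bound[of "\<bar>y\<bar> * sqrt a" "s * \<bar>k\<bar>"] by (simp only: mult.assoc)
        also have "\<dots> = y\<^sup>2 * a + s\<^sup>2 * k\<^sup>2" using a by (simp add: power_mult_distrib)
        finally show ?thesis .
      qed
      moreover have "q\<^sup>2 \<le> s\<^sup>2 * a" using q a by (simp add: algebra_simps)
      ultimately show ?thesis unfolding D(2) by (simp add: power2_eq_square algebra_simps)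
    qed
    moreover have "y\<^sup>2 \<le> D" using D by simp
    ultimately have "y\<^sup>2 * (q + y * k)\<^sup>2 \<le> D * (D * (a + k\<^sup>2))"
      using D a by (intro mult_mono) auto
    then have "8 * y\<^sup>2 * (q + y * k)\<^sup>2 / D ^ 3 \<le> 8 * (D * (D * (a + k\<^sup>2))) / D ^ 3"
      using D(1) by (intro divide_right_mono) auto
    also have "\<dots> = 8 * (a + k\<^sup>2) / D" using D(1) by (simp add: power3_eq_cube)
    finally show ?thesis .
  qed
  moreover have "0 \<le> 2 * y\<^sup>2 * (a + k\<^sup>2) / D\<^sup>2" using a by simp
  moreover have "(14 * k\<^sup>2 + 12 * a) / D \<le> (14 * k\<^sup>2 + 12 * a) / s\<^sup>2"
    using D a s by (intro divide_left_mono) auto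
  moreover have "a / s\<^sup>2 \<le> 2 * a / s - 2 * q\<^sup>2 / (s\<^sup>2 * s) - a / s\<^sup>2 + 2 * q\<^sup>2 / (s\<^sup>2)\<^sup>2"
  proof -
    \<comment> \<open>\<open>q\<^sup>2\<close> enters with the nonpositive coefficient
      \<open>- 2 * (s - 1) / s ^ 4\<close>, so the worst case is equality in Cauchy-Schwarz, with
      \<open>h\<close> parallel to \<open>x\<close>.\<close>
    have "q\<^sup>2 * (s - 1) \<le> (s\<^sup>2 - 1) * a * (s - 1)"
      using q s by (intro mult_right_mono) auto
    moreover have "2 * (a * s\<^sup>2) \<le> 2 * (a * s ^ 3) - 2 * (q\<^sup>2 * (s - 1))"
      if "q\<^sup>2 * (s - 1) \<le> (s\<^sup>2 - 1) * a * (s - 1)"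
    proof -
      have "a * s ^ 3 - a * s\<^sup>2 - (s\<^sup>2 - 1) * a * (s - 1) = a * (s - 1)" by algebra
      moreover have "0 \<le> a * (s - 1)" using a s by simp
      ultimately show ?thesis using that by linarith
    qed
    ultimately have "2 * (a * s\<^sup>2) / s ^ 4 \<le> (2 * (a * s ^ 3) - 2 * (q\<^sup>2 * (s - 1))) / s ^ 4"
      using s by (intro divide_right_mono) auto
    also have "2 * (a * s\<^sup>2) / s ^ 4 = 2 * a / s\<^sup>2"
      using s by (simp add: power2_eq_square power4_eq_xxxx)
    also have "(2 * (a * s ^ 3) - 2 * (q\<^sup>2 * (s - 1))) / s ^ 4 = 2 * a / s - 2 * q\<^sup>2 / (s\<^sup>2 * s) + 2 * q\<^sup>2 / (s\<^sup>2)\<^sup>2"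
      using s by (simp add: power2_eq_square power4_eq_xxxx power3_eq_cube divide_simps)
        (simp add: algebra_simps)
    finally show ?thesis by simp
  qed
  then have "c * (a / s\<^sup>2) \<le> c * (2 * a / s - 2 * q\<^sup>2 / (s\<^sup>2 * s) - a / s\<^sup>2 + 2 * q\<^sup>2 / (s\<^sup>2)\<^sup>2)"
    using c by (rule mult_left_mono)
  moreover have "(20 * k\<^sup>2 + (12 - c) * (h \<bullet> h)) / (1 + x \<bullet> x) = (20 * k\<^sup>2 + 12 * a) / s\<^sup>2 - c * (a / s\<^sup>2)"
    using s by (simp add: a_def s(2) field_simps)
  moreover have "2 * k\<^sup>2 / D + (4 * k\<^sup>2 + 4 * a) / D + 8 * (a + k\<^sup>2) / D = (14 * k\<^sup>2 + 12 * a) / D"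
    by (simp add: add_divide_distrib)
  moreover have "(14 * k\<^sup>2 + 12 * a) / s\<^sup>2 \<le> (20 * k\<^sup>2 + 12 * a) / s\<^sup>2"
    by (intro divide_right_mono) auto
  ultimately show ?thesis
    by linarith
qed

text \<open>The subtracted term is nonnegative because \<open>ln s \<le> s - 1\<close>. The bound
  involves \<open>y\<close> alone, so at late times the decay of the scalar part decides the
  limit.\<close>

lemma bellman_le:
  fixes x :: "'v::real_inner"
  assumes "0 \<le> c"
  shows "bellman c x y \<le> y\<^sup>2"
proof -
  define s where "s = sqrt (1 + x \<bullet> x)"
  have s: "s > 0" "1 + x \<bullet> x = s\<^sup>2" "s \<ge> 1" by (simp_all add: s_def)
  have "ln s \<le> s - 1" using s by (intro ln_le_minus_one) auto
  then have "0 \<le> c * (2 * s - ln (s\<^sup>2) / 2 - 2)" using s assms by (simp add: ln_realpow)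
  moreover have "y\<^sup>2 / (s\<^sup>2 + y\<^sup>2) \<le> y\<^sup>2"
  proof -
    have "1 \<le> s\<^sup>2 + y\<^sup>2" using s(3) one_le_power[of s 2] by (simp add: add_increasing2)
    then have "y\<^sup>2 * 1 \<le> y\<^sup>2 * (s\<^sup>2 + y\<^sup>2)" by (intro mult_left_mono) auto
    moreover have "0 < s\<^sup>2 + y\<^sup>2" using s(1) by (simp add: add_pos_nonneg)
    ultimately show ?thesis by (simp add: divide_le_eq)
  qed
  ultimately show ?thesis using s(1) by (simp add: bellman_def s(2))
qed

text \<open>For use at time 0. The subtracted term is at most \<open>2 * c * norm x\<close> because
  \<open>s \<le> 1 + norm x\<close>, and dropping \<open>x \<bullet> x\<close> from the denominator
  of the first summand costs at most \<open>norm x\<close>.\<close>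

lemma bellman_ge:
  fixes x :: "'v::real_inner"
  assumes "0 \<le> c"
  shows "y\<^sup>2 / (1 + y\<^sup>2) - (1 + 2 * c) * norm x \<le> bellman c x y"
proof -
  define s where "s = sqrt (1 + x \<bullet> x)"
  have s: "s > 0" "1 + x \<bullet> x = s\<^sup>2" "s \<ge> 1" by (simp_all add: s_def)
  have "s \<le> 1 + norm x" unfolding s_def
    by (rule real_le_lsqrt) (auto simp: power2_eq_square algebra_simps dot_square_norm)
  moreover have "0 \<le> ln (s\<^sup>2)" using s by (intro ln_ge_zero) (auto simp: one_le_power)
  ultimately have "c * (2 * s - ln (s\<^sup>2) / 2 - 2) \<le> c * (2 * norm x)"
    using assms by (intro mult_left_mono) auto
  moreover have "y\<^sup>2 / (1 + y\<^sup>2) - norm x \<le> y\<^sup>2 / (1 + x \<bullet> x + y\<^sup>2)"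
  proof -
    define r where "r = norm x"
    have r: "x \<bullet> x = r\<^sup>2" "r \<ge> 0" by (simp_all add: r_def dot_square_norm)
    have p: "1 + y\<^sup>2 > 0" "1 + r\<^sup>2 + y\<^sup>2 > 0" by (simp_all add: add_pos_nonneg)
    have "y\<^sup>2 / (1 + y\<^sup>2) - y\<^sup>2 / (1 + r\<^sup>2 + y\<^sup>2) = (y\<^sup>2 / (1 + y\<^sup>2)) * (r\<^sup>2 / (1 + r\<^sup>2 + y\<^sup>2))"
      using p by (simp add: divide_simps) (simp add: algebra_simps)
    also have "\<dots> \<le> 1 * (r\<^sup>2 / (1 + r\<^sup>2 + y\<^sup>2))"
      using p by (intro mult_right_mono) auto
    also have "\<dots> \<le> r"
    proof -
      have "r\<^sup>2 \<le> r * (1 + r\<^sup>2)"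
      proof (cases "r \<le> 1")
        case True then show ?thesis using r by (simp add: power2_eq_square algebra_simps mult_left_le add_increasing2)
      next
        case False
        then have "r\<^sup>2 * 1 \<le> r\<^sup>2 * r" by (intro mult_left_mono) auto
        then show ?thesis using r by (simp add: power2_eq_square algebra_simps)
      qed
      also have "\<dots> \<le> r * (1 + r\<^sup>2 + y\<^sup>2)" using r by (intro mult_left_mono) auto
      finally show ?thesis using p by (simp add: divide_le_eq)
    qed
    finally show ?thesis by (simp add: r r_def)
  qed
  ultimately show ?thesis using s(1) by (simp add: bellman_def s(2) algebra_simps)
qed

section \<open>Heat flow of trigonometric polynomials\<close>

lemma continuous_on_bellman [continuous_intros]:
  fixes x :: "'z::topological_space \<Rightarrow> 'v::real_inner"
  assumes [continuous_intros]: "continuous_on S x" "continuous_on S y"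
  shows "continuous_on S (\<lambda>z. bellman c (x z) (y z))"
  unfolding bellman_def by (intro continuous_intros) auto

lemma continuous_on_bellman_deriv [continuous_intros]:
  fixes x h :: "'z::topological_space \<Rightarrow> 'v::real_inner"
  assumes [continuous_intros]: "continuous_on S x" "continuous_on S y" "continuous_on S h" "continuous_on S k"
  shows "continuous_on S (\<lambda>z. bellman_deriv c (x z) (y z) (h z) (k z))"
  unfolding bellman_deriv_def by (intro continuous_intros) auto

lemma continuous_on_bellman_hess [continuous_intros]:
  fixes x h :: "'z::topological_space \<Rightarrow> 'v::real_inner"
  assumes [continuous_intros]: "continuous_on S x" "continuous_on S y" "continuous_on S h" "continuous_on S k"
  shows "continuous_on S (\<lambda>z. bellman_hess c (x z) (y z) (h z) (k z))"
  unfolding bellman_hess_def by (intro continuous_intros) auto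

lemma bellman_deriv_sum:
  "bellman_deriv c x y (\<Sum>u\<in>B. h u) (\<Sum>u\<in>B. k u) = (\<Sum>u\<in>B. bellman_deriv c x y (h u) (k u))"
proof (induction B rule: infinite_finite_induct)
  case (insert u B)
  have "bellman_deriv c x y (a + a') (b + b') = bellman_deriv c x y a b + bellman_deriv c x y a' b'"
    for a a' :: 'a and b b'
    unfolding bellman_deriv_def
    by (simp add: inner_add_right distrib_left add_divide_distrib diff_divide_distrib right_diff_distrib)
  with insert show ?case by simp
qed (simp_all add: bellman_deriv_def)

definition heat_sum ::
    "'k set \<Rightarrow> ('k \<Rightarrow> 'a::euclidean_space) \<Rightarrow> ('k \<Rightarrow> 'b::real_normed_vector) \<Rightarrow> ('k \<Rightarrow> 'b) \<Rightarrow> real \<Rightarrow> 'a \<Rightarrow> 'b"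
  where "heat_sum I w P Q t x =
    (\<Sum>k\<in>I. exp (- t * (w k \<bullet> w k)) *\<^sub>R (cos (w k \<bullet> x) *\<^sub>R P k + sin (w k \<bullet> x) *\<^sub>R Q k))"

text \<open>Differentiation along \<open>u\<close> exchanges cosine and sine coefficients with a
  factor \<open>w k \<bullet> u\<close> and one sign, so derivatives of heat sums are heat sums
  again and the same lemmas apply to derivatives of any order.\<close>

abbreviation heat_sum_deriv ::
    "'k set \<Rightarrow> ('k \<Rightarrow> 'a::euclidean_space) \<Rightarrow> ('k \<Rightarrow> 'b::real_normed_vector) \<Rightarrow> ('k \<Rightarrow> 'b) \<Rightarrow> 'a \<Rightarrow> real \<Rightarrow> 'a \<Rightarrow> 'b"
  where "heat_sum_deriv I w P Q u \<equiv> heat_sum I w (\<lambda>k. (w k \<bullet> u) *\<^sub>R Q k) (\<lambda>k. - (w k \<bullet> u) *\<^sub>R P k)"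

lemma heat_sum_has_space_derivative:
  "((\<lambda>\<tau>. heat_sum I w P Q t (x + \<tau> *\<^sub>R u)) has_vector_derivative
     heat_sum_deriv I w P Q u t (x + \<tau> *\<^sub>R u)) (at \<tau> within S)"
proof -
  have l: "((\<lambda>\<tau>. w k \<bullet> (x + \<tau> *\<^sub>R u)) has_real_derivative w k \<bullet> u) (at \<tau> within S)" for k
    unfolding inner_add_right inner_scaleR_right by (auto intro!: derivative_eq_intros)
  have c: "((\<lambda>\<tau>. cos (w k \<bullet> (x + \<tau> *\<^sub>R u))) has_real_derivative - sin (w k \<bullet> (x + \<tau> *\<^sub>R u)) * (w k \<bullet> u)) (at \<tau> within S)" for k
    by (rule DERIV_chain2[OF DERIV_cos l])
  have s: "((\<lambda>\<tau>. sin (w k \<bullet> (x + \<tau> *\<^sub>R u))) has_real_derivative cos (w k \<bullet> (x + \<tau> *\<^sub>R u)) * (w k \<bullet> u)) (at \<tau> within S)" for k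
    by (rule DERIV_chain2[OF DERIV_sin l])
  show ?thesis
    unfolding heat_sum_def
    by (rule derivative_eq_intros c s refl | simp add: algebra_simps)+
qed

lemma heat_sum_has_real_space_derivative:
  fixes p q :: "'k \<Rightarrow> real"
  shows "((\<lambda>\<tau>. heat_sum I w p q t (x + \<tau> *\<^sub>R u)) has_real_derivative
     heat_sum_deriv I w p q u t (x + \<tau> *\<^sub>R u)) (at \<tau> within S)"
  unfolding has_real_derivative_iff_has_vector_derivative by (rule heat_sum_has_space_derivative)

text \<open>The heat equation: the Laplacian, written as iterated derivatives along the basis,
  multiplies each wave by \<open>- (w k \<bullet> w k)\<close>, and so does the time
  derivative.\<close>

lemma heat_sum_has_time_derivative:
  "((\<lambda>t. heat_sum I w P Q t x) has_vector_derivative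
     (\<Sum>u\<in>Basis. heat_sum_deriv I w (\<lambda>k. (w k \<bullet> u) *\<^sub>R Q k) (\<lambda>k. - (w k \<bullet> u) *\<^sub>R P k) u t x)) (at t within S)"
proof -
  have "(\<Sum>u\<in>Basis. heat_sum_deriv I w (\<lambda>k. (w k \<bullet> u) *\<^sub>R Q k) (\<lambda>k. - (w k \<bullet> u) *\<^sub>R P k) u t x)
    = (\<Sum>k\<in>I. \<Sum>u\<in>Basis. - ((w k \<bullet> u) * (w k \<bullet> u)) *\<^sub>R (exp (- t * (w k \<bullet> w k)) *\<^sub>R (cos (w k \<bullet> x) *\<^sub>R P k + sin (w k \<bullet> x) *\<^sub>R Q k)))"
    unfolding heat_sum_def by (subst sum.swap) (simp add: algebra_simps)
  also have "\<dots> = (\<Sum>k\<in>I. - (w k \<bullet> w k) *\<^sub>R (exp (- t * (w k \<bullet> w k)) *\<^sub>R (cos (w k \<bullet> x) *\<^sub>R P k + sin (w k \<bullet> x) *\<^sub>R Q k)))"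
    by (simp only: scaleR_sum_left[symmetric] sum_negf euclidean_inner[of "w _" "w _", symmetric])
  finally show ?thesis
    unfolding heat_sum_def
    apply (simp only:)
    apply (rule derivative_eq_intros refl | simp)+
    apply (simp add: algebra_simps)
    done
qed

lemma continuous_on_heat_sum [continuous_intros]:
  fixes f :: "'z::t2_space \<Rightarrow> real"
  assumes [continuous_intros]: "continuous_on S f" "continuous_on S g"
  shows "continuous_on S (\<lambda>z. heat_sum I w P Q (f z) (g z))"
  unfolding heat_sum_def by (intro continuous_intros)

lemma heat_sum_periodic:
  assumes "\<And>k. k \<in> I \<Longrightarrow> \<exists>m::int. w k \<bullet> u = 2 * pi * of_int m"
  shows "heat_sum I w P Q t (x + u) = heat_sum I w P Q t x"
  unfolding heat_sum_def
proof (rule sum.cong)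
  fix k assume "k \<in> I"
  then obtain m :: int where m: "w k \<bullet> u = of_int m * (2 * pi)" using assms by (metis mult.commute)
  then show "exp (- t * (w k \<bullet> w k)) *\<^sub>R (cos (w k \<bullet> (x + u)) *\<^sub>R P k + sin (w k \<bullet> (x + u)) *\<^sub>R Q k)
    = exp (- t * (w k \<bullet> w k)) *\<^sub>R (cos (w k \<bullet> x) *\<^sub>R P k + sin (w k \<bullet> x) *\<^sub>R Q k)"
    unfolding inner_add_right m
    using sin.plus_of_int[of "w k \<bullet> x" m] cos.plus_of_int[of "w k \<bullet> x" m] by simp
qed simp

text \<open>The time derivative of the integral is the gradient of \<open>bellman\<close> applied to
  the two Laplacians; integration by parts over a period turns it into minus the integral of the
  Hessian at the pairs of first derivatives. By subordination the summed Hessian is at most a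
  nonnegative multiple of \<open>20 * N + 12 - c\<close>, hence nonpositive.\<close>

theorem bellman_heat_mono:
  fixes w :: "'k \<Rightarrow> 'a::euclidean_space" and P Q :: "'k \<Rightarrow> 'v::real_inner" and p q :: "'k \<Rightarrow> real"
  assumes lattice: "\<And>k u. k \<in> I \<Longrightarrow> u \<in> Basis \<Longrightarrow> \<exists>m::int. w k \<bullet> u = 2 * pi * of_int m"
    and sub: "\<And>t x. (\<Sum>u\<in>Basis. (heat_sum_deriv I w p q u t x)\<^sup>2)
        \<le> N * (\<Sum>u\<in>Basis. (norm (heat_sum_deriv I w P Q u t x))\<^sup>2)"
    and c: "12 + 20 * N \<le> c" "0 \<le> c" and t: "0 \<le> t"
  shows "integral (cbox 0 One) (\<lambda>x. bellman c (heat_sum I w P Q 0 x) (heat_sum I w p q 0 x))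
    \<le> integral (cbox 0 One) (\<lambda>x. bellman c (heat_sum I w P Q t x) (heat_sum I w p q t x))"
proof -
  let ?V = "heat_sum I w P Q" and ?y = "heat_sum I w p q"
  let ?Vu = "heat_sum_deriv I w P Q" and ?yu = "heat_sum_deriv I w p q"
  let ?Vuu = "\<lambda>u. heat_sum_deriv I w (\<lambda>k. (w k \<bullet> u) *\<^sub>R Q k) (\<lambda>k. - (w k \<bullet> u) *\<^sub>R P k) u"
  let ?yuu = "\<lambda>u. heat_sum_deriv I w (\<lambda>k. (w k \<bullet> u) *\<^sub>R q k) (\<lambda>k. - (w k \<bullet> u) *\<^sub>R p k) u"
  have cI: "(f :: 'a \<Rightarrow> real) integrable_on cbox 0 One" if "continuous_on UNIV f" for f
    using that by (intro integrable_continuous) (auto intro: continuous_on_subset)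
  define G where "G t = integral (cbox 0 One) (\<lambda>x. bellman c (?V t x) (?y t x))" for t
  define G' where "G' t = integral (cbox 0 One) (\<lambda>x. bellman_deriv c (?V t x) (?y t x)
    (\<Sum>u\<in>Basis. ?Vuu u t x) (\<Sum>u\<in>Basis. ?yuu u t x))" for t
  have der: "(G has_real_derivative G' t) (at t)" for t
  proof -
    have "(G has_real_derivative G' t) (at t within UNIV)"
      unfolding G_def G'_def
    proof (rule leibniz_rule_field_derivative)
      show "((\<lambda>t. bellman c (?V t x) (?y t x)) has_field_derivative bellman_deriv c (?V t x) (?y t x)
          (\<Sum>u\<in>Basis. ?Vuu u t x) (\<Sum>u\<in>Basis. ?yuu u t x)) (at t within UNIV)" for t x
        by (intro bellman_has_derivative heat_sum_has_time_derivative)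
          (use heat_sum_has_time_derivative[of I w p q x t UNIV] in \<open>simp add: has_real_derivative_iff_has_vector_derivative\<close>)
      show "(\<lambda>x. bellman c (?V t x) (?y t x)) integrable_on cbox 0 One" for t
        by (intro cI continuous_intros)
      show "continuous_on (UNIV \<times> cbox 0 One) (\<lambda>(t, x). bellman_deriv c (?V t x) (?y t x)
          (\<Sum>u\<in>Basis. ?Vuu u t x) (\<Sum>u\<in>Basis. ?yuu u t x))"
        unfolding split_beta by (intro continuous_intros)
    qed auto
    then show ?thesis by simp
  qed
  have pos: "0 \<le> G' t" for t
  proof -
    define A where "A u x = bellman_deriv c (?V t x) (?y t x) (?Vuu u t x) (?yuu u t x)" for u x
    define H where "H u x = bellman_hess c (?V t x) (?y t x) (?Vu u t x) (?yu u t x)" for u x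
    have iA: "A u integrable_on cbox 0 One" and iH: "H u integrable_on cbox 0 One" for u
      unfolding A_def H_def by (intro cI continuous_intros)+
    have "integral (cbox 0 One) (\<lambda>x. H u x + A u x) = 0" if u: "u \<in> Basis" for u
    proof (rule integral_periodic_derivative[OF u])
      let ?g = "\<lambda>x. bellman_deriv c (?V t x) (?y t x) (?Vu u t x) (?yu u t x)"
      show "?g (x + u) = ?g x" for x
        by (simp only: heat_sum_periodic[OF lattice[OF _ u]])
      show "continuous_on UNIV ?g" "continuous_on UNIV (\<lambda>x. H u x + A u x)"
        unfolding A_def H_def by (intro continuous_intros)+
      show "((\<lambda>\<tau>. ?g (x + \<tau> *\<^sub>R u)) has_real_derivative H u (x + \<tau> *\<^sub>R u) + A u (x + \<tau> *\<^sub>R u)) (at \<tau>)" for x \<tau>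
        unfolding A_def H_def
        by (intro bellman_deriv_has_derivative heat_sum_has_space_derivative
            heat_sum_has_real_space_derivative)
    qed
    then have A: "integral (cbox 0 One) (A u) = - integral (cbox 0 One) (H u)" if "u \<in> Basis" for u
      using that integral_add[OF iH iA, of u u] by fastforce
    have "(\<Sum>u\<in>Basis. H u x) \<le> 0" for x
    proof -
      have "(\<Sum>u\<in>Basis. H u x) \<le> (\<Sum>u\<in>Basis. (20 * (?yu u t x)\<^sup>2 + (12 - c) * (?Vu u t x \<bullet> ?Vu u t x)) / (1 + ?V t x \<bullet> ?V t x))"
        unfolding H_def by (intro sum_mono bellman_hess_le c)
      also have "\<dots> = (20 * (\<Sum>u\<in>Basis. (?yu u t x)\<^sup>2) + (12 - c) * (\<Sum>u\<in>Basis. (norm (?Vu u t x))\<^sup>2)) / (1 + ?V t x \<bullet> ?V t x)"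
        by (simp add: sum_divide_distrib[symmetric] sum.distrib sum_distrib_left dot_square_norm)
      also have "\<dots> \<le> 0"
      proof (rule divide_nonpos_pos)
        have "20 * (\<Sum>u\<in>Basis. (?yu u t x)\<^sup>2) \<le> 20 * (N * (\<Sum>u\<in>Basis. (norm (?Vu u t x))\<^sup>2))"
          using sub[of t x] by simp
        also have "\<dots> = (20 * N) * (\<Sum>u\<in>Basis. (norm (?Vu u t x))\<^sup>2)" by simp
        also have "\<dots> \<le> (c - 12) * (\<Sum>u\<in>Basis. (norm (?Vu u t x))\<^sup>2)"
          using c by (intro mult_right_mono sum_nonneg) auto
        finally show "20 * (\<Sum>u\<in>Basis. (?yu u t x)\<^sup>2) + (12 - c) * (\<Sum>u\<in>Basis. (norm (?Vu u t x))\<^sup>2) \<le> 0"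
          by (simp add: algebra_simps)
      qed simp
      finally show ?thesis .
    qed
    then have "integral (cbox 0 One) (\<lambda>x. \<Sum>u\<in>Basis. H u x) \<le> integral (cbox 0 One) (\<lambda>x::'a. 0 :: real)"
      using iH by (intro integral_le integrable_sum) auto
    then have "(\<Sum>u\<in>Basis. integral (cbox 0 One) (H u)) \<le> 0"
      using iH by (subst (asm) integral_sum) auto
    moreover have "G' t = (\<Sum>u\<in>Basis. integral (cbox 0 One) (A u))"
      unfolding G'_def bellman_deriv_sum A_def[symmetric] using iA by (intro integral_sum) auto
    ultimately show ?thesis using A by (simp add: sum_negf)
  qed
  have "G 0 \<le> G t"
    by (rule DERIV_nonneg_imp_nondecreasing[OF t]) (use der pos in blast)
  then show ?thesis by (simp add: G_def)
qed

section \<open>A positive trigonometric kernel\<close>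

lemma cos_power_eq_sum:
  "complex_of_real (cos s ^ (2 * M)) =
    (\<Sum>j\<in>{- int M..int M}. of_real (real ((2 * M) choose nat (int M + j)) / 4 ^ M) * cis (2 * of_int j * s))"
proof -
  have "complex_of_real (cos s) = (cis s + cis (- s)) / 2"
    by (simp add: complex_eq_iff)
  then have "complex_of_real (cos s ^ (2 * M)) = ((cis s + cis (- s)) / 2) ^ (2 * M)"
    by (simp only: of_real_power)
  then have "complex_of_real (cos s ^ (2 * M)) = (cis s + cis (- s)) ^ (2 * M) / 4 ^ M"
    by (simp add: power_divide power_mult)
  also have "(cis s + cis (- s)) ^ (2 * M) =
      (\<Sum>l\<le>2 * M. of_nat ((2 * M) choose l) * cis s ^ l * cis (- s) ^ (2 * M - l))"
    by (rule binomial_ring)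
  also have "\<dots> = (\<Sum>j\<in>{- int M..int M}. of_nat ((2 * M) choose nat (int M + j)) * cis (2 * of_int j * s))"
  proof (rule sum.reindex_bij_witness[of _ "\<lambda>j. nat (int M + j)" "\<lambda>l. int l - int M"])
    fix l assume l: "l \<in> {..2 * M}"
    have "cis s ^ l * cis (- s) ^ (2 * M - l) = cis (2 * of_int (int l - int M) * s)"
    proof -
      have "real l * s + real (2 * M - l) * - s = 2 * of_int (int l - int M) * s"
        using l by (simp add: of_nat_diff algebra_simps)
      then show ?thesis by (simp only: Complex.DeMoivre cis_mult)
    qed
    then show "of_nat ((2 * M) choose nat (int M + (int l - int M))) * cis (2 * of_int (int l - int M) * s)
      = of_nat ((2 * M) choose l) * cis s ^ l * cis (- s) ^ (2 * M - l)" by simp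
  qed auto
  finally show ?thesis
    by (simp add: sum_divide_distrib)
qed

text \<open>The kernel is defined by its Fourier coefficients; being a product of even powers of cosines
  (\<open>trig_kernel_eq_prod\<close>) it is nonnegative.\<close>

definition lattice_freq :: "('n \<Rightarrow> int) \<Rightarrow> real ^ 'n"
  where "lattice_freq m = (\<chi> i. 2 * pi * of_int (m i))"

definition freq_box :: "nat \<Rightarrow> ('n \<Rightarrow> int) set"
  where "freq_box M = {m. \<forall>i. m i \<in> {- int M..int M}}"

text \<open>Division by the central binomial coefficient makes the coefficient at frequency 0 equal
  to 1, so that the kernel has integral 1 over the unit cube and acts as an approximate
  identity.\<close>

definition kernel_coeff :: "nat \<Rightarrow> ('n::finite \<Rightarrow> int) \<Rightarrow> real"
  where "kernel_coeff M m = (\<Prod>i\<in>UNIV. real ((2 * M) choose nat (int M + m i)) / real ((2 * M) choose M))"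

definition trig_kernel :: "nat \<Rightarrow> real ^ 'n \<Rightarrow> real"
  where "trig_kernel M z = (\<Sum>m\<in>freq_box M. kernel_coeff M m * cos (lattice_freq m \<bullet> z))"

lemma freq_box_eq_PiE: "freq_box M = PiE UNIV (\<lambda>_. {- int M..int M})"
  by (auto simp: freq_box_def PiE_def Pi_def)

lemma finite_freq_box [simp]: "finite (freq_box M :: ('n::finite \<Rightarrow> int) set)"
  unfolding freq_box_eq_PiE by (intro finite_PiE) auto

text \<open>Each factor is the binomial expansion of a power of a cosine. Multiplying out chooses
  one frequency per coordinate, which is an element of \<open>freq_box M\<close>; the complex
  exponentials become cosines on taking real parts.\<close>

lemma trig_kernel_eq_prod:
  fixes z :: "real ^ 'n"
  shows "trig_kernel M z = (\<Prod>i\<in>UNIV. 4 ^ M / real ((2 * M) choose M) * cos (pi * z $ i) ^ (2 * M))"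
proof -
  define C where "C = real ((2 * M) choose M)"
  have C: "C > 0" by (simp add: C_def)
  define f where "f i j = complex_of_real (real ((2 * M) choose nat (int M + j)) / C) * cis (2 * pi * of_int j * z $ i)" for i j
  have "complex_of_real (\<Prod>i\<in>UNIV. 4 ^ M / C * cos (pi * z $ i) ^ (2 * M)) =
      (\<Prod>i\<in>UNIV. \<Sum>j\<in>{- int M..int M}. f i j)"
    unfolding of_real_prod
  proof (rule prod.cong)
    fix i
    have "complex_of_real (4 ^ M / C * cos (pi * z $ i) ^ (2 * M)) = of_real (4 ^ M / C) * of_real (cos (pi * z $ i) ^ (2 * M))"
      by simp
    also have "\<dots> = (\<Sum>j\<in>{- int M..int M}. f i j)"
      unfolding cos_power_eq_sum sum_distrib_left f_def
      by (intro sum.cong refl) (simp add: mult_ac)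
    finally show "complex_of_real (4 ^ M / C * cos (pi * z $ i) ^ (2 * M)) = (\<Sum>j\<in>{- int M..int M}. f i j)" .
  qed simp
  also have "\<dots> = (\<Sum>m\<in>freq_box M. \<Prod>i\<in>UNIV. f i (m i))"
    unfolding freq_box_eq_PiE by (rule prod_sum_PiE) auto
  also have "\<dots> = (\<Sum>m\<in>freq_box M. of_real (kernel_coeff M m) * cis (lattice_freq m \<bullet> z))"
  proof (rule sum.cong[OF refl])
    fix m :: "'n \<Rightarrow> int"
    have "(\<Prod>i\<in>A. cis (g i)) = cis (\<Sum>i\<in>A. g i)" for A :: "'n set" and g
      by (induction A rule: infinite_finite_induct) (auto simp: cis_mult)
    then show "(\<Prod>i\<in>UNIV. f i (m i)) = of_real (kernel_coeff M m) * cis (lattice_freq m \<bullet> z)"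
      by (simp only: f_def prod.distrib kernel_coeff_def C_def lattice_freq_def inner_vec_def
        of_real_prod vec_lambda_beta inner_real_def)
  qed
  finally have "Re (complex_of_real (\<Prod>i\<in>UNIV. 4 ^ M / C * cos (pi * z $ i) ^ (2 * M))) = Re \<dots>"
    by (rule arg_cong)
  then show ?thesis
    unfolding Re_complex_of_real by (simp add: trig_kernel_def C_def)
qed

lemma trig_kernel_nonneg: "0 \<le> trig_kernel M z"
  unfolding trig_kernel_eq_prod by (intro prod_nonneg) (auto intro!: zero_le_even_power)

lemma kernel_coeff_zero [simp]: "kernel_coeff M (\<lambda>_. 0) = 1"
  by (simp add: kernel_coeff_def)

lemma zero_in_freq_box [simp]: "(\<lambda>_. 0) \<in> freq_box M"
  by (simp add: freq_box_def)

lemma lattice_freq_eq_0_iff [simp]: "lattice_freq m = 0 \<longleftrightarrow> m = (\<lambda>_. 0)"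
  by (auto simp: lattice_freq_def vec_eq_iff fun_eq_iff)

lemma lattice_freq_zero [simp]: "lattice_freq (\<lambda>_. 0) = 0"
  by simp

lemma lattice_freq_inner_Basis:
  assumes "u \<in> Basis"
  shows "\<exists>l::int. lattice_freq m \<bullet> u = 2 * pi * of_int l"
  using assms by (auto simp: Basis_vec_def inner_axis lattice_freq_def)

text \<open>The lower bound \<open>4 ^ M / (2 * M)\<close> for the central binomial coefficient
  costs a factor \<open>2 * M\<close> per coordinate. The root of degree \<open>CARD('n)\<close>
  gathers everything into one power of \<open>M * r ^ M\<close>, which tends to 0 when
  \<open>r < 1\<close>.\<close>

lemma trig_kernel_le:
  fixes z :: "real ^ 'n"
  assumes "0 < M"
  shows "trig_kernel M z \<le> (2 * real M * root CARD('n) (\<Prod>i\<in>UNIV. (cos (pi * z $ i))\<^sup>2) ^ M) ^ CARD('n)"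
proof -
  define q where "q = (\<Prod>i\<in>UNIV. (cos (pi * z $ i))\<^sup>2)"
  have q: "q \<ge> 0" by (simp add: q_def prod_nonneg)
  have "trig_kernel M z = (4 ^ M / real ((2 * M) choose M)) ^ CARD('n) * q ^ M"
    unfolding trig_kernel_eq_prod prod.distrib q_def by (simp add: prod_power_distrib power_mult)
  also have "\<dots> \<le> (2 * real M) ^ CARD('n) * q ^ M"
  proof (intro mult_right_mono power_mono)
    show "4 ^ M / real (2 * M choose M) \<le> 2 * real M"
      using central_binomial_lower_bound[OF assms] assms by (simp add: field_simps)
  qed (use q in auto)
  also have "q ^ M = (root CARD('n) q ^ M) ^ CARD('n)"
  proof -
    have "(root CARD('n) q ^ M) ^ CARD('n) = (root CARD('n) q ^ CARD('n)) ^ M"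
      by (simp only: power_mult[symmetric] mult.commute)
    then show ?thesis using q by (simp add: real_root_pow_pos2)
  qed
  finally show ?thesis by (simp add: q_def power_mult_distrib)
qed

text \<open>A squared cosine is 1 only at multiples of pi, so on a compact set without integer
  points the product of the squared cosines has a maximum below 1. Geometric decay then beats the
  factor \<open>M\<close>.\<close>

lemma trig_kernel_tendsto_0:
  fixes S :: "(real ^ 'n) set"
  assumes S: "compact S" and far: "\<And>z. z \<in> S \<Longrightarrow> \<exists>i. z $ i \<notin> \<int>" and e: "e > 0"
  shows "\<forall>\<^sub>F M in sequentially. \<forall>z\<in>S. trig_kernel M z \<le> e"
proof (cases "S = {}")
  case False
  define r where "r z = root CARD('n) (\<Prod>i\<in>UNIV. (cos (pi * z $ i))\<^sup>2)" for z :: "real ^ 'n"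
  have "continuous_on S r"
    unfolding r_def by (intro continuous_intros)
  then obtain z0 where z0: "z0 \<in> S" "\<And>z. z \<in> S \<Longrightarrow> r z \<le> r z0"
    using continuous_attains_sup[OF S False] by blast
  have r0: "0 \<le> r z" for z by (auto simp: r_def intro!: prod_nonneg)
  have "(\<Prod>i\<in>UNIV. (cos (pi * z0 $ i))\<^sup>2) < 1"
  proof -
    obtain i where i: "z0 $ i \<notin> \<int>" using far z0 by blast
    have c1: "(cos t)\<^sup>2 \<le> 1" for t :: real by (simp add: abs_square_le_1)
    have "(cos (pi * z0 $ i))\<^sup>2 \<noteq> 1"
    proof
      assume "(cos (pi * z0 $ i))\<^sup>2 = 1"
      then have "sin (pi * z0 $ i) = 0" using sin_cos_squared_add[of "pi * z0 $ i"] by simp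
      then obtain l :: int where "pi * z0 $ i = of_int l * pi" by (auto simp: sin_zero_iff_int2)
      then show False using i by simp
    qed
    then have "(cos (pi * z0 $ i))\<^sup>2 < 1" using c1[of "pi * z0 $ i"] by simp
    moreover have "(\<Prod>j\<in>UNIV - {i}. (cos (pi * z0 $ j))\<^sup>2) \<le> 1"
      by (intro prod_le_1) (auto simp: c1)
    ultimately show ?thesis
      using mult_left_mono[of "\<Prod>j\<in>UNIV - {i}. (cos (pi * z0 $ j))\<^sup>2" 1 "(cos (pi * z0 $ i))\<^sup>2"]
      by (subst prod.remove[of _ i]) auto
  qed
  then have "r z0 < 1" unfolding r_def by (simp add: real_root_lt_1_iff)
  then have "(\<lambda>M. (2 * (real M * r z0 ^ M)) ^ CARD('n)) \<longlonglongrightarrow> (2 * 0) ^ CARD('n)"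
    using r0 by (intro tendsto_intros powser_times_n_limit_0) auto
  then have "\<forall>\<^sub>F M in sequentially. (2 * (real M * r z0 ^ M)) ^ CARD('n) < e"
    using e by (intro order_tendstoD) (auto simp: power_0_left)
  then show ?thesis
    using eventually_gt_at_top[of 0]
  proof eventually_elim
    case (elim M)
    have "trig_kernel M z \<le> e" if z: "z \<in> S" for z
    proof -
      have "trig_kernel M z \<le> (2 * real M * r z ^ M) ^ CARD('n)"
        using trig_kernel_le[OF elim(2), of z] by (simp add: r_def)
      also have "\<dots> \<le> (2 * real M * r z0 ^ M) ^ CARD('n)"
        using z0(2)[OF z] r0[of z] by (intro power_mono mult_left_mono) auto
      finally show ?thesis using elim(1) by (simp add: mult_ac)
    qed
    then show ?case by blast
  qed
qed auto

lemma integral_cos_lattice: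
  assumes "m \<noteq> (\<lambda>_. 0)"
  shows "integral (cbox 0 One) (\<lambda>x. cos (lattice_freq m \<bullet> x)) = 0"
    and "integral (cbox 0 One) (\<lambda>x. sin (lattice_freq m \<bullet> x)) = 0"
proof -
  let ?w = "lattice_freq m"
  have "?w \<noteq> 0" using assms by simp
  then obtain u where u: "u \<in> Basis" "?w \<bullet> u \<noteq> 0" by (metis euclidean_all_zero_iff)
  obtain l :: int where l: "?w \<bullet> u = of_int l * (2 * pi)"
    using lattice_freq_inner_Basis[OF u(1), of m] by (metis mult.commute)
  have d: "((\<lambda>\<tau>. ?w \<bullet> (x + \<tau> *\<^sub>R u)) has_real_derivative ?w \<bullet> u) (at \<tau>)" for x \<tau>
    unfolding inner_add_right inner_scaleR_right by (auto intro!: derivative_eq_intros)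
  have p: "sin (?w \<bullet> (x + u)) = sin (?w \<bullet> x)" "cos (?w \<bullet> (x + u)) = cos (?w \<bullet> x)" for x
    unfolding inner_add_right l
    using sin.plus_of_int[of "?w \<bullet> x" l] cos.plus_of_int[of "?w \<bullet> x" l] by simp_all
  show "integral (cbox 0 One) (\<lambda>x. cos (?w \<bullet> x)) = 0"
  proof (rule integral_periodic_derivative[OF u(1), of "\<lambda>x. sin (?w \<bullet> x) / (?w \<bullet> u)"])
    show "((\<lambda>\<tau>. sin (?w \<bullet> (x + \<tau> *\<^sub>R u)) / (?w \<bullet> u)) has_real_derivative cos (?w \<bullet> (x + \<tau> *\<^sub>R u))) (at \<tau>)" for x \<tau>
      using DERIV_cdivide[OF DERIV_chain2[OF DERIV_sin d], where c = "?w \<bullet> u"] u(2) by simp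
  qed (use u p in \<open>auto intro!: continuous_intros\<close>)
  show "integral (cbox 0 One) (\<lambda>x. sin (?w \<bullet> x)) = 0"
  proof (rule integral_periodic_derivative[OF u(1), of "\<lambda>x. - cos (?w \<bullet> x) / (?w \<bullet> u)"])
    show "((\<lambda>\<tau>. - cos (?w \<bullet> (x + \<tau> *\<^sub>R u)) / (?w \<bullet> u)) has_real_derivative sin (?w \<bullet> (x + \<tau> *\<^sub>R u))) (at \<tau>)" for x \<tau>
      using DERIV_cdivide[OF DERIV_minus[OF DERIV_chain2[OF DERIV_cos d]], where c = "?w \<bullet> u"] u(2) by simp
  qed (use u p in \<open>auto intro!: continuous_intros\<close>)
qed

lemma trig_kernel_diff:
  "trig_kernel M (x - y) = (\<Sum>m\<in>freq_box M. kernel_coeff M m *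
     (cos (lattice_freq m \<bullet> x) * cos (lattice_freq m \<bullet> y) + sin (lattice_freq m \<bullet> x) * sin (lattice_freq m \<bullet> y)))"
  by (simp add: trig_kernel_def inner_diff_right cos_diff)

text \<open>Nonzero frequencies integrate to 0 over a period, and frequency 0 has coefficient
  1.\<close>

lemma integral_trig_kernel: "integral (cbox 0 One) (\<lambda>x::real^'n. trig_kernel M (x - y)) = 1"
proof -
  let ?w = "lattice_freq :: ('n \<Rightarrow> int) \<Rightarrow> real ^ 'n"
  have c: "((\<lambda>x. cos (?w m \<bullet> x)) has_integral (if m = (\<lambda>_. 0) then 1 else 0)) (cbox 0 One)" for m
  proof (cases "m = (\<lambda>_. 0)")
    case True
    then have "lattice_freq m = 0" by simp
    then show ?thesis using True has_integral_const[of "1::real" 0 "One :: real ^ 'n"] by simp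
  next
    case False
    have "(\<lambda>x. cos (?w m \<bullet> x)) integrable_on cbox 0 One"
      by (intro integrable_continuous continuous_intros)
    then show ?thesis using False by (simp add: has_integral_iff integral_cos_lattice)
  qed
  have s: "((\<lambda>x. sin (?w m \<bullet> x)) has_integral 0) (cbox 0 One)" for m
  proof (cases "m = (\<lambda>_. 0)")
    case True
    then have "lattice_freq m = 0" by simp
    then show ?thesis by simp
  next
    case False
    have "(\<lambda>x. sin (?w m \<bullet> x)) integrable_on cbox 0 One"
      by (intro integrable_continuous continuous_intros)
    then show ?thesis using False by (simp add: has_integral_iff integral_cos_lattice)
  qed
  have "((\<lambda>x. \<Sum>m\<in>freq_box M. kernel_coeff M m *
     (cos (?w m \<bullet> x) * cos (?w m \<bullet> y) + sin (?w m \<bullet> x) * sin (?w m \<bullet> y))) has_integral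
     (\<Sum>m\<in>freq_box M. kernel_coeff M m * ((if m = (\<lambda>_. 0) then 1 else 0) * cos (?w m \<bullet> y) + 0 * sin (?w m \<bullet> y)))) (cbox 0 One)"
    by (intro has_integral_sum has_integral_mult_right has_integral_add has_integral_mult_left c s) simp
  also have "(\<Sum>m\<in>freq_box M. kernel_coeff M m * ((if m = (\<lambda>_. 0) then 1 else 0) * cos (?w m \<bullet> y) + 0 * sin (?w m \<bullet> y)))
    = (\<Sum>m\<in>(freq_box M :: ('n \<Rightarrow> int) set). if m = (\<lambda>_. 0) then 1 else 0)"
  proof (rule sum.cong)
    fix m :: "'n \<Rightarrow> int"
    show "kernel_coeff M m * ((if m = (\<lambda>_. 0) then 1 else 0) * cos (?w m \<bullet> y) + 0 * sin (?w m \<bullet> y))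
      = (if m = (\<lambda>_. 0) then 1 else 0)"
    proof (cases "m = (\<lambda>_. 0)")
      case True
      then have "lattice_freq m = 0" by simp
      then show ?thesis using True by simp
    qed simp
  qed simp
  finally show ?thesis unfolding trig_kernel_diff[symmetric] by (simp add: integral_unique)
qed

section \<open>Duality and trigonometric vector fields\<close>

lemma bcontfun_scaleR_const:
  fixes E :: "'e::real_normed_vector"
  assumes f: "f \<in> bcontfun"
  shows "(\<lambda>y. f y *\<^sub>R E) \<in> bcontfun"
proof -
  obtain C :: real where C: "\<And>x. norm (f x) \<le> C" using f by (auto simp: bcontfun_def bounded_iff)
  show ?thesis
  proof (rule bcontfun_normI)
    show "continuous_on UNIV (\<lambda>y. f y *\<^sub>R E)" using f by (auto simp: bcontfun_def intro!: continuous_intros)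
    show "norm (f y *\<^sub>R E) \<le> C * norm E" for y using C[of y] by (simp add: mult_right_mono)
  qed
qed

lemma linear_Bcontfun_scaleR:
  fixes f :: "'a::topological_space \<Rightarrow> real" and v :: "('a \<Rightarrow>\<^sub>C 'e::real_normed_vector) \<Rightarrow> real"
  assumes v: "linear v" and f: "f \<in> bcontfun"
  shows "linear (\<lambda>E. v (Bcontfun (\<lambda>y. f y *\<^sub>R E)))"
proof -
  note mem = bcontfun_scaleR_const[OF f]
  show ?thesis
  proof (rule linearI)
    fix E E' :: 'e and r :: real
    have "Bcontfun (\<lambda>y. f y *\<^sub>R (E + E')) = Bcontfun (\<lambda>y. f y *\<^sub>R E) + Bcontfun (\<lambda>y. f y *\<^sub>R E')"
      by (rule bcontfun_eqI, subst Bcontfun_inverse[OF mem]) (simp add: Bcontfun_inverse mem scaleR_add_right)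
    then show "v (Bcontfun (\<lambda>y. f y *\<^sub>R (E + E'))) = v (Bcontfun (\<lambda>y. f y *\<^sub>R E)) + v (Bcontfun (\<lambda>y. f y *\<^sub>R E'))"
      using v by (simp add: linear_add)
    have "Bcontfun (\<lambda>y. f y *\<^sub>R (r *\<^sub>R E)) = r *\<^sub>R Bcontfun (\<lambda>y. f y *\<^sub>R E)"
      by (rule bcontfun_eqI, subst Bcontfun_inverse[OF mem]) (simp add: Bcontfun_inverse mem mult.commute)
    then show "v (Bcontfun (\<lambda>y. f y *\<^sub>R (r *\<^sub>R E))) = r *\<^sub>R v (Bcontfun (\<lambda>y. f y *\<^sub>R E))"
      using v by (simp add: linear_cmul)
  qed
qed

lemma cos_sin_inner_bcontfun:
  "(\<lambda>y. cos ((k::'a::real_inner) \<bullet> y)) \<in> bcontfun" "(\<lambda>y. sin (k \<bullet> y)) \<in> bcontfun"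
  by (rule bcontfun_normI[where b = 1]; auto intro!: continuous_intros)+

text \<open>The vector that represents \<open>E\<close> mapped to \<open>v\<close> of the wave
  \<open>cos (k \<bullet> y) *\<^sub>R E\<close> as an inner product, found by applying the adjoint
  to 1. The functional \<open>v\<close> plays the role of a vector-valued measure seen through its
  Fourier coefficients.\<close>

definition cos_coeff :: "(('a::euclidean_space \<Rightarrow>\<^sub>C 'e::euclidean_space) \<Rightarrow> real) \<Rightarrow> 'a \<Rightarrow> 'e"
  where "cos_coeff v k = adjoint (\<lambda>E. v (Bcontfun (\<lambda>y. cos (k \<bullet> y) *\<^sub>R E))) 1"

definition sin_coeff :: "(('a::euclidean_space \<Rightarrow>\<^sub>C 'e::euclidean_space) \<Rightarrow> real) \<Rightarrow> 'a \<Rightarrow> 'e"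
  where "sin_coeff v k = adjoint (\<lambda>E. v (Bcontfun (\<lambda>y. sin (k \<bullet> y) *\<^sub>R E))) 1"

lemma
  assumes v: "linear v"
  shows inner_cos_coeff: "E \<bullet> cos_coeff v k = v (Bcontfun (\<lambda>y. cos (k \<bullet> y) *\<^sub>R E))"
    and inner_sin_coeff: "E \<bullet> sin_coeff v k = v (Bcontfun (\<lambda>y. sin (k \<bullet> y) *\<^sub>R E))"
  unfolding cos_coeff_def sin_coeff_def
  using adjoint_works[OF linear_Bcontfun_scaleR[OF v cos_sin_inner_bcontfun(1)], of E k 1]
    adjoint_works[OF linear_Bcontfun_scaleR[OF v cos_sin_inner_bcontfun(2)], of E k 1]
  by simp_all

text \<open>The sum is the convolution of \<open>v\<close> with the kernel, and its L1 norm is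
  computed by duality: it is nearly attained on a regularised direction field \<psi> of the sum, and
  that pairing equals \<open>v\<close> at the convolution of \<psi> with the kernel. The latter has
  norm at most 1 since the kernel is nonnegative with integral 1.\<close>

lemma integral_norm_heat_sum_le:
  fixes v :: "((real ^ 'n) \<Rightarrow>\<^sub>C 'e::euclidean_space) \<Rightarrow> real"
  assumes v: "linear v" and bd: "\<And>\<phi>. \<bar>v \<phi>\<bar> \<le> \<epsilon> * norm \<phi>" and \<epsilon>: "0 \<le> \<epsilon>"
  shows "integral (cbox 0 One) (\<lambda>x. norm (heat_sum (freq_box M) lattice_freq
    (\<lambda>m. kernel_coeff M m *\<^sub>R cos_coeff v (lattice_freq m))
    (\<lambda>m. kernel_coeff M m *\<^sub>R sin_coeff v (lattice_freq m)) 0 x)) \<le> \<epsilon>"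
    (is "integral _ (\<lambda>x. norm (?U x)) \<le> _")
proof (rule field_le_epsilon)
  fix \<eta> :: real assume \<eta>: "0 < \<eta>"
  let ?w = "lattice_freq :: ('n \<Rightarrow> int) \<Rightarrow> real ^ 'n" and ?b = "kernel_coeff M"
  \<comment> \<open>Dividing by \<open>R\<close> instead of the norm keeps \<psi> continuous at the
    zeros of the sum, at a cost of at most \<eta>.\<close>
  define R where "R x = sqrt (\<eta>\<^sup>2 + (norm (?U x))\<^sup>2)" for x
  define \<psi> where "\<psi> x = inverse (R x) *\<^sub>R ?U x" for x
  have R: "0 < R x" "norm (?U x) \<le> R x" "R x \<le> \<eta> + norm (?U x)" for x
  proof -
    show "0 < R x" unfolding R_def using \<eta> by (simp add: add_pos_nonneg)
    show "norm (?U x) \<le> R x" unfolding R_def by (simp add: real_le_rsqrt)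
    show "R x \<le> \<eta> + norm (?U x)" unfolding R_def using \<eta>
      by (intro real_le_lsqrt) (auto simp: power2_sum)
  qed
  have [continuous_intros]: "continuous_on S ?U" for S
    by (intro continuous_intros)
  have Rc [continuous_intros]: "continuous_on S R" for S
    unfolding R_def by (intro continuous_intros)
  have [continuous_intros]: "continuous_on S \<psi>" for S
    unfolding \<psi>_def using R(1) by (intro continuous_intros) (auto simp: less_imp_neq[THEN not_sym])
  have \<psi>1: "norm (\<psi> x) \<le> 1" for x
    using R[of x] by (simp add: \<psi>_def divide_simps)
  have U\<psi>: "norm (?U x) - \<eta> \<le> ?U x \<bullet> \<psi> x" for x
  proof -
    define n where "n = norm (?U x)"
    have "(n - \<eta>) * R x \<le> n * n"
    proof (cases "\<eta> \<le> n")
      case True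
      then have "(n - \<eta>) * R x \<le> (n - \<eta>) * (n + \<eta>)"
        using R(3)[of x] by (intro mult_left_mono) (auto simp: n_def)
      also have "\<dots> \<le> n * n" by (simp add: algebra_simps)
      finally show ?thesis .
    next
      case False
      then have "(n - \<eta>) * R x \<le> 0" using R(1)[of x] by (intro mult_nonpos_nonneg) auto
      then show ?thesis by (smt (verit) zero_le_square)
    qed
    then have "n - \<eta> \<le> n * n / R x" using R(1)[of x] by (simp add: field_simps)
    then show ?thesis by (simp add: \<psi>_def n_def dot_square_norm power2_eq_square divide_inverse mult.commute)
  qed
  define Pc where "Pc m = integral (cbox 0 One) (\<lambda>x. cos (?w m \<bullet> x) *\<^sub>R \<psi> x)" for m
  define Ps where "Ps m = integral (cbox 0 One) (\<lambda>x. sin (?w m \<bullet> x) *\<^sub>R \<psi> x)" for m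
  have Pc: "((\<lambda>x. cos (?w m \<bullet> x) *\<^sub>R \<psi> x) has_integral Pc m) (cbox 0 One)"
    and Ps: "((\<lambda>x. sin (?w m \<bullet> x) *\<^sub>R \<psi> x) has_integral Ps m) (cbox 0 One)" for m
    unfolding Pc_def Ps_def by (intro integrable_integral integrable_continuous continuous_intros)+
  \<comment> \<open>The convolution of \<psi> with the kernel, expanded in waves so that
    \<open>v\<close> can be evaluated term by term.\<close>
  define \<phi> where "\<phi> y = (\<Sum>m\<in>freq_box M. ?b m *\<^sub>R (cos (?w m \<bullet> y) *\<^sub>R Pc m + sin (?w m \<bullet> y) *\<^sub>R Ps m))" for y
  have "((\<lambda>x. \<Sum>m\<in>freq_box M. ?b m *\<^sub>R (cos (?w m \<bullet> y) *\<^sub>R (cos (?w m \<bullet> x) *\<^sub>R \<psi> x)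
     + sin (?w m \<bullet> y) *\<^sub>R (sin (?w m \<bullet> x) *\<^sub>R \<psi> x))) has_integral \<phi> y) (cbox 0 One)" for y
    unfolding \<phi>_def by (intro has_integral_sum has_integral_cmul has_integral_add Pc Ps) simp
  moreover have "(\<Sum>m\<in>freq_box M. ?b m *\<^sub>R (cos (?w m \<bullet> y) *\<^sub>R (cos (?w m \<bullet> x) *\<^sub>R \<psi> x)
     + sin (?w m \<bullet> y) *\<^sub>R (sin (?w m \<bullet> x) *\<^sub>R \<psi> x))) = trig_kernel M (x - y) *\<^sub>R \<psi> x" for x y
    unfolding trig_kernel_diff scaleR_sum_left by (simp add: algebra_simps)
  ultimately have \<phi>: "((\<lambda>x. trig_kernel M (x - y) *\<^sub>R \<psi> x) has_integral \<phi> y) (cbox 0 One)" for y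
    by simp
  have kc [continuous_intros]: "continuous_on S (\<lambda>x. trig_kernel M (x - y))" for S and y :: "real ^ 'n"
    unfolding trig_kernel_def by (intro continuous_intros)
  have \<phi>1: "norm (\<phi> y) \<le> 1" for y
  proof -
    have "norm (integral (cbox 0 One) (\<lambda>x. trig_kernel M (x - y) *\<^sub>R \<psi> x)) \<le> integral (cbox 0 One) (\<lambda>x. trig_kernel M (x - y))"
      using \<psi>1 trig_kernel_nonneg[of M]
      by (intro integral_norm_bound_integral integrable_continuous continuous_intros) (auto simp: abs_of_nonneg[OF trig_kernel_nonneg] intro!: mult_left_le)
    then show ?thesis using \<phi>[of y] by (simp add: integral_trig_kernel integral_unique)
  qed
  have \<phi>b: "\<phi> \<in> bcontfun"
    by (rule bcontfun_normI[OF _ \<phi>1]) (unfold \<phi>_def, intro continuous_intros)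
  have app: "apply_bcontfun (\<Sum>i\<in>J. g i) y = (\<Sum>i\<in>J. apply_bcontfun (g i) y)"
    for g :: "('n \<Rightarrow> int) \<Rightarrow> (real ^ 'n) \<Rightarrow>\<^sub>C 'e" and J y
    by (induction J rule: infinite_finite_induct) auto
  have "Bcontfun \<phi> = (\<Sum>m\<in>freq_box M. ?b m *\<^sub>R (Bcontfun (\<lambda>y. cos (?w m \<bullet> y) *\<^sub>R Pc m) + Bcontfun (\<lambda>y. sin (?w m \<bullet> y) *\<^sub>R Ps m)))"
    by (rule bcontfun_eqI)
      (simp add: app Bcontfun_inverse \<phi>b bcontfun_scaleR_const cos_sin_inner_bcontfun, simp add: \<phi>_def)
  then have "v (Bcontfun \<phi>) = (\<Sum>m\<in>freq_box M. ?b m * (Pc m \<bullet> cos_coeff v (?w m) + Ps m \<bullet> sin_coeff v (?w m)))"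
    using v by (simp add: linear_sum linear_add linear_cmul inner_cos_coeff inner_sin_coeff)
  moreover have "((\<lambda>x. \<Sum>m\<in>freq_box M. ?b m * ((cos (?w m \<bullet> x) *\<^sub>R \<psi> x) \<bullet> cos_coeff v (?w m) + (sin (?w m \<bullet> x) *\<^sub>R \<psi> x) \<bullet> sin_coeff v (?w m)))
    has_integral (\<Sum>m\<in>freq_box M. ?b m * (Pc m \<bullet> cos_coeff v (?w m) + Ps m \<bullet> sin_coeff v (?w m)))) (cbox 0 One)"
    by (intro has_integral_sum has_integral_mult_right has_integral_add
      has_integral_linear[OF Pc bounded_linear_inner_left, unfolded o_def] has_integral_linear[OF Ps bounded_linear_inner_left, unfolded o_def]) simp
  moreover have "(\<Sum>m\<in>freq_box M. ?b m * ((cos (?w m \<bullet> x) *\<^sub>R \<psi> x) \<bullet> cos_coeff v (?w m) + (sin (?w m \<bullet> x) *\<^sub>R \<psi> x) \<bullet> sin_coeff v (?w m)))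
     = ?U x \<bullet> \<psi> x" for x
    unfolding heat_sum_def inner_sum_left
    by (intro sum.cong) (simp_all add: inner_add_left inner_commute algebra_simps)
  ultimately have int: "((\<lambda>x. ?U x \<bullet> \<psi> x) has_integral v (Bcontfun \<phi>)) (cbox 0 One)"
    by simp
  have "v (Bcontfun \<phi>) \<le> \<epsilon> * norm (Bcontfun \<phi>)" using bd[of "Bcontfun \<phi>"] by simp
  also have "\<dots> \<le> \<epsilon> * 1"
    using \<phi>1 \<epsilon> by (intro mult_left_mono norm_bound) (simp_all add: Bcontfun_inverse \<phi>b)
  finally have vb: "v (Bcontfun \<phi>) \<le> \<epsilon>" by simp
  have "integral (cbox 0 One) (\<lambda>x. norm (?U x) - \<eta>) \<le> integral (cbox 0 One) (\<lambda>x. ?U x \<bullet> \<psi> x)"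
    using U\<psi> by (intro integral_le integrable_continuous continuous_intros)
  moreover have "integral (cbox 0 One) (\<lambda>x. norm (?U x) - \<eta>) = integral (cbox 0 One) (\<lambda>x. norm (?U x)) - \<eta>"
    by (subst integral_diff) (auto intro!: integrable_continuous continuous_intros)
  ultimately show "integral (cbox 0 One) (\<lambda>x. norm (?U x)) \<le> \<epsilon> + \<eta>"
    using vb int by (simp add: integral_unique)
qed

section \<open>Rank-one matrices and trigonometric vector fields\<close>

definition outer :: "real ^ 'm \<Rightarrow> real ^ 'n \<Rightarrow> real ^ 'n ^ 'm"
  where "outer a k = (\<chi> i j. a $ i * k $ j)"

lemma outer_inner: "outer a k \<bullet> B = a \<bullet> (B *v k)"
  by (simp add: outer_def inner_vec_def matrix_vector_mult_def sum_distrib_left mult_ac)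

lemma trace_outer: "trace (outer a k) = a \<bullet> k"
  by (simp add: outer_def trace_def inner_vec_def)

lemma outer_scaleR: "outer (r *\<^sub>R a) k = r *\<^sub>R outer a k" "outer a (r *\<^sub>R k) = r *\<^sub>R outer a k"
  by (simp_all add: outer_def vec_eq_iff)

lemma outer_mult_vec: "outer a k *v h = (k \<bullet> h) *\<^sub>R a"
  by (simp add: outer_def vec_eq_iff inner_vec_def matrix_vector_mult_def sum_distrib_left sum_distrib_right mult_ac)

lemma norm_matrix_vector_mult_le:
  fixes A :: "real ^ 'n ^ 'm"
  shows "norm (A *v x) \<le> norm A * norm x"
proof (rule power2_le_imp_le)
  have "(norm (A *v x))\<^sup>2 = (\<Sum>i\<in>UNIV. (A $ i \<bullet> x)\<^sup>2)"
    unfolding power2_norm_eq_inner inner_vec_def[of "A *v x"] matrix_vector_mul_component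
    by (simp add: power2_eq_square)
  also have "\<dots> \<le> (\<Sum>i\<in>UNIV. (A $ i \<bullet> A $ i) * (x \<bullet> x))"
    by (intro sum_mono Cauchy_Schwarz_ineq)
  also have "\<dots> = (norm A * norm x)\<^sup>2"
    by (simp add: power_mult_distrib power2_norm_eq_inner inner_vec_def[of A] sum_distrib_right)
  finally show "(norm (A *v x))\<^sup>2 \<le> (norm A * norm x)\<^sup>2" .
qed simp

lemma abs_trace_le:
  fixes A :: "real ^ 'n ^ 'n"
  shows "\<bar>trace A\<bar> \<le> (\<Sum>i\<in>UNIV. norm (A $ i))"
  unfolding trace_def by (rule order_trans[OF sum_abs]) (intro sum_mono component_le_norm_cart)

text \<open>A field and its derivative matrix are generated together from plane waves with
  frequencies in \<open>W\<close>; the phase \<beta> supplies the sines. Rule induction then gives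
  every property wave by wave. \<open>W\<close> is \<open>range lattice_freq\<close> for periodic
  fields and \<open>UNIV\<close> after rescaling.\<close>

inductive trig_field :: "(real ^ 'n) set \<Rightarrow> (real ^ 'n \<Rightarrow> real ^ 'n) \<Rightarrow> (real ^ 'n \<Rightarrow> real ^ 'n ^ 'n) \<Rightarrow> bool"
  for W where
  zero: "trig_field W (\<lambda>x. 0) (\<lambda>x. 0)"
| wave: "k \<in> W \<Longrightarrow> trig_field W (\<lambda>x. cos (k \<bullet> x + \<beta>) *\<^sub>R a) (\<lambda>x. - sin (k \<bullet> x + \<beta>) *\<^sub>R outer a k)"
| add: "trig_field W F D \<Longrightarrow> trig_field W G D' \<Longrightarrow> trig_field W (\<lambda>x. F x + G x) (\<lambda>x. D x + D' x)"

lemma trig_field_scale: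
  "trig_field W F D \<Longrightarrow> trig_field W (\<lambda>x. r *\<^sub>R F x) (\<lambda>x. r *\<^sub>R D x)"
proof (induction rule: trig_field.induct)
  case zero
  then show ?case using trig_field.zero by simp
next
  case (wave k \<beta> a)
  then show ?case using trig_field.wave[of k W \<beta> "r *\<^sub>R a"] by (simp add: outer_scaleR mult.commute)
next
  case (add F D G D')
  then show ?case using trig_field.add by (simp add: scaleR_add_right)
qed

lemma trig_field_diff:
  assumes "trig_field W F D" "trig_field W G D'"
  shows "trig_field W (\<lambda>x. F x - G x) (\<lambda>x. D x - D' x)"
  using trig_field.add[OF assms(1) trig_field_scale[OF assms(2), of "-1"]] by simp

lemma trig_field_rescale:
  assumes \<delta>: "\<delta> \<noteq> 0"
  shows "trig_field W F D \<Longrightarrow> trig_field UNIV (\<lambda>x. \<delta> *\<^sub>R F ((1 / \<delta>) *\<^sub>R x)) (\<lambda>x. D ((1 / \<delta>) *\<^sub>R x))"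
proof (induction rule: trig_field.induct)
  case zero
  then show ?case using trig_field.zero by simp
next
  case (wave k \<beta> a)
  then show ?case
    using trig_field.wave[of "(1 / \<delta>) *\<^sub>R k" UNIV \<beta> "\<delta> *\<^sub>R a"] \<delta> by (simp add: outer_scaleR mult.commute)
next
  case (add F D G D')
  then show ?case using trig_field.add by (simp add: scaleR_add_right)
qed

lemma trig_field_bounded: "trig_field W F D \<Longrightarrow> \<exists>B. \<forall>x. norm (D x) \<le> B"
proof (induction rule: trig_field.induct)
  case (wave k \<beta> a)
  have "norm (- sin (k \<bullet> x + \<beta>) *\<^sub>R outer a k) \<le> norm (outer a k)" for x
    by (simp add: mult_left_le_one_le)
  then show ?case by blast
next
  case (add F D G D')
  then obtain B B' where B: "\<And>x. norm (D x) \<le> B" "\<And>x. norm (D' x) \<le> B'" by blast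
  have "norm (D x + D' x) \<le> B + B'" for x
    using norm_triangle_ineq[of "D x" "D' x"] B[of x] by linarith
  then show ?case by blast
qed auto

lemma trig_field_continuous:
  "trig_field W F D \<Longrightarrow> continuous_on S F \<and> continuous_on S D"
proof (induction rule: trig_field.induct)
  case (wave k \<beta> a)
  then show ?case by (auto intro!: continuous_intros)
qed (auto intro!: continuous_intros)

lemma trig_field_has_derivative:
  "trig_field W F D \<Longrightarrow> (F has_derivative (\<lambda>h. D x *v h)) (at x)"
proof (induction rule: trig_field.induct)
  case (wave k \<beta> a)
  have "((\<lambda>x. cos (k \<bullet> x + \<beta>) *\<^sub>R a) has_derivative (\<lambda>h. (- sin (k \<bullet> x + \<beta>) * (k \<bullet> h)) *\<^sub>R a)) (at x)"
    by (auto intro!: derivative_eq_intros)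
  moreover have "(- sin (k \<bullet> x + \<beta>) *\<^sub>R outer a k) *v h = (- sin (k \<bullet> x + \<beta>) * (k \<bullet> h)) *\<^sub>R a" for h
    by (simp only: outer_scaleR(1)[symmetric] outer_mult_vec scaleR_scaleR mult.commute)
  ultimately show ?case by simp
next
  case (add F D G D')
  then show ?case by (auto intro!: derivative_eq_intros simp: matrix_vector_mult_add_rdistrib)
qed simp

lemma trig_field_lipschitz:
  assumes F: "trig_field W F D" and B: "\<And>x. norm (D x) \<le> B"
  shows "norm (F x - F y) \<le> B * norm (x - y)"
proof (rule differentiable_bound[where S = UNIV and f' = "\<lambda>x h. D x *v h"])
  show "onorm ((*v) (D x)) \<le> B" for x
    using norm_matrix_vector_mult_le[of "D x"] B[of x]
    by (intro onorm_le) (meson mult_right_mono norm_ge_zero order_trans)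
qed (use trig_field_has_derivative[OF F] in auto)

lemma trig_field_lattice_periodic:
  "trig_field (range lattice_freq) F D \<Longrightarrow> F (\<chi> i. frac (x $ i)) = F x"
proof (induction rule: trig_field.induct)
  case (wave k \<beta> a)
  then obtain m where k: "k = lattice_freq m" by blast
  have "k \<bullet> x + \<beta> = (k \<bullet> (\<chi> i. frac (x $ i)) + \<beta>) + of_int (\<Sum>i\<in>UNIV. m i * \<lfloor>x $ i\<rfloor>) * (2 * pi)"
  proof -
    have "2 * pi * of_int (m i) * (x $ i) = 2 * pi * of_int (m i) * frac (x $ i) + of_int (m i * \<lfloor>x $ i\<rfloor>) * (2 * pi)" for i
      by (simp add: frac_def algebra_simps)
    then show ?thesis
      unfolding k lattice_freq_def inner_vec_def
      by (simp add: sum.distrib sum_distrib_right)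
  qed
  then obtain s :: int where E: "k \<bullet> x + \<beta> = (k \<bullet> (\<chi> i. frac (x $ i)) + \<beta>) + of_int s * (2 * pi)"
    by blast
  have "cos (a + of_int s * (2 * pi)) = cos a" for a
    using cos.plus_of_int[of a s] by simp
  then have "cos (k \<bullet> x + \<beta>) = cos (k \<bullet> (\<chi> i. frac (x $ i)) + \<beta>)"
    unfolding E .
  then show ?case by simp
qed auto

section \<open>Differential subordination\<close>

lemma heat_sum_decay:
  fixes P Q :: "'k \<Rightarrow> 'b::real_normed_vector"
  assumes "\<And>k. k \<in> I \<Longrightarrow> 1 \<le> w k \<bullet> w k \<or> P k = 0 \<and> Q k = 0" and t: "0 \<le> t"
  shows "norm (heat_sum I w P Q t x) \<le> exp (- t) * (\<Sum>k\<in>I. norm (P k) + norm (Q k))"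
  unfolding heat_sum_def sum_distrib_left
proof (rule sum_norm_le)
  fix k assume "k \<in> I"
  then consider "1 \<le> w k \<bullet> w k" | "P k = 0" "Q k = 0" using assms(1) by blast
  then show "norm (exp (- t * (w k \<bullet> w k)) *\<^sub>R (cos (w k \<bullet> x) *\<^sub>R P k + sin (w k \<bullet> x) *\<^sub>R Q k))
    \<le> exp (- t) * (norm (P k) + norm (Q k))"
  proof cases
    case 1
    have "norm (cos (w k \<bullet> x) *\<^sub>R P k + sin (w k \<bullet> x) *\<^sub>R Q k) \<le> norm (P k) + norm (Q k)"
      by (rule norm_triangle_le) (auto intro!: add_mono mult_left_le_one_le)
    moreover have "exp (- t * (w k \<bullet> w k)) \<le> exp (- t)"
      using mult_left_mono[OF 1 t] by simp
    ultimately show ?thesis by (simp add: mult_mono del: exp_le_cancel_iff)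
  qed simp
qed

text \<open>The integral increases along the flow, and at time \<open>t\<close> it is at most
  \<open>(exp (- t) * S)\<^sup>2\<close>, because \<open>bellman\<close> is bounded by the square of
  the scalar part. Accordingly \<open>mean0\<close> concerns \<open>p\<close> and \<open>q\<close>
  only; the matrix part may keep its mean.\<close>

lemma bellman_integral_le_0:
  fixes w :: "'k \<Rightarrow> 'a::euclidean_space" and P Q :: "'k \<Rightarrow> 'v::real_inner" and p q :: "'k \<Rightarrow> real"
  assumes lattice: "\<And>k u. k \<in> I \<Longrightarrow> u \<in> Basis \<Longrightarrow> \<exists>m::int. w k \<bullet> u = 2 * pi * of_int m"
    and sub: "\<And>t x. (\<Sum>u\<in>Basis. (heat_sum_deriv I w p q u t x)\<^sup>2)
        \<le> N * (\<Sum>u\<in>Basis. (norm (heat_sum_deriv I w P Q u t x))\<^sup>2)"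
    and c: "12 + 20 * N \<le> c" "0 \<le> c"
    and mean0: "\<And>k. k \<in> I \<Longrightarrow> 1 \<le> w k \<bullet> w k \<or> p k = 0 \<and> q k = 0"
  shows "integral (cbox 0 One) (\<lambda>x. bellman c (heat_sum I w P Q 0 x) (heat_sum I w p q 0 x)) \<le> 0"
proof -
  define S where "S = (\<Sum>k\<in>I. norm (p k) + norm (q k))"
  have "integral (cbox 0 One) (\<lambda>x. bellman c (heat_sum I w P Q 0 x) (heat_sum I w p q 0 x)) \<le> (exp (- t) * S)\<^sup>2"
    if t: "0 \<le> t" for t
  proof -
    have "integral (cbox 0 One) (\<lambda>x. bellman c (heat_sum I w P Q 0 x) (heat_sum I w p q 0 x))
      \<le> integral (cbox 0 One) (\<lambda>x. bellman c (heat_sum I w P Q t x) (heat_sum I w p q t x))"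
      by (rule bellman_heat_mono[OF lattice sub c t])
    also have "\<dots> \<le> integral (cbox 0 (One::'a)) (\<lambda>x. (exp (- t) * S)\<^sup>2)"
    proof (rule integral_le)
      show "bellman c (heat_sum I w P Q t x) (heat_sum I w p q t x) \<le> (exp (- t) * S)\<^sup>2" for x
      proof (rule order_trans[OF bellman_le[OF c(2)]])
        have "\<bar>heat_sum I w p q t x\<bar> \<le> exp (- t) * S"
          using heat_sum_decay[of I w p q t x] mean0 t by (simp add: S_def)
        then show "(heat_sum I w p q t x)\<^sup>2 \<le> (exp (- t) * S)\<^sup>2"
          by (metis abs_ge_zero order_trans power2_abs power_mono)
      qed
    qed (auto intro!: integrable_continuous continuous_intros)
    finally show ?thesis by simp
  qed
  then have ev: "\<forall>\<^sub>F t in at_top. integral (cbox 0 One) (\<lambda>x. bellman c (heat_sum I w P Q 0 x) (heat_sum I w p q 0 x))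
      \<le> (exp (- t) * S)\<^sup>2"
    unfolding eventually_at_top_linorder by blast
  have "((\<lambda>t. (exp (- t) * S)\<^sup>2) \<longlongrightarrow> (0 * S)\<^sup>2) at_top"
    by (intro tendsto_intros filterlim_compose[OF exp_at_bot] filterlim_uminus_at_bot_at_top)
  from tendsto_lowerbound[OF this ev] show ?thesis by simp
qed

lemma sum_Basis_vec:
  fixes f :: "real ^ 'n \<Rightarrow> 'b::comm_monoid_add"
  shows "(\<Sum>u\<in>Basis. f u) = (\<Sum>j\<in>UNIV. f (axis j 1))"
proof (rule sum.reindex_bij_betw[symmetric])
  show "bij_betw (\<lambda>j. axis j 1) UNIV (Basis :: (real ^ 'n) set)"
    by (auto simp: bij_betw_def inj_def axis_eq_axis Basis_vec_def)
qed

lemma heat_sum_component: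
  "heat_sum I w P Q t x $ i = heat_sum I w (\<lambda>k. P k $ i) (\<lambda>k. Q k $ i) t x"
  unfolding heat_sum_def by (simp add: sum_component)

text \<open>The hypotheses say \<open>\<nabla>y = div V\<close>, the divergence being taken row by row.\<close>

lemma heat_sum_subordinate:
  fixes w :: "'k \<Rightarrow> real ^ 'n" and P Q :: "'k \<Rightarrow> real ^ 'n ^ 'n"
  assumes p: "\<And>k. k \<in> I \<Longrightarrow> p k *\<^sub>R w k = P k *v w k" and q: "\<And>k. k \<in> I \<Longrightarrow> q k *\<^sub>R w k = Q k *v w k"
  shows "(\<Sum>u\<in>Basis. (heat_sum_deriv I w p q u t x)\<^sup>2)
        \<le> real CARD('n) * (\<Sum>u\<in>Basis. (norm (heat_sum_deriv I w P Q u t x))\<^sup>2)"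
proof -
  define Z where "Z l = heat_sum_deriv I w P Q (axis l 1) t x" for l
  \<comment> \<open>Row \<open>j\<close> of the hypotheses, frequency by frequency: the derivative
    of the scalar sum along \<open>j\<close> is the divergence of row \<open>j\<close> of the matrix
    sum.\<close>
  have e: "heat_sum_deriv I w p q (axis j 1) t x = (\<Sum>l\<in>UNIV. Z l $ j $ l)" for j
  proof -
    have "(\<Sum>l\<in>UNIV. Z l $ j $ l) = (\<Sum>k\<in>I. \<Sum>l\<in>UNIV. exp (- t * (w k \<bullet> w k)) * (cos (w k \<bullet> x) * (w k $ l * Q k $ j $ l) - sin (w k \<bullet> x) * (w k $ l * P k $ j $ l)))"
      unfolding Z_def heat_sum_component heat_sum_def by (subst sum.swap) (simp add: inner_axis mult.assoc)
    also have "\<dots> = (\<Sum>k\<in>I. exp (- t * (w k \<bullet> w k)) * (cos (w k \<bullet> x) * (Q k *v w k) $ j - sin (w k \<bullet> x) * (P k *v w k) $ j))"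
      by (simp add: matrix_vector_mult_def sum_distrib_left sum_subtractf right_diff_distrib mult_ac)
    also have "\<dots> = heat_sum_deriv I w p q (axis j 1) t x"
      unfolding heat_sum_def by (intro sum.cong refl) (simp add: p[symmetric] q[symmetric] inner_axis mult_ac)
    finally show ?thesis ..
  qed
  have "(\<Sum>u\<in>Basis. (heat_sum_deriv I w p q u t x)\<^sup>2) = (\<Sum>j\<in>UNIV. (\<Sum>l\<in>UNIV. Z l $ j $ l)\<^sup>2)"
    unfolding sum_Basis_vec e ..
  also have "\<dots> \<le> (\<Sum>j\<in>UNIV. real CARD('n) * (\<Sum>l\<in>UNIV. (Z l $ j $ l)\<^sup>2))"
  proof (intro sum_mono)
    fix j
    \<comment> \<open>Cauchy-Schwarz against the constant 1; this is where the dimension enters the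
      subordination constant.\<close>
    show "(\<Sum>l\<in>UNIV. Z l $ j $ l)\<^sup>2 \<le> real CARD('n) * (\<Sum>l\<in>UNIV. (Z l $ j $ l)\<^sup>2)"
      using Cauchy_Schwarz_ineq_sum[of "\<lambda>_. 1" "\<lambda>l. Z l $ j $ l" "UNIV :: 'n set"] by simp
  qed
  also have "\<dots> = real CARD('n) * (\<Sum>l\<in>UNIV. \<Sum>j\<in>UNIV. (Z l $ j $ l)\<^sup>2)"
    by (subst sum.swap) (simp add: sum_distrib_left)
  also have "\<dots> \<le> real CARD('n) * (\<Sum>l\<in>UNIV. (norm (Z l))\<^sup>2)"
  proof (intro mult_left_mono sum_mono)
    fix l
    have "(\<Sum>j\<in>UNIV. (Z l $ j $ l)\<^sup>2) \<le> (\<Sum>j\<in>UNIV. Z l $ j \<bullet> Z l $ j)"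
    proof (intro sum_mono)
      fix j
      show "(Z l $ j $ l)\<^sup>2 \<le> Z l $ j \<bullet> Z l $ j"
        unfolding dot_square_norm using component_le_norm_cart[of "Z l $ j" l] by (metis abs_ge_zero power2_abs power_mono)
    qed
    then show "(\<Sum>j\<in>UNIV. (Z l $ j $ l)\<^sup>2) \<le> (norm (Z l))\<^sup>2"
      by (simp add: power2_norm_eq_inner inner_vec_def[of "Z l"])
  qed simp
  finally show ?thesis unfolding sum_Basis_vec Z_def .
qed

lemma trig_field_Bcontfun:
  assumes "trig_field W F D"
  shows "D \<in> bcontfun"
  using trig_field_bounded[OF assms] trig_field_continuous[OF assms, of UNIV]
  by (auto intro: bcontfun_normI)

text \<open>On derivative matrices the functional integrates the divergence of the field against
  \<nu>. \<open>H\<close> bounds it on the unit ball, hence by homogeneity by \<epsilon> times the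
  sup norm, and Hahn-Banach extends it to all bounded continuous matrix fields. The last conclusion
  is the weak form of \<nabla>\<nu> = div V.\<close>

lemma trig_field_dual:
  fixes \<nu> :: "(real ^ 'n) measure"
  assumes "prob_space \<nu>" and sets: "sets \<nu> = sets borel" and \<epsilon>: "0 < \<epsilon>"
    and H: "\<And>F D. trig_field W F D \<Longrightarrow> (\<And>x. norm (D x) \<le> 1) \<Longrightarrow> (\<integral>x. trace (D x) \<partial>\<nu>) \<le> \<epsilon>"
  obtains v :: "((real ^ 'n) \<Rightarrow>\<^sub>C (real ^ 'n ^ 'n)) \<Rightarrow> real"
  where "linear v" "\<And>\<phi>. \<bar>v \<phi>\<bar> \<le> \<epsilon> * norm \<phi>"
    "\<And>F D. trig_field W F D \<Longrightarrow> v (Bcontfun D) = (\<integral>x. trace (D x) \<partial>\<nu>)"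
proof -
  interpret prob_space \<nu> by fact
  define f where "f \<phi> = (\<integral>x. trace (apply_bcontfun \<phi> x) \<partial>\<nu>)" for \<phi> :: "(real ^ 'n) \<Rightarrow>\<^sub>C (real ^ 'n ^ 'n)"
  have int: "integrable \<nu> (\<lambda>x. trace (apply_bcontfun \<phi> x))" for \<phi> :: "(real ^ 'n) \<Rightarrow>\<^sub>C (real ^ 'n ^ 'n)"
  proof (rule integrable_const_bound)
    have "continuous_on UNIV (\<lambda>x. trace (apply_bcontfun \<phi> x))"
      unfolding trace_def by (intro continuous_intros) auto
    then show "(\<lambda>x. trace (apply_bcontfun \<phi> x)) \<in> borel_measurable \<nu>"
      using sets by (simp add: borel_measurable_continuous_onI measurable_cong_sets[OF sets refl])
    have "norm (trace (apply_bcontfun \<phi> x)) \<le> real CARD('n) * norm \<phi>" for x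
    proof -
      have "\<bar>trace (apply_bcontfun \<phi> x)\<bar> \<le> (\<Sum>i\<in>UNIV. norm (apply_bcontfun \<phi> x $ i))" by (rule abs_trace_le)
      also have "\<dots> \<le> (\<Sum>i\<in>(UNIV :: 'n set). norm \<phi>)"
        by (intro sum_mono order_trans[OF Finite_Cartesian_Product.norm_nth_le norm_bounded])
      finally show ?thesis by simp
    qed
    then show "AE x in \<nu>. norm (trace (apply_bcontfun \<phi> x)) \<le> real CARD('n) * norm \<phi>" by simp
  qed
  have tr: "trace (A + B) = trace A + trace B" "trace (r *\<^sub>R A) = r * trace A" for A B :: "real ^ 'n ^ 'n" and r
    by (simp_all add: trace_def sum.distrib sum_distrib_left)
  have fadd: "f (\<phi> + \<psi>) = f \<phi> + f \<psi>" and fscale: "f (r *\<^sub>R \<phi>) = r * f \<phi>" for \<phi> \<psi> r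
    unfolding f_def using int by (simp_all add: tr)
  define S where "S = {\<phi>. \<exists>F D. trig_field W F D \<and> \<phi> = Bcontfun D}"
  have SB: "f (Bcontfun D) = (\<integral>x. trace (D x) \<partial>\<nu>)" if "trig_field W F D" for F D
    by (simp add: f_def Bcontfun_inverse trig_field_Bcontfun[OF that])
  have sub: "subspace S"
    unfolding subspace_def
  proof (intro conjI ballI allI)
    have "0 = Bcontfun (\<lambda>x::real^'n. 0 :: real ^ 'n ^ 'n)" by (simp add: zero_bcontfun_def)
    then show "0 \<in> S" unfolding S_def using trig_field.zero by blast
  next
    fix \<phi> \<psi> assume "\<phi> \<in> S" "\<psi> \<in> S"
    then obtain F D G D' where FD: "trig_field W F D" "\<phi> = Bcontfun D" "trig_field W G D'" "\<psi> = Bcontfun D'"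
      unfolding S_def by blast
    have s: "trig_field W (\<lambda>x. F x + G x) (\<lambda>x. D x + D' x)" using FD trig_field.add by blast
    have "\<phi> + \<psi> = Bcontfun (\<lambda>x. D x + D' x)"
      by (rule bcontfun_eqI) (simp add: FD Bcontfun_inverse trig_field_Bcontfun[OF s] trig_field_Bcontfun[OF FD(1)] trig_field_Bcontfun[OF FD(3)])
    with s show "\<phi> + \<psi> \<in> S" unfolding S_def by blast
  next
    fix r :: real and \<phi> assume "\<phi> \<in> S"
    then obtain F D where FD: "trig_field W F D" "\<phi> = Bcontfun D"
      unfolding S_def by blast
    have s: "trig_field W (\<lambda>x. r *\<^sub>R F x) (\<lambda>x. r *\<^sub>R D x)" by (rule trig_field_scale[OF FD(1)])
    have "r *\<^sub>R \<phi> = Bcontfun (\<lambda>x. r *\<^sub>R D x)"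
      by (rule bcontfun_eqI) (simp add: FD Bcontfun_inverse trig_field_Bcontfun[OF s] trig_field_Bcontfun[OF FD(1)])
    with s show "r *\<^sub>R \<phi> \<in> S" unfolding S_def by blast
  qed
  have bd: "f \<phi> \<le> \<epsilon> * norm \<phi>" if \<phi>: "\<phi> \<in> S" for \<phi>
  proof (cases "\<phi> = 0")
    case False
    obtain F D where FD: "trig_field W F D" "\<phi> = Bcontfun D" using \<phi> unfolding S_def by blast
    have D: "D x = apply_bcontfun \<phi> x" for x by (simp add: FD Bcontfun_inverse trig_field_Bcontfun[OF FD(1)])
    have "(\<integral>x. trace ((1 / norm \<phi>) *\<^sub>R D x) \<partial>\<nu>) \<le> \<epsilon>"
    proof (rule H[OF trig_field_scale[OF FD(1)]])
      show "norm ((1 / norm \<phi>) *\<^sub>R D x) \<le> 1" for x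
        using norm_bounded[of \<phi> x] False by (simp add: D)
    qed
    moreover have "(\<integral>x. trace ((1 / norm \<phi>) *\<^sub>R D x) \<partial>\<nu>) = f \<phi> / norm \<phi>"
      using SB[OF FD(1)] FD(2) by (simp only: tr) simp
    ultimately show ?thesis using False by (simp add: field_simps)
  qed (simp add: f_def trace_def)
  obtain v where v: "linear v" "\<And>\<phi>. \<phi> \<in> S \<Longrightarrow> v \<phi> = f \<phi>" "\<And>\<phi>. \<bar>v \<phi>\<bar> \<le> \<epsilon> * norm \<phi>"
    using hahn_banach_norm[OF sub fadd fscale bd less_imp_le[OF \<epsilon>]] by blast
  show thesis
  proof (rule that[OF v(1,3)])
    fix F D assume FD: "trig_field W F D"
    then have "Bcontfun D \<in> S" unfolding S_def by blast
    then show "v (Bcontfun D) = (\<integral>x. trace (D x) \<partial>\<nu>)" using v(2) SB[OF FD] by simp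
  qed
qed

text \<open>Tests the duality on the waves \<open>sin (k \<bullet> x) *\<^sub>R a\<close> and
  \<open>- cos (k \<bullet> x) *\<^sub>R a\<close>, whose derivatives are
  \<open>cos (k \<bullet> x)\<close> and \<open>sin (k \<bullet> x)\<close> times
  \<open>outer a k\<close>. Varying \<open>a\<close> gives the vector identities at frequency
  \<open>k\<close>.\<close>

lemma trig_field_dual_coeff:
  fixes v :: "((real ^ 'n) \<Rightarrow>\<^sub>C (real ^ 'n ^ 'n)) \<Rightarrow> real"
  assumes v: "linear v"
    and tf: "\<And>F D. trig_field W F D \<Longrightarrow> v (Bcontfun D) = (\<integral>x. trace (D x) \<partial>\<nu>)" and k: "k \<in> W"
  shows "(\<integral>y. cos (k \<bullet> y) \<partial>\<nu>) *\<^sub>R k = cos_coeff v k *v k"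
    and "(\<integral>y. sin (k \<bullet> y) \<partial>\<nu>) *\<^sub>R k = sin_coeff v k *v k"
proof -
  have "a \<bullet> (cos_coeff v k *v k) = a \<bullet> ((\<integral>y. cos (k \<bullet> y) \<partial>\<nu>) *\<^sub>R k)"
    and "a \<bullet> (sin_coeff v k *v k) = a \<bullet> ((\<integral>y. sin (k \<bullet> y) \<partial>\<nu>) *\<^sub>R k)" for a
  proof -
    have c: "- sin (t + - (pi / 2)) = cos t" for t :: real by (simp add: sin_diff)
    have 1: "trig_field W (\<lambda>x. cos (k \<bullet> x + - (pi / 2)) *\<^sub>R a) (\<lambda>x. cos (k \<bullet> x) *\<^sub>R outer a k)"
      using trig_field.wave[OF k, of "- (pi / 2)" a] unfolding c .
    have 2: "trig_field W (\<lambda>x. cos (k \<bullet> x + 0) *\<^sub>R (- a)) (\<lambda>x. sin (k \<bullet> x) *\<^sub>R outer a k)"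
      using trig_field.wave[OF k, of 0 "- a"] outer_scaleR(1)[of "-1" a k] by simp
    have tr: "trace (r *\<^sub>R outer a k) = r * (a \<bullet> k)" for r
    proof -
      have "trace (r *\<^sub>R outer a k) = r * trace (outer a k)" by (simp add: trace_def sum_distrib_left)
      then show ?thesis by (simp only: trace_outer)
    qed
    show "a \<bullet> (cos_coeff v k *v k) = a \<bullet> ((\<integral>y. cos (k \<bullet> y) \<partial>\<nu>) *\<^sub>R k)"
      using tf[OF 1] unfolding outer_inner[symmetric] inner_cos_coeff[OF v] tr by simp
    show "a \<bullet> (sin_coeff v k *v k) = a \<bullet> ((\<integral>y. sin (k \<bullet> y) \<partial>\<nu>) *\<^sub>R k)"
      using tf[OF 2] unfolding outer_inner[symmetric] inner_sin_coeff[OF v] tr by simp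
  qed
  then show "(\<integral>y. cos (k \<bullet> y) \<partial>\<nu>) *\<^sub>R k = cos_coeff v k *v k"
    and "(\<integral>y. sin (k \<bullet> y) \<partial>\<nu>) *\<^sub>R k = sin_coeff v k *v k"
    by (subst vector_eq_ldot[symmetric], simp)+
qed

section \<open>Test fields for singular measures\<close>

lemma integral_trig_kernel_measure:
  fixes \<nu> :: "(real ^ 'n) measure"
  assumes "prob_space \<nu>" and sets: "sets \<nu> = sets borel"
  shows "(\<integral>y. trig_kernel M (x - y) \<partial>\<nu>) = heat_sum (freq_box M) lattice_freq
    (\<lambda>m. kernel_coeff M m * (\<integral>y. cos (lattice_freq m \<bullet> y) \<partial>\<nu>))
    (\<lambda>m. kernel_coeff M m * (\<integral>y. sin (lattice_freq m \<bullet> y) \<partial>\<nu>)) 0 x"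
proof -
  interpret prob_space \<nu> by fact
  have meas: "f \<in> borel_measurable \<nu>" if "continuous_on UNIV f" for f :: "real ^ 'n \<Rightarrow> real"
    using sets borel_measurable_continuous_onI[OF that] by (simp add: measurable_cong_sets[OF sets refl])
  have "integrable \<nu> (\<lambda>y. cos (k \<bullet> y))" "integrable \<nu> (\<lambda>y. sin (k \<bullet> y))" for k
    by (rule integrable_const_bound[where B = 1]; auto intro!: meas continuous_intros)+
  then show ?thesis
    unfolding trig_kernel_diff heat_sum_def by (subst Bochner_Integration.integral_sum) (auto simp: algebra_simps)
qed

theorem singular_test_field:
  fixes \<nu> :: "(real ^ 'n) measure" and K :: "(real ^ 'n) set"
  assumes prob: "prob_space \<nu>" and sets: "sets \<nu> = sets borel"
    and K: "compact K" "K \<in> null_sets lborel" and conc: "AE x in \<nu>. x \<in> K"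
  shows "\<exists>F D. trig_field (range lattice_freq) F D \<and> (\<forall>x. norm (D x) \<le> 1)
    \<and> 1 / (100 + 160 * real CARD('n)) \<le> (\<integral>x. trace (D x) \<partial>\<nu>)"
proof (rule ccontr)
  interpret prob_space \<nu> by fact
  let ?w = "lattice_freq :: ('n \<Rightarrow> int) \<Rightarrow> real ^ 'n"
  \<comment> \<open>\<open>c\<close> is what monotonicity demands when the subordination constant is
    the dimension. Then \<open>1 + 2 * c = 25 + 40 * CARD('n)\<close>, and \<epsilon> makes its
    product with this equal to 1/4, half of the limit value 1/2 reached at the end.\<close>
  define \<epsilon> where "\<epsilon> = 1 / (100 + 160 * real CARD('n))"
  define c where "c = 12 + 20 * real CARD('n)"
  have c: "12 + 20 * real CARD('n) \<le> c" "0 \<le> c" by (simp_all add: c_def)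
  have \<epsilon>: "0 < \<epsilon>" "(1 + 2 * c) * \<epsilon> = 1 / 4"
    by (simp_all add: \<epsilon>_def c_def divide_simps add_pos_nonneg)
  assume no: "\<not> ?thesis"
  have H: "(\<integral>x. trace (D x) \<partial>\<nu>) \<le> \<epsilon>" if "trig_field (range ?w) F D" "\<And>x. norm (D x) \<le> 1" for F D
    using no that unfolding \<epsilon>_def by (metis linear)
  obtain v where v: "linear v" "\<And>\<phi>. \<bar>v \<phi>\<bar> \<le> \<epsilon> * norm \<phi>"
    and tf: "\<And>F D. trig_field (range ?w) F D \<Longrightarrow> v (Bcontfun D) = (\<integral>x. trace (D x) \<partial>\<nu>)"
  proof (rule trig_field_dual[OF prob sets \<epsilon>(1), where W = "range ?w"])
    show "(\<integral>x. trace (D x) \<partial>\<nu>) \<le> \<epsilon>" if "trig_field (range ?w) F D" "\<And>x. norm (D x) \<le> 1" for F D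
      using H that .
  qed blast
  define \<alpha> where "\<alpha> m = (\<integral>y. cos (?w m \<bullet> y) \<partial>\<nu>)" for m
  define \<beta> where "\<beta> m = (\<integral>y. sin (?w m \<bullet> y) \<partial>\<nu>)" for m
  \<comment> \<open>Dropping frequency 0 subtracts the mean 1 of the smoothed measure. The relation
    between \<open>p\<close> and \<open>P\<close> survives there because the frequency vector is
    0.\<close>
  define p where "p M m = (if m = (\<lambda>_. 0) then 0 else kernel_coeff M m * \<alpha> m)" for M m
  define q where "q M m = kernel_coeff M m * \<beta> m" for M m
  define P where "P M m = kernel_coeff M m *\<^sub>R cos_coeff v (?w m)" for M m
  define Q where "Q M m = kernel_coeff M m *\<^sub>R sin_coeff v (?w m)" for M m
  define y where "y M x = (\<integral>z. trig_kernel M (x - z) \<partial>\<nu>) - 1" for M and x :: "real ^ 'n"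
  have y: "heat_sum (freq_box M) ?w (p M) (q M) 0 x = y M x" for M x
  proof -
    have "\<alpha> (\<lambda>_. 0) = 1" by (simp add: \<alpha>_def prob_space)
    then have "heat_sum (freq_box M) ?w (\<lambda>m. kernel_coeff M m * \<alpha> m) (q M) 0 x
      = 1 + heat_sum (freq_box M) ?w (p M) (q M) 0 x"
      unfolding heat_sum_def p_def by (simp add: sum.remove[of _ "\<lambda>_. 0"])
    then show ?thesis
      using integral_trig_kernel_measure[OF prob sets, of M x] by (simp add: y_def \<alpha>_def \<beta>_def q_def[abs_def])
  qed
  have sub: "p M m *\<^sub>R ?w m = P M m *v ?w m" "q M m *\<^sub>R ?w m = Q M m *v ?w m" for M m
  proof -
    have s: "(r *\<^sub>R A) *v (x :: real ^ 'n) = r *\<^sub>R (A *v x)" for r and A :: "real ^ 'n ^ 'n" and x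
      by (simp add: vec_eq_iff matrix_vector_mult_def sum_distrib_left mult_ac)
    show "p M m *\<^sub>R ?w m = P M m *v ?w m" "q M m *\<^sub>R ?w m = Q M m *v ?w m"
      unfolding p_def q_def P_def Q_def s
      using trig_field_dual_coeff[OF v(1) tf rangeI[of ?w m]] by (auto simp: \<alpha>_def \<beta>_def simp flip: scaleR_scaleR)
  qed
  have mean0: "1 \<le> ?w m \<bullet> ?w m \<or> p M m = 0 \<and> q M m = 0" for M m
  proof (cases "m = (\<lambda>_. 0)")
    case True
    then have "?w m = 0" by simp
    then show ?thesis using True by (simp add: p_def q_def \<beta>_def)
  next
    case False
    then obtain i where i: "m i \<noteq> 0" by auto
    have "1 \<le> \<bar>?w m $ i\<bar>"
    proof -
      have "1 * 1 \<le> (2 * pi) * \<bar>real_of_int (m i)\<bar>"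
        using i pi_gt3 by (intro mult_mono) auto
      then show ?thesis by (simp add: lattice_freq_def abs_mult)
    qed
    also have "\<dots> \<le> norm (?w m)" by (rule component_le_norm_cart)
    finally have "1 \<le> (norm (?w m))\<^sup>2" by (simp add: one_le_power)
    then show ?thesis by (simp add: dot_square_norm)
  qed
  have bound: "integral (cbox 0 One) (\<lambda>x. (y M x)\<^sup>2 / (1 + (y M x)\<^sup>2)) \<le> 1 / 4" for M
  proof -
    let ?V = "heat_sum (freq_box M) ?w (P M) (Q M)"
    have yc [continuous_intros]: "continuous_on S (y M)" for S
      unfolding y[symmetric, abs_def] by (intro continuous_intros)
    have n: "1 + (y M x)\<^sup>2 \<noteq> 0" for x by (smt (verit) zero_le_power2)
    have "integral (cbox 0 One) (\<lambda>x. (y M x)\<^sup>2 / (1 + (y M x)\<^sup>2) - (1 + 2 * c) * norm (?V 0 x))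
      \<le> integral (cbox 0 One) (\<lambda>x. bellman c (?V 0 x) (y M x))"
      by (intro integral_le integrable_continuous continuous_intros bellman_ge c n) (use n in auto)
    also have "\<dots> \<le> 0"
      unfolding y[symmetric]
      by (rule bellman_integral_le_0[OF lattice_freq_inner_Basis heat_sum_subordinate[OF sub] c mean0])
    finally have "integral (cbox 0 One) (\<lambda>x. (y M x)\<^sup>2 / (1 + (y M x)\<^sup>2)) - (1 + 2 * c) * integral (cbox 0 One) (\<lambda>x. norm (?V 0 x)) \<le> 0"
      by (subst (asm) integral_diff) (use n in \<open>auto intro!: integrable_continuous continuous_intros\<close>)
    moreover have "(1 + 2 * c) * integral (cbox 0 One) (\<lambda>x. norm (?V 0 x)) \<le> (1 + 2 * c) * \<epsilon>"
      using integral_norm_heat_sum_le[OF v less_imp_le[OF \<epsilon>(1)], of M] c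
      by (intro mult_left_mono) (auto simp: P_def[abs_def] Q_def[abs_def])
    ultimately show ?thesis using \<epsilon>(2) by simp
  qed
  \<comment> \<open>The lattice translates of \<open>K\<close>: for \<open>x\<close> outside this
    null set no difference \<open>x - z\<close> with \<open>z \<in> K\<close> is an integer point,
    so the kernel tends to 0 uniformly on these differences.\<close>
  define N where "N = (\<Union>m. (\<lambda>z. (\<chi> i. of_int (m i)) + z) ` K)"
  have "negligible K"
    using K by (simp add: negligible_iff_null_sets null_sets_completionI)
  then have neg: "negligible N"
    unfolding N_def by (intro negligible_countable_Union) (auto intro: negligible_translation)
  have lim: "(\<lambda>M. y M x) \<longlonglongrightarrow> -1" if x: "x \<notin> N" for x
  proof -
    have "(\<lambda>M. y M x + 1) \<longlonglongrightarrow> 0"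
    proof (rule tendstoI)
      fix e :: real assume e: "0 < e"
      have "compact ((\<lambda>z. x - z) ` K)"
        by (intro compact_continuous_image continuous_intros K)
      moreover have "\<exists>i. z $ i \<notin> \<int>" if z: "z \<in> (\<lambda>z. x - z) ` K" for z
      proof (rule ccontr)
        assume "\<nexists>i. z $ i \<notin> \<int>"
        then have "\<forall>i. \<exists>l::int. z $ i = of_int l" by (metis Ints_cases)
        then obtain m :: "'n \<Rightarrow> int" where m: "\<And>i. z $ i = of_int (m i)" by metis
        obtain z' where "z' \<in> K" "z = x - z'" using z by blast
        then have "x = (\<chi> i. of_int (m i)) + z'" using m by (simp add: vec_eq_iff)
        then show False using x \<open>z' \<in> K\<close> by (auto simp: N_def)
      qed
      ultimately have "\<forall>\<^sub>F M in sequentially. \<forall>z\<in>(\<lambda>z. x - z) ` K. trig_kernel M z \<le> e / 2"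
        using e by (intro trig_kernel_tendsto_0) auto
      then show "\<forall>\<^sub>F M in sequentially. dist (y M x + 1) 0 < e"
      proof eventually_elim
        case (elim M)
        have "(\<integral>z. trig_kernel M (x - z) \<partial>\<nu>) \<le> e / 2"
        proof (rule integral_le_const)
          show "AE z in \<nu>. trig_kernel M (x - z) \<le> e / 2" using conc by (rule AE_mp) (use elim in auto)
          have "continuous_on UNIV (\<lambda>z. trig_kernel M (x - z))" unfolding trig_kernel_def by (intro continuous_intros)
          then have "(\<lambda>z. trig_kernel M (x - z)) \<in> borel_measurable \<nu>"
            using sets by (simp add: borel_measurable_continuous_onI measurable_cong_sets[OF sets refl])
          moreover have "AE z in \<nu>. norm (trig_kernel M (x - z)) \<le> e / 2"
            using conc by (rule AE_mp) (use elim in \<open>auto simp: abs_of_nonneg[OF trig_kernel_nonneg]\<close>)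
          ultimately show "integrable \<nu> (\<lambda>z. trig_kernel M (x - z))"
            by (intro integrable_const_bound)
        qed
        moreover have "0 \<le> (\<integral>z. trig_kernel M (x - z) \<partial>\<nu>)" by (simp add: trig_kernel_nonneg)
        ultimately show ?case using e by (simp add: y_def)
      qed
    qed
    from tendsto_diff[OF this tendsto_const[of 1]] show ?thesis by simp
  qed
  \<comment> \<open>The value 1/2 on \<open>N\<close> makes the sequence converge to 1/2 at every
    point, the form in which dominated convergence is applied, and leaves the integrals
    unchanged.\<close>
  define g where "g M x = (if x \<in> N then 1 / 2 else (y M x)\<^sup>2 / (1 + (y M x)\<^sup>2))" for M x
  have n: "1 + (y M x)\<^sup>2 \<noteq> 0" for M x by (smt (verit) zero_le_power2)
  have gi: "g M integrable_on cbox 0 One" and gI: "integral (cbox 0 One) (g M) \<le> 1 / 4" for M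
  proof -
    have "continuous_on UNIV (y M)"
      unfolding y[symmetric, abs_def] by (intro continuous_intros)
    then have int: "(\<lambda>x. (y M x)\<^sup>2 / (1 + (y M x)\<^sup>2)) integrable_on cbox 0 One"
      using n by (intro integrable_continuous continuous_intros) (auto intro: continuous_on_subset)
    show "g M integrable_on cbox 0 One"
      by (rule integrable_spike[OF int neg]) (simp add: g_def)
    have "integral (cbox 0 One) (g M) = integral (cbox 0 One) (\<lambda>x. (y M x)\<^sup>2 / (1 + (y M x)\<^sup>2))"
      by (rule integral_spike[OF neg]) (simp add: g_def)
    then show "integral (cbox 0 One) (g M) \<le> 1 / 4" using bound by simp
  qed
  have "(\<lambda>M. integral (cbox 0 One) (g M)) \<longlonglongrightarrow> integral (cbox 0 (One :: real ^ 'n)) (\<lambda>x. 1 / 2)"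
  proof (rule dominated_convergence(2)[OF gi])
    show "(\<lambda>x::real ^ 'n. 1 :: real) integrable_on cbox 0 One" by (intro integrable_continuous continuous_intros)
    show "norm (g M x) \<le> 1" for M x
      using n[of M x] by (simp add: g_def divide_le_eq add_pos_nonneg)
    show "(\<lambda>M. g M x) \<longlonglongrightarrow> 1 / 2" for x
    proof (cases "x \<in> N")
      case False
      have "(\<lambda>M. (y M x)\<^sup>2 / (1 + (y M x)\<^sup>2)) \<longlonglongrightarrow> (-1)\<^sup>2 / (1 + (-1)\<^sup>2)"
        by (intro tendsto_intros lim False) simp
      then show ?thesis using False by (simp add: g_def)
    qed (simp add: g_def)
  qed
  then have "integral (cbox 0 (One :: real ^ 'n)) (\<lambda>x. 1 / 2 :: real) \<le> 1 / 4"
    by (rule LIMSEQ_le_const2) (use gI in blast)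
  then show False by simp
qed

section \<open>Uniformly small test fields with Cauchy derivatives\<close>

lemma trig_field_const: "0 \<in> W \<Longrightarrow> trig_field W (\<lambda>x. a) (\<lambda>x. 0)"
  using trig_field.wave[of 0 W 0 a] by simp

text \<open>\<open>singular_test_field\<close> is applied to the image of \<nu> under
  \<open>x / \<eta>\<close>, again concentrated on a compact null set. The field it yields is
  1-Lipschitz and periodic, so it stays within \<open>CARD('n)\<close> of its value at 0.
  Subtracting that value and scaling back makes it at most \<delta>, while the derivative bound and
  the integral of the divergence are kept.\<close>

lemma small_test_field:
  fixes \<nu> :: "(real ^ 'n) measure" and K :: "(real ^ 'n) set"
  assumes prob: "prob_space \<nu>" and sets: "sets \<nu> = sets borel"
    and K: "compact K" "K \<in> null_sets lborel" and conc: "AE x in \<nu>. x \<in> K" and \<delta>: "0 < \<delta>"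
  shows "\<exists>F D. trig_field UNIV F D \<and> (\<forall>x. norm (D x) \<le> 1) \<and> (\<forall>x. norm (F x) \<le> \<delta>)
    \<and> 1 / (100 + 160 * real CARD('n)) \<le> (\<integral>x. trace (D x) \<partial>\<nu>)"
proof -
  interpret prob_space \<nu> by fact
  define \<eta> where "\<eta> = \<delta> / real CARD('n)"
  have \<eta>: "0 < \<eta>" using \<delta> by (simp add: \<eta>_def)
  define s where "s x = (1 / \<eta>) *\<^sub>R x" for x :: "real ^ 'n"
  have s: "s \<in> borel_measurable borel" "linear s"
    unfolding s_def by (intro borel_measurable_continuous_onI continuous_intros, rule linear_scaleR)
  have s': "s \<in> measurable \<nu> borel"
    using s(1) by (simp add: measurable_cong_sets[OF sets refl])
  have K': "compact (s ` K)"
    unfolding s_def by (intro compact_continuous_image continuous_intros K)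
  have "negligible K"
    using K by (simp add: negligible_iff_null_sets null_sets_completionI)
  then have "negligible (s ` K)"
    by (intro negligible_differentiable_image_negligible linear_imp_differentiable_on s) auto
  then have K'': "s ` K \<in> null_sets lborel"
    using K' by (simp add: negligible_iff_null_sets null_sets_completion_iff borel_compact)
  have "prob_space (distr \<nu> borel s)" by (rule prob_space_distr[OF s'])
  moreover have "AE x in distr \<nu> borel s. x \<in> s ` K"
    using conc K' by (subst AE_distr_iff[OF s']) (auto intro: borel_compact)
  ultimately obtain F D where FD: "trig_field (range lattice_freq) F D" "\<And>x. norm (D x) \<le> 1"
    and tr: "1 / (100 + 160 * real CARD('n)) \<le> (\<integral>x. trace (D x) \<partial>distr \<nu> borel s)"
    using singular_test_field[of "distr \<nu> borel s" "s ` K"] K' K'' by auto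
  define F' where "F' x = \<eta> *\<^sub>R F (s x) - \<eta> *\<^sub>R F 0" for x
  have "trig_field UNIV F' (\<lambda>x. D (s x))"
    using trig_field_diff[OF trig_field_rescale[OF _ FD(1), of \<eta>] trig_field_const[of UNIV "\<eta> *\<^sub>R F 0"]] \<eta>
    by (simp add: F'_def[abs_def] s_def)
  moreover have "norm (F' x) \<le> \<delta>" for x
  proof -
    define z where "z = (\<chi> i. frac (s x $ i))"
    have "norm (F (s x) - F 0) = norm (F z - F 0)"
      using trig_field_lattice_periodic[OF FD(1), of "s x"] by (simp add: z_def)
    also have "\<dots> \<le> 1 * norm (z - 0)" by (rule trig_field_lipschitz[OF FD])
    also have "\<dots> \<le> (\<Sum>i\<in>UNIV. \<bar>z $ i\<bar>)" using norm_le_l1_cart[of z] by simp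
    also have "\<dots> \<le> (\<Sum>i\<in>(UNIV :: 'n set). 1)"
      by (intro sum_mono) (simp add: z_def frac_lt_1 less_imp_le)
    finally have "norm (F (s x) - F 0) \<le> real CARD('n)" by simp
    then have "\<eta> * norm (F (s x) - F 0) \<le> \<eta> * real CARD('n)" using \<eta> by (intro mult_left_mono) auto
    then show ?thesis using \<eta> \<delta> by (simp add: F'_def scaleR_diff_right[symmetric] \<eta>_def)
  qed
  moreover have "(\<integral>x. trace (D x) \<partial>distr \<nu> borel s) = (\<integral>x. trace (D (s x)) \<partial>\<nu>)"
  proof (rule integral_distr[OF s'])
    have "continuous_on UNIV (\<lambda>x. trace (D x))"
      unfolding trace_def using trig_field_continuous[OF FD(1), of UNIV] by (auto intro!: continuous_intros)
    then show "(\<lambda>x. trace (D x)) \<in> borel_measurable borel" by (rule borel_measurable_continuous_onI)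
  qed
  ultimately show ?thesis using FD(2) tr by auto
qed

text \<open>Almost minimising the convex functional \<open>\<integral>|D|\<^sup>2 d\<nu>\<close> over the decreasing convex sets of
  admissible fields replaces weak compactness: by the parallelogram law such a sequence is Cauchy.\<close>

lemma cauchy_test_fields:
  fixes \<nu> :: "(real ^ 'n) measure" and K :: "(real ^ 'n) set"
  assumes prob: "prob_space \<nu>" and sets: "sets \<nu> = sets borel"
    and K: "compact K" "K \<in> null_sets lborel" and conc: "AE x in \<nu>. x \<in> K"
  obtains F D where "\<And>m. trig_field UNIV (F m) (D m)" "\<And>m x. norm (D m x) \<le> 1"
    "\<And>m x. norm (F m x) \<le> 1 / real (Suc m)"
    "\<And>m. 1 / (100 + 160 * real CARD('n)) \<le> (\<integral>x. trace (D m x) \<partial>\<nu>)"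
    "\<And>e. 0 < e \<Longrightarrow> \<exists>m0. \<forall>m\<ge>m0. \<forall>l\<ge>m. (\<integral>x. (norm (D m x - D l x))\<^sup>2 \<partial>\<nu>) \<le> e"
proof -
  interpret prob_space \<nu> by fact
  define c where "c = 1 / (100 + 160 * real CARD('n))"
  define C where "C m = {(F, D). trig_field UNIV F D \<and> (\<forall>x. norm (D x) \<le> 1) \<and>
    (\<forall>x. norm (F x) \<le> 1 / real (Suc m)) \<and> c \<le> (\<integral>x. trace (D x) \<partial>\<nu>)}" for m
  define J where "J FD = (\<integral>x. (norm (snd FD x))\<^sup>2 \<partial>\<nu>)" for FD :: "(real ^ 'n \<Rightarrow> real ^ 'n) \<times> (real ^ 'n \<Rightarrow> real ^ 'n ^ 'n)"
  define d where "d m = Inf (J ` C m)" for m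
  have meas: "f \<in> borel_measurable \<nu>" if "continuous_on UNIV f" for f :: "real ^ 'n \<Rightarrow> real"
    using sets borel_measurable_continuous_onI[OF that] by (simp add: measurable_cong_sets[OF sets refl])
  have int: "integrable \<nu> (\<lambda>x. (norm (D x))\<^sup>2)" "integrable \<nu> (\<lambda>x. trace (D x))"
    if FD: "trig_field UNIV F D" for F D
  proof -
    have c: "continuous_on UNIV D" using trig_field_continuous[OF FD] by blast
    obtain B where B: "\<And>x. norm (D x) \<le> B" using trig_field_bounded[OF FD] by blast
    show "integrable \<nu> (\<lambda>x. (norm (D x))\<^sup>2)"
      using B by (intro integrable_const_bound[where B = "B\<^sup>2"] meas continuous_intros c) (auto intro!: power_mono AE_I2)
    have "norm (trace (D x)) \<le> real CARD('n) * B" for x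
    proof -
      have "\<bar>trace (D x)\<bar> \<le> (\<Sum>i\<in>UNIV. norm (D x $ i))" by (rule abs_trace_le)
      also have "\<dots> \<le> (\<Sum>i\<in>(UNIV :: 'n set). B)"
        by (intro sum_mono order_trans[OF Finite_Cartesian_Product.norm_nth_le B])
      finally show ?thesis by simp
    qed
    moreover have "continuous_on UNIV (\<lambda>x. trace (D x))"
      unfolding trace_def by (intro continuous_intros c)
    ultimately show "integrable \<nu> (\<lambda>x. trace (D x))"
      by (intro integrable_const_bound[where B = "real CARD('n) * B"] meas) auto
  qed
  have ne: "C m \<noteq> {}" for m
    using small_test_field[OF prob sets K conc, of "1 / real (Suc m)"] by (force simp: C_def c_def)
  have J0: "0 \<le> J x" for x unfolding J_def by simp
  have bdd: "bdd_below (J ` X)" for X using J0 by (rule bdd_belowI2)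
  have anti: "C l \<subseteq> C m" if "m \<le> l" for m l
  proof -
    have "1 / real (Suc l) \<le> 1 / real (Suc m)" using that by (intro divide_left_mono) auto
    then show ?thesis by (auto simp: C_def intro: order_trans)
  qed
  have mono: "d m \<le> d l" if "m \<le> l" for m l
    unfolding d_def by (rule cInf_superset_mono) (use ne bdd anti[OF that] in auto)
  have d1: "d m \<le> 1" for m
  proof -
    obtain F0 D0 where FD: "(F0, D0) \<in> C m" using ne[of m] by (metis ex_in_conv surj_pair)
    then have "d m \<le> J (F0, D0)" unfolding d_def by (intro cInf_lower bdd imageI)
    also have "\<dots> \<le> (\<integral>x. 1 \<partial>\<nu>)"
      unfolding J_def using FD by (intro integral_mono) (auto simp: C_def power_le_one intro: int)
    finally show ?thesis by (simp add: prob_space)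
  qed
  have "\<exists>FD\<in>C m. J FD < d m + 1 / real (Suc m)" for m
    using cInf_lessD[of "J ` C m" "d m + 1 / real (Suc m)"] ne by (auto simp: d_def)
  then obtain FD where FD: "\<And>m. FD m \<in> C m" "\<And>m. J (FD m) < d m + 1 / real (Suc m)" by metis
  define F where "F m = fst (FD m)" for m
  define D where "D m = snd (FD m)" for m
  have FD': "(F m, D m) \<in> C m" for m using FD(1)[of m] by (simp add: F_def D_def)
  have tf: "trig_field UNIV (F m) (D m)" for m using FD'[of m] by (simp add: C_def)
  \<comment> \<open>The midpoint of two members of \<open>C m\<close> lies in \<open>C m\<close>, so
    its functional is at least \<open>d m\<close>. Since both members are almost minimal, the
    parallelogram law gives the bound.\<close>
  have par: "(\<integral>x. (norm (D m x - D l x))\<^sup>2 \<partial>\<nu>) \<le> 2 * (d l - d m) + 4 / real (Suc m)" if ml: "m \<le> l" for m l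
  proof -
    let ?F = "\<lambda>x. (1 / 2) *\<^sub>R (F m x + F l x)" and ?D = "\<lambda>x. (1 / 2) *\<^sub>R (D m x + D l x)"
    have l: "(F l, D l) \<in> C m" using FD'[of l] anti[OF ml] by blast
    have t: "trig_field UNIV ?F ?D" by (intro trig_field_scale trig_field.add tf)
    have half: "norm ((1 / 2) *\<^sub>R (a + b)) \<le> r" if "norm a \<le> r" "norm b \<le> r" for a b :: "'v::real_normed_vector" and r
      using norm_triangle_ineq[of a b] that by simp
    have "(\<integral>x. trace (?D x) \<partial>\<nu>) = (\<integral>x. (1 / 2) * (trace (D m x) + trace (D l x)) \<partial>\<nu>)"
    proof -
      have "trace (?D x) = (1 / 2) * (trace (D m x) + trace (D l x))" for x
        by (simp add: trace_def sum.distrib[symmetric] sum_distrib_left)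
      then show ?thesis by (simp only:)
    qed
    also have "\<dots> = (1 / 2) * ((\<integral>x. trace (D m x) \<partial>\<nu>) + (\<integral>x. trace (D l x) \<partial>\<nu>))"
      using int(2)[OF tf[of m]] int(2)[OF tf[of l]] by simp
    finally have "c \<le> (\<integral>x. trace (?D x) \<partial>\<nu>)" using FD'[of m] l by (simp add: C_def)
    moreover have "norm (?D x) \<le> 1" "norm (?F x) \<le> 1 / real (Suc m)" for x
      using FD'[of m] l by (intro half; simp add: C_def)+
    ultimately have "(?F, ?D) \<in> C m" using t by (simp add: C_def del: scaleR_add_right)
    then have "d m \<le> J (?F, ?D)" unfolding d_def by (intro cInf_lower bdd) auto
    moreover have "(\<integral>x. (norm (D m x - D l x))\<^sup>2 \<partial>\<nu>) = 2 * J (FD m) + 2 * J (FD l) - 4 * J (?F, ?D)"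
    proof -
      have eq: "(norm (D m x - D l x))\<^sup>2 = 2 * (norm (D m x))\<^sup>2 + 2 * (norm (D l x))\<^sup>2 - 4 * (norm (?D x))\<^sup>2" for x
      proof -
        have "(norm (D m x - D l x))\<^sup>2 + (norm (D m x + D l x))\<^sup>2 = 2 * (norm (D m x))\<^sup>2 + 2 * (norm (D l x))\<^sup>2"
          unfolding power2_norm_eq_inner
          by (simp add: inner_add_left inner_add_right inner_diff_left inner_diff_right inner_commute)
        moreover have "4 * (norm (?D x))\<^sup>2 = (norm (D m x + D l x))\<^sup>2"
          unfolding norm_scaleR power_mult_distrib by (simp add: power2_eq_square)
        ultimately show ?thesis by linarith
      qed
      have "(\<integral>x. (norm (D m x - D l x))\<^sup>2 \<partial>\<nu>) =
         (\<integral>x. 2 * (norm (D m x))\<^sup>2 + 2 * (norm (D l x))\<^sup>2 - 4 * (norm (?D x))\<^sup>2 \<partial>\<nu>)" by (simp only: eq)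
      also have "\<dots> = 2 * (\<integral>x. (norm (D m x))\<^sup>2 \<partial>\<nu>) + 2 * (\<integral>x. (norm (D l x))\<^sup>2 \<partial>\<nu>) - 4 * (\<integral>x. (norm (?D x))\<^sup>2 \<partial>\<nu>)"
        by (simp only: Bochner_Integration.integral_diff Bochner_Integration.integral_add integral_mult_right_zero
          integrable_mult_right Bochner_Integration.integrable_add int(1)[OF tf[of m]] int(1)[OF tf[of l]] int(1)[OF t])
      finally show ?thesis by (simp add: J_def D_def)
    qed
    moreover have "1 / real (Suc l) \<le> 1 / real (Suc m)" using ml by (intro divide_left_mono) auto
    ultimately show ?thesis using FD(2)[of m] FD(2)[of l] by simp
  qed
  have d0: "0 \<le> d m" for m
    unfolding d_def using ne J0 by (intro cInf_greatest) auto
  \<comment> \<open>The sets \<open>C m\<close> decrease, so the infima \<open>d m\<close> increase;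
    they are at most 1 because the derivatives are, hence they converge and \<open>d l - d m\<close>
    becomes small.\<close>
  have "Bseq d"
    by (rule BseqI'[where K = 1]) (use d0 d1 in auto)
  moreover have "monoseq d" using mono by (auto simp: monoseq_def)
  ultimately have "convergent d" by (rule Bseq_monoseq_convergent)
  then have "Cauchy d" by (rule convergent_Cauchy)
  have cau: "\<exists>m0. \<forall>m\<ge>m0. \<forall>l\<ge>m. (\<integral>x. (norm (D m x - D l x))\<^sup>2 \<partial>\<nu>) \<le> e" if e: "0 < e" for e
  proof -
    obtain m1 where m1: "\<And>m l. m \<ge> m1 \<Longrightarrow> l \<ge> m1 \<Longrightarrow> \<bar>d m - d l\<bar> < e / 4"
      using metric_CauchyD[OF \<open>Cauchy d\<close>, of "e / 4"] e unfolding dist_real_def by auto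
    obtain m2 :: nat where m2: "8 / e < real m2" using reals_Archimedean2 by blast
    show ?thesis
    proof (intro exI[of _ "max m1 m2"] allI impI)
      fix m l assume m: "m \<ge> max m1 m2" and l: "l \<ge> m"
      have "8 / e < real (Suc m)" using m2 m by simp
      then have "8 < e * real (Suc m)" using e by (simp only: pos_divide_less_eq mult.commute)
      then have 1: "4 / real (Suc m) \<le> e / 2"
        by (simp only: pos_divide_le_eq of_nat_0_less_iff zero_less_Suc)
      have 2: "d l - d m \<le> e / 4"
        using m m1[of l m] l by (intro less_imp_le[OF le_less_trans[OF abs_ge_self]]) simp
      have "2 * (d l - d m) + 4 / real (Suc m) \<le> 2 * (e / 4) + e / 2"
        by (rule add_mono[OF mult_left_mono[OF 2] 1]) simp
      also have "2 * (e / 4) + e / 2 = e" by simp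
      finally show "(\<integral>x. (norm (D m x - D l x))\<^sup>2 \<partial>\<nu>) \<le> e"
        by (rule order_trans[OF par[OF l]])
    qed
  qed
  show thesis
  proof (rule that[of F D])
    fix m x
    show "trig_field UNIV (F m) (D m)" by (rule tf)
    show "norm (D m x) \<le> 1" "norm (F m x) \<le> 1 / real (Suc m)"
      and "1 / (100 + 160 * real CARD('n)) \<le> (\<integral>x. trace (D m x) \<partial>\<nu>)"
      using FD'[of m] by (simp_all add: C_def c_def)
  qed (rule cau)
qed

section \<open>Energy measures of composed fields\<close>

lemma Lip_a_le:
  assumes g: "C-lipschitz_on UNIV g" and \<rho>: "0 < \<rho>" and L: "L-lipschitz_on (ball y \<rho>) g"
  shows "0 \<le> Lip_a g y" "Lip_a g y \<le> L"
proof -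
  have small: "LIP g (ball y r) \<le> L" if "r \<le> \<rho>" for r
    by (rule LIP_le) (rule lipschitz_on_subset[OF L], simp add: that subset_ball)
  have "\<forall>\<^sub>F r in at_right 0. LIP g (ball y r) \<le> L"
    unfolding eventually_at_right_field using \<rho> small by (intro exI[of _ \<rho>]) auto
  then show "Lip_a g y \<le> L"
    using LIP_tendsto_Lip_a[OF g] by (intro tendsto_upperbound) auto
  have "0 \<le> LIP g (ball y r)" for r
    using LIP_lipschitz_on[OF lipschitz_on_subset[OF g subset_UNIV]] by (auto simp: lipschitz_on_def)
  then show "0 \<le> Lip_a g y"
    by (intro tendsto_lowerbound[OF LIP_tendsto_Lip_a[OF g]]) auto
qed

lemma lipschitz_on_derivative_bound:
  fixes g :: "real \<Rightarrow> real"
  assumes "convex S" "\<And>x. x \<in> S \<Longrightarrow> (g has_real_derivative g' x) (at x)" "\<And>x. x \<in> S \<Longrightarrow> \<bar>g' x\<bar> \<le> L" "0 \<le> L"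
  shows "L-lipschitz_on S g"
proof (rule lipschitz_onI)
  fix x y assume "x \<in> S" "y \<in> S"
  then have "norm (g x - g y) \<le> L * norm (x - y)"
    using assms by (intro field_differentiable_bound[of S g g']) (auto intro: has_field_derivative_at_within)
  then show "dist (g x) (g y) \<le> L * dist x y" by (simp add: dist_norm)
qed (use assms in auto)

lemma Lip_a_le_derivative:
  fixes g :: "real \<Rightarrow> real"
  assumes d: "\<And>x. (g has_real_derivative g' x) (at x)" and C: "\<And>x. \<bar>g' x\<bar> \<le> C" and cont: "isCont g' y"
  shows "Lip_a g y \<le> \<bar>g' y\<bar>"
proof (rule field_le_epsilon)
  fix e :: real assume e: "0 < e"
  have C0: "0 \<le> C" using C[of 0] by linarith
  have g: "C-lipschitz_on UNIV g" by (rule lipschitz_on_derivative_bound[OF convex_UNIV d C C0])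
  obtain \<rho> where \<rho>: "0 < \<rho>" "\<And>x. dist x y < \<rho> \<Longrightarrow> dist (g' x) (g' y) < e"
    using cont e unfolding continuous_at_eps_delta by blast
  have "(\<bar>g' y\<bar> + e)-lipschitz_on (ball y \<rho>) g"
  proof (rule lipschitz_on_derivative_bound[OF convex_ball d])
    fix x assume "x \<in> ball y \<rho>"
    then show "\<bar>g' x\<bar> \<le> \<bar>g' y\<bar> + e" using \<rho>(2)[of x] by (simp add: dist_real_def abs_minus_commute)
  qed (use e in auto)
  from Lip_a_le(2)[OF g \<rho>(1) this] show "Lip_a g y \<le> \<bar>g' y\<bar> + e" .
qed

lemma sets_floor_cell:
  fixes \<phi> :: "'a \<Rightarrow> real ^ 'n"
  assumes [measurable]: "\<And>i. (\<lambda>x. \<phi> x $ i) \<in> borel_measurable M" "S \<in> sets M"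
  shows "{x \<in> S. \<forall>i. \<lfloor>\<phi> x $ i / s\<rfloor> = m i} \<in> sets M"
proof -
  have "{x \<in> S. \<forall>i. \<lfloor>\<phi> x $ i / s\<rfloor> = m i} = S \<inter> {x \<in> space M. \<forall>i. \<lfloor>\<phi> x $ i / s\<rfloor> = m i}"
    using sets.sets_into_space[OF assms(2)] by auto
  also have "\<dots> \<in> sets M" by measurable
  finally show ?thesis .
qed

text \<open>A grid of side \<open>r / CARD('n)\<close> in the target splits \<open>S\<close> into
  countably many pieces on which \<phi> varies by at most \<open>r\<close>, and the local
  inequalities add up by countable additivity. Pieces are numbered through \<open>to_nat\<close>;
  numbers outside its range give empty pieces.\<close>

lemma measure_le_of_small_pieces:
  fixes \<phi> :: "'a \<Rightarrow> real ^ 'n"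
  assumes N1: "finite_measure N1" "sets N1 = sets M" and N2: "finite_measure N2" "sets N2 = sets M"
    and \<phi>: "\<And>i. (\<lambda>x. \<phi> x $ i) \<in> borel_measurable M" and S: "S \<in> sets M" and r: "0 < r"
    and piece: "\<And>T x. T \<in> sets M \<Longrightarrow> T \<subseteq> S \<Longrightarrow> x \<in> T \<Longrightarrow> (\<And>y. y \<in> T \<Longrightarrow> norm (\<phi> y - \<phi> x) \<le> r) \<Longrightarrow>
      measure N1 T \<le> k * measure N2 T"
  shows "measure N1 S \<le> k * measure N2 S"
proof -
  define s where "s = r / real CARD('n)"
  have s: "0 < s" using r by (simp add: s_def)
  define T where "T j = {x \<in> S. to_nat (\<lambda>i. \<lfloor>\<phi> x $ i / s\<rfloor>) = j}" for j
  have T: "T j \<in> sets M" for j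
  proof (cases "\<exists>m :: 'n \<Rightarrow> int. to_nat m = j")
    case True
    then obtain m :: "'n \<Rightarrow> int" where "j = to_nat m" by blast
    then have "T j = {x \<in> S. \<forall>i. \<lfloor>\<phi> x $ i / s\<rfloor> = m i}" by (auto simp: T_def fun_eq_iff)
    then show ?thesis using sets_floor_cell[OF \<phi> S] by simp
  next
    case False
    then have "T j = {}" by (auto simp: T_def)
    then show ?thesis by simp
  qed
  have disj: "disjoint_family T" by (auto simp: disjoint_family_on_def T_def)
  have un: "(\<Union>j. T j) = S" by (auto simp: T_def)
  have le: "measure N1 (T j) \<le> k * measure N2 (T j)" for j
  proof (cases "T j = {}")
    case False
    then obtain x where x: "x \<in> T j" by blast
    have "norm (\<phi> y - \<phi> x) \<le> r" if y: "y \<in> T j" for y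
    proof -
      have fl: "\<lfloor>\<phi> y $ i / s\<rfloor> = \<lfloor>\<phi> x $ i / s\<rfloor>" for i
      proof -
        have "to_nat (\<lambda>i. \<lfloor>\<phi> y $ i / s\<rfloor>) = to_nat (\<lambda>i. \<lfloor>\<phi> x $ i / s\<rfloor>)" using x y by (simp add: T_def)
        then have "(\<lambda>i. \<lfloor>\<phi> y $ i / s\<rfloor>) = (\<lambda>i. \<lfloor>\<phi> x $ i / s\<rfloor>)" by simp
        then show ?thesis by (rule fun_cong)
      qed
      have "\<bar>\<phi> y $ i - \<phi> x $ i\<bar> \<le> s" for i
      proof -
        have "\<bar>\<phi> y $ i / s - \<phi> x $ i / s\<bar> < 1" using fl[of i] by linarith
        moreover have "\<phi> y $ i / s - \<phi> x $ i / s = (\<phi> y $ i - \<phi> x $ i) / s" by (rule diff_divide_distrib[symmetric])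
        ultimately show ?thesis using s by (simp add: abs_divide pos_divide_less_eq)
      qed
      then have "(\<Sum>i\<in>UNIV. \<bar>(\<phi> y - \<phi> x) $ i\<bar>) \<le> (\<Sum>i\<in>(UNIV :: 'n set). s)" by (intro sum_mono) simp
      then show ?thesis using norm_le_l1_cart[of "\<phi> y - \<phi> x"] by (simp add: s_def)
    qed
    then show ?thesis using T x by (intro piece[of "T j" x]) (auto simp: T_def)
  qed simp
  interpret N1: finite_measure N1 by fact
  interpret N2: finite_measure N2 by fact
  have 1: "(\<lambda>j. measure N1 (T j)) sums measure N1 S"
    unfolding un[symmetric] using T N1(2) disj by (intro N1.finite_measure_UNION) auto
  have 2: "(\<lambda>j. measure N2 (T j)) sums measure N2 S"
    unfolding un[symmetric] using T N2(2) disj by (intro N2.finite_measure_UNION) auto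
  show ?thesis by (rule sums_le[OF le 1 sums_mult[OF 2]])
qed

section \<open>Calculus of the energy seminorms\<close>

locale energy_map = dirichlet_structure p M E F \<Gamma>
  for p :: real and M :: "'a measure" and E F \<Gamma> +
  fixes \<phi> :: "'a \<Rightarrow> real ^ 'n"
  assumes p: "1 < p" and \<phi>: "\<And>i. (\<lambda>x. \<phi> x $ i) \<in> F"
begin

abbreviation \<Lambda> :: "'a measure" where "\<Lambda> \<equiv> energy_sum M \<Gamma> \<phi>"

text \<open>The root makes this a seminorm in \<open>f\<close> for each fixed set, so triangle
  inequalities are available on every piece of a partition.\<close>

definition energy_norm :: "('a \<Rightarrow> real) \<Rightarrow> 'a set \<Rightarrow> real"
  where "energy_norm f S = measure (\<Gamma> f) S powr (1 / p)"

lemma F_zero: "(\<lambda>x. 0) \<in> F"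
  using F_scale[OF F_one, of 0] by simp

lemma F_const: "(\<lambda>x. c) \<in> F"
  using F_scale[OF F_one, of c] by simp

lemma F_diff: "f \<in> F \<Longrightarrow> g \<in> F \<Longrightarrow> (\<lambda>x. f x - g x) \<in> F"
  using F_add[OF _ F_scale[of g "-1"], of f] by simp

lemma F_sum: "(\<And>i. i \<in> I \<Longrightarrow> f i \<in> F) \<Longrightarrow> (\<lambda>x. \<Sum>i\<in>I. f i x) \<in> F"
proof (induction I rule: infinite_finite_induct)
  case (insert i I)
  then show ?case using F_add[of "f i" "\<lambda>x. \<Sum>i\<in>I. f i x"] by simp
qed (simp_all add: F_zero)

lemma F_measurable: "f \<in> F \<Longrightarrow> f \<in> borel_measurable M"
  using subsetD[OF F_subset, of f] by (simp add: Lp_space_def)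

lemma energy_norm_nonneg: "0 \<le> energy_norm f S"
  by (simp add: energy_norm_def)

lemma measure_eq_energy_norm: "measure (\<Gamma> f) S = energy_norm f S powr p"
  using p by (simp add: energy_norm_def powr_powr)

lemma energy_norm_add:
  "f \<in> F \<Longrightarrow> g \<in> F \<Longrightarrow> S \<in> sets M \<Longrightarrow> energy_norm (\<lambda>x. f x + g x) S \<le> energy_norm f S + energy_norm g S"
  unfolding energy_norm_def by (rule \<Gamma>_triangle)

lemma energy_norm_scale:
  assumes "f \<in> F" "S \<in> sets M"
  shows "energy_norm (\<lambda>x. c * f x) S = \<bar>c\<bar> * energy_norm f S"
proof -
  have "measure (\<Gamma> (\<lambda>x. c * f x)) S = \<bar>c\<bar> powr p * measure (\<Gamma> f) S"
    using \<Gamma>_scale[OF assms, of c] by (simp add: measure_def enn2real_mult)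
  then show ?thesis using p by (simp add: energy_norm_def powr_mult powr_powr)
qed

lemma energy_norm_const: "S \<in> sets M \<Longrightarrow> energy_norm (\<lambda>x. c) S = 0"
  using locality[OF F_const, of S c c] p by (simp add: energy_norm_def measure_def)

lemma energy_norm_sum:
  assumes "\<And>i. i \<in> I \<Longrightarrow> f i \<in> F" "S \<in> sets M"
  shows "energy_norm (\<lambda>x. \<Sum>i\<in>I. f i x) S \<le> (\<Sum>i\<in>I. energy_norm (f i) S)"
  using assms(1)
proof (induction I rule: infinite_finite_induct)
  case (insert i I)
  have "energy_norm (\<lambda>x. f i x + (\<Sum>i\<in>I. f i x)) S \<le> energy_norm (f i) S + energy_norm (\<lambda>x. \<Sum>i\<in>I. f i x) S"
    by (intro energy_norm_add assms(2) F_sum) (use insert.prems in auto)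
  also have "\<dots> \<le> energy_norm (f i) S + (\<Sum>i\<in>I. energy_norm (f i) S)"
    using insert by simp
  finally show ?case using insert by simp
qed (use assms in \<open>simp_all add: energy_norm_const\<close>)

text \<open>The chain rule of the structure concerns functions with \<open>g 0 = 0\<close>;
  subtracting the constant \<open>g 0\<close> changes no energy, by locality. The asymptotic
  Lipschitz constant is bounded by \<open>\<bar>g'\<bar>\<close>, so the factor \<open>b\<close>
  comes from the values of \<open>f\<close> on \<open>S\<close> alone.\<close>

lemma energy_norm_chain:
  assumes f: "f \<in> F" and S: "S \<in> sets M" and d: "\<And>x. (g has_real_derivative g' x) (at x)" and C: "\<And>x. \<bar>g' x\<bar> \<le> C"
    and cont: "continuous_on UNIV g'" and b: "\<And>x. x \<in> S \<Longrightarrow> \<bar>g' (f x)\<bar> \<le> b" and b0: "0 \<le> b"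
  shows "(\<lambda>x. g (f x)) \<in> F" "energy_norm (\<lambda>x. g (f x)) S \<le> b * energy_norm f S"
proof -
  define h where "h x = g x - g 0" for x
  have dh: "(h has_real_derivative g' x) (at x)" for x
    unfolding h_def using d[of x] by (auto intro!: derivative_eq_intros)
  have C0: "0 \<le> C" using C[of 0] by linarith
  have lip: "C-lipschitz_on UNIV h" by (rule lipschitz_on_derivative_bound[OF convex_UNIV dh C C0])
  have h0: "h 0 = 0" by (simp add: h_def)
  have hF: "h \<circ> f \<in> F" by (rule chain_closed[OF f lip h0])
  have eq: "(\<lambda>x. (h \<circ> f) x + g 0) = (\<lambda>x. g (f x))" by (simp add: h_def fun_eq_iff)
  show "(\<lambda>x. g (f x)) \<in> F" using F_add[OF hF F_const[of "g 0"]] unfolding eq .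
  have "energy_norm (\<lambda>x. g (f x)) S \<le> energy_norm (h \<circ> f) S"
    using energy_norm_add[OF hF F_const S, of "g 0"] energy_norm_const[OF S] unfolding eq by simp
  also have "\<dots> \<le> b * energy_norm f S"
  proof -
    interpret \<Gamma>f: finite_measure "\<Gamma> f" by (rule finite_\<Gamma>[OF f])
    interpret \<Gamma>h: finite_measure "\<Gamma> (h \<circ> f)" by (rule finite_\<Gamma>[OF hF])
    have SF: "S \<in> sets (\<Gamma> f)" using S sets_\<Gamma>[OF f] by simp
    have L: "Lip_a h (f x) powr p \<le> b powr p" if "x \<in> S" for x
    proof (rule powr_mono2)
      show "0 \<le> Lip_a h (f x)" by (rule Lip_a_le(1)[OF lip zero_less_one lipschitz_on_subset[OF lip subset_UNIV]])
      show "Lip_a h (f x) \<le> b"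
        using Lip_a_le_derivative[OF dh C, of "f x"] cont b[OF that] by (auto simp: continuous_on_eq_continuous_at)
    qed (use p in auto)
    have "emeasure (\<Gamma> (h \<circ> f)) S \<le> emeasure (density (\<Gamma> f) (\<lambda>x. ennreal (Lip_a h (f x) powr p))) S"
      by (rule chain_le[OF f lip h0 S])
    also have "\<dots> \<le> ennreal (b powr p) * emeasure (\<Gamma> f) S"
    proof -
      \<comment> \<open>No measurability of \<open>Lip_a h\<close> is established: if the integrals
        do not define a measure, \<open>density\<close> has the default value 0, and the inequality
        holds in either case.\<close>
      have "emeasure (density (\<Gamma> f) (\<lambda>x. ennreal (Lip_a h (f x) powr p))) S
        \<le> (\<integral>\<^sup>+x. ennreal (Lip_a h (f x) powr p) * indicator S x \<partial>\<Gamma> f)"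
        unfolding density_def by (simp add: emeasure_measure_of_conv)
      also have "\<dots> \<le> (\<integral>\<^sup>+x. ennreal (b powr p) * indicator S x \<partial>\<Gamma> f)"
        using L by (intro nn_integral_mono) (auto simp: indicator_def intro: ennreal_leI)
      also have "\<dots> = ennreal (b powr p) * emeasure (\<Gamma> f) S"
        using SF by (rule nn_integral_cmult_indicator)
      finally show ?thesis .
    qed
    also have "\<dots> = ennreal (b powr p * measure (\<Gamma> f) S)"
      by (simp add: \<Gamma>f.emeasure_eq_measure ennreal_mult)
    finally have "measure (\<Gamma> (h \<circ> f)) S \<le> b powr p * measure (\<Gamma> f) S"
      by (simp add: \<Gamma>h.emeasure_eq_measure)
    then have "measure (\<Gamma> (h \<circ> f)) S powr (1 / p) \<le> (b powr p * measure (\<Gamma> f) S) powr (1 / p)"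
      using p by (intro powr_mono2) auto
    then show ?thesis using p b0 by (simp add: energy_norm_def powr_mult powr_powr)
  qed
  finally show "energy_norm (\<lambda>x. g (f x)) S \<le> b * energy_norm f S" .
qed

lemma emeasure_\<Lambda>: "S \<in> sets M \<Longrightarrow> emeasure \<Lambda> S = (\<Sum>i\<in>UNIV. emeasure (\<Gamma> (\<lambda>x. \<phi> x $ i)) S)"
  by (rule emeasure_energy_sum) (use sets_\<Gamma>[OF \<phi>] in auto)

lemma finite_\<Lambda>: "finite_measure \<Lambda>"
proof (rule finite_measureI)
  have "emeasure (\<Gamma> (\<lambda>x. \<phi> x $ i)) (space M) \<noteq> \<infinity>" for i
    using finite_measure.emeasure_finite[OF finite_\<Gamma>[OF \<phi>]] by auto
  then show "emeasure \<Lambda> (space \<Lambda>) \<noteq> \<infinity>"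
    by (simp add: emeasure_\<Lambda>)
qed

lemma energy_norm_component_le: "S \<in> sets M \<Longrightarrow> energy_norm (\<lambda>x. \<phi> x $ i) S \<le> measure \<Lambda> S powr (1 / p)"
proof -
  assume S: "S \<in> sets M"
  interpret \<Lambda>: finite_measure \<Lambda> by (rule finite_\<Lambda>)
  interpret \<Gamma>i: finite_measure "\<Gamma> (\<lambda>x. \<phi> x $ i)" by (rule finite_\<Gamma>[OF \<phi>])
  have "emeasure (\<Gamma> (\<lambda>x. \<phi> x $ i)) S \<le> emeasure \<Lambda> S"
    unfolding emeasure_\<Lambda>[OF S] by (rule member_le_sum) auto
  then have "measure (\<Gamma> (\<lambda>x. \<phi> x $ i)) S \<le> measure \<Lambda> S"
    by (simp add: \<Lambda>.emeasure_eq_measure \<Gamma>i.emeasure_eq_measure)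
  then show ?thesis unfolding energy_norm_def using p by (intro powr_mono2) auto
qed

lemma inner_\<phi>_in_F: "(\<lambda>x. l \<bullet> \<phi> x) \<in> F"
  unfolding inner_vec_def inner_real_def by (intro F_sum F_scale \<phi>)

lemma energy_norm_inner_le:
  assumes S: "S \<in> sets M"
  shows "energy_norm (\<lambda>x. l \<bullet> \<phi> x) S \<le> real CARD('n) * norm l * measure \<Lambda> S powr (1 / p)"
proof -
  have "energy_norm (\<lambda>x. l \<bullet> \<phi> x) S \<le> (\<Sum>i\<in>UNIV. energy_norm (\<lambda>x. l $ i * \<phi> x $ i) S)"
    unfolding inner_vec_def inner_real_def by (intro energy_norm_sum F_scale \<phi> S)
  also have "\<dots> \<le> (\<Sum>i\<in>(UNIV :: 'n set). norm l * measure \<Lambda> S powr (1 / p))"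
    unfolding energy_norm_scale[OF \<phi> S]
    by (intro sum_mono mult_mono component_le_norm_cart energy_norm_component_le S energy_norm_nonneg) auto
  finally show ?thesis by simp
qed

text \<open>For a wave, \<open>k \<bullet> \<phi>\<close> is a linear combination of the components
  and the cosine is Lipschitz. The set \<open>{}\<close> and the bound 0 are dummies, as only
  membership is drawn from the chain rule.\<close>

lemma trig_field_comp_in_F: "trig_field W G D \<Longrightarrow> (\<lambda>x. G (\<phi> x) $ j) \<in> F"
proof (induction rule: trig_field.induct)
  case zero
  then show ?case by (simp add: F_zero)
next
  case (wave k \<beta> a)
  have d: "((\<lambda>s. cos (s + \<beta>)) has_real_derivative - sin (s + \<beta>)) (at s)" for s
    by (auto intro!: derivative_eq_intros)
  have "(\<lambda>x. cos (k \<bullet> \<phi> x + \<beta>)) \<in> F"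
    by (rule energy_norm_chain(1)[where S = "{}" and f = "\<lambda>x. k \<bullet> \<phi> x" and g = "\<lambda>s. cos (s + \<beta>)"
        and g' = "\<lambda>s. - sin (s + \<beta>)" and C = 1 and b = 0])
      (auto intro!: d inner_\<phi>_in_F continuous_intros)
  from F_scale[OF this, of "a $ j"] show ?case by (simp add: mult.commute)
next
  case (add G D G' D')
  then show ?case using F_add by simp
qed

text \<open>Only functions of one real variable may be composed with elements of \<open>F\<close>.  Freezing the
  gradient at a point of a small cell turns this into a first-order Taylor estimate for all
  trigonometric fields.\<close>

definition freezes :: "real \<Rightarrow> (real ^ 'n \<Rightarrow> real ^ 'n) \<Rightarrow> (real ^ 'n \<Rightarrow> real ^ 'n ^ 'n) \<Rightarrow> 'n \<Rightarrow> bool"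
  where "freezes C G D j \<longleftrightarrow> 0 \<le> C \<and> (\<forall>r y S. 0 < r \<longrightarrow> S \<in> sets M \<longrightarrow> (\<forall>x\<in>S. norm (\<phi> x - y) \<le> r) \<longrightarrow>
    energy_norm (\<lambda>x. G (\<phi> x) $ j - (D y $ j) \<bullet> \<phi> x) S \<le> C * r * measure \<Lambda> S powr (1 / p))"

text \<open>For a wave the difference is a function \<open>g\<close> of
  \<open>k \<bullet> \<phi>\<close> alone. Its derivative there is a multiple of a difference of two
  sines, hence of order \<open>norm k * r\<close> wherever \<phi> is within \<open>r\<close> of
  \<open>y\<close>. Sums of fields add their constants.\<close>

lemma trig_field_freezes: "trig_field W G D \<Longrightarrow> \<exists>C. freezes C G D j"
proof (induction rule: trig_field.induct)
  case zero
  have "freezes 0 (\<lambda>x. 0) (\<lambda>x. 0) j" by (simp add: freezes_def energy_norm_const)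
  then show ?case by (rule exI)
next
  case (wave k \<beta> a)
  define C where "C = \<bar>a $ j\<bar> * norm k * (real CARD('n) * norm k)"
  have "energy_norm (\<lambda>x. (cos (k \<bullet> \<phi> x + \<beta>) *\<^sub>R a) $ j - ((- sin (k \<bullet> y + \<beta>) *\<^sub>R outer a k) $ j) \<bullet> \<phi> x) S
     \<le> C * r * measure \<Lambda> S powr (1 / p)"
    if r: "0 < r" and S: "S \<in> sets M" and near: "\<forall>x\<in>S. norm (\<phi> x - y) \<le> r" for r y S
  proof -
    define g where "g s = a $ j * (cos (s + \<beta>) + sin (k \<bullet> y + \<beta>) * s)" for s
    define g' where "g' s = a $ j * (- sin (s + \<beta>) + sin (k \<bullet> y + \<beta>))" for s
    have row: "outer a k $ j = a $ j *\<^sub>R k" by (simp add: outer_def vec_eq_iff)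
    have eq: "(\<lambda>x. (cos (k \<bullet> \<phi> x + \<beta>) *\<^sub>R a) $ j - ((- sin (k \<bullet> y + \<beta>) *\<^sub>R outer a k) $ j) \<bullet> \<phi> x) = (\<lambda>x. g (k \<bullet> \<phi> x))"
      by (simp add: g_def fun_eq_iff row algebra_simps)
    have "energy_norm (\<lambda>x. g (k \<bullet> \<phi> x)) S \<le> (\<bar>a $ j\<bar> * (norm k * r)) * energy_norm (\<lambda>x. k \<bullet> \<phi> x) S"
    proof (rule energy_norm_chain(2)[OF inner_\<phi>_in_F S])
      show "(g has_real_derivative g' s) (at s)" for s
        unfolding g_def g'_def by (auto intro!: derivative_eq_intros)
      show "\<bar>g' s\<bar> \<le> \<bar>a $ j\<bar> * 2" for s
        unfolding g'_def abs_mult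
        by (intro mult_left_mono) (use abs_sin_le_one[of "s + \<beta>"] abs_sin_le_one[of "k \<bullet> y + \<beta>"] in linarith, simp)
      show "continuous_on UNIV g'" unfolding g'_def by (intro continuous_intros)
      show "\<bar>g' (k \<bullet> \<phi> x)\<bar> \<le> \<bar>a $ j\<bar> * (norm k * r)" if "x \<in> S" for x
        unfolding g'_def abs_mult
      proof (intro mult_left_mono)
        have "\<bar>sin (k \<bullet> y + \<beta>) - sin (k \<bullet> \<phi> x + \<beta>)\<bar> \<le> 1 * \<bar>(k \<bullet> y + \<beta>) - (k \<bullet> \<phi> x + \<beta>)\<bar>"
          using field_differentiable_bound[of UNIV sin cos 1 "k \<bullet> y + \<beta>" "k \<bullet> \<phi> x + \<beta>"]
          by (auto intro: DERIV_sin)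
        also have "\<dots> = \<bar>k \<bullet> (\<phi> x - y)\<bar>" by (simp add: inner_diff_right abs_minus_commute)
        also have "\<dots> \<le> norm k * norm (\<phi> x - y)" by (rule Cauchy_Schwarz_ineq2)
        also have "\<dots> \<le> norm k * r" using near that by (intro mult_left_mono) auto
        finally show "\<bar>- sin (k \<bullet> \<phi> x + \<beta>) + sin (k \<bullet> y + \<beta>)\<bar> \<le> norm k * r" by simp
      qed simp
      show "0 \<le> \<bar>a $ j\<bar> * (norm k * r)" using r by simp
    qed
    also have "\<dots> \<le> (\<bar>a $ j\<bar> * (norm k * r)) * (real CARD('n) * norm k * measure \<Lambda> S powr (1 / p))"
      using r by (intro mult_left_mono energy_norm_inner_le S) auto
    finally show ?thesis unfolding eq by (simp add: C_def mult_ac)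
  qed
  moreover have "0 \<le> C" by (simp add: C_def)
  ultimately have "freezes C (\<lambda>x. cos (k \<bullet> x + \<beta>) *\<^sub>R a) (\<lambda>x. - sin (k \<bullet> x + \<beta>) *\<^sub>R outer a k) j"
    unfolding freezes_def by (intro conjI allI impI)
  then show ?case by (rule exI)
next
  case (add G D G' D')
  then obtain C C' where fr: "freezes C G D j" "freezes C' G' D' j" by blast
  note b = fr(1)[unfolded freezes_def, THEN conjunct2, rule_format]
    and b' = fr(2)[unfolded freezes_def, THEN conjunct2, rule_format]
  have C: "0 \<le> C" "0 \<le> C'" using fr by (simp_all add: freezes_def)
  have "energy_norm (\<lambda>x. (G (\<phi> x) + G' (\<phi> x)) $ j - ((D y + D' y) $ j) \<bullet> \<phi> x) S \<le> (C + C') * r * measure \<Lambda> S powr (1 / p)"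
    if r: "0 < r" and S: "S \<in> sets M" and near: "\<forall>x\<in>S. norm (\<phi> x - y) \<le> r" for r y S
  proof -
    have eq: "(\<lambda>x. (G (\<phi> x) + G' (\<phi> x)) $ j - ((D y + D' y) $ j) \<bullet> \<phi> x)
      = (\<lambda>x. (G (\<phi> x) $ j - (D y $ j) \<bullet> \<phi> x) + (G' (\<phi> x) $ j - (D' y $ j) \<bullet> \<phi> x))"
      by (simp add: fun_eq_iff inner_add_left)
    have "energy_norm (\<lambda>x. (G (\<phi> x) + G' (\<phi> x)) $ j - ((D y + D' y) $ j) \<bullet> \<phi> x) S \<le>
      energy_norm (\<lambda>x. G (\<phi> x) $ j - (D y $ j) \<bullet> \<phi> x) S + energy_norm (\<lambda>x. G' (\<phi> x) $ j - (D' y $ j) \<bullet> \<phi> x) S"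
      unfolding eq
      by (intro energy_norm_add F_diff inner_\<phi>_in_F S trig_field_comp_in_F[OF add.hyps(1)] trig_field_comp_in_F[OF add.hyps(2)])
    also have "\<dots> \<le> C * r * measure \<Lambda> S powr (1 / p) + C' * r * measure \<Lambda> S powr (1 / p)"
      using near by (intro add_mono b b' r S) auto
    finally show ?thesis by (simp add: algebra_simps)
  qed
  moreover have "0 \<le> C + C'" using C by simp
  ultimately have "freezes (C + C') (\<lambda>x. G x + G' x) (\<lambda>x. D x + D' x) j"
    unfolding freezes_def by (intro conjI allI impI)
  then show ?case by (rule exI)
qed

end

section \<open>Two-sided energy bounds by the pointwise size of the derivative\<close>

context energy_map
begin

lemma \<phi>_measurable: "\<phi> \<in> borel_measurable M"
  using F_measurable[OF \<phi>]
  by (subst borel_measurable_euclidean_space) (auto simp: Basis_vec_def inner_axis)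

lemma energy_norm_diff_le:
  assumes "f \<in> F" "g \<in> F" "S \<in> sets M"
  shows "energy_norm f S \<le> energy_norm g S + energy_norm (\<lambda>x. f x - g x) S"
  using energy_norm_add[OF assms(2) F_diff[OF assms(1,2)] assms(3)] by simp

lemma energy_norm_minus_commute:
  assumes "f \<in> F" "g \<in> F" "S \<in> sets M"
  shows "energy_norm (\<lambda>x. g x - f x) S = energy_norm (\<lambda>x. f x - g x) S"
  using energy_norm_scale[OF F_diff[OF assms(1,2)] assms(3), of "-1"] by simp

lemma powr_limit_le:
  fixes a b :: real
  assumes le: "\<And>r. 0 < r \<Longrightarrow> a \<le> (b + C * r) powr p * c" and b: "0 \<le> b" and C: "0 \<le> C"
  shows "a \<le> b powr p * c"
proof -
  have "((\<lambda>r. (b + C * r) powr p * c) \<longlongrightarrow> (b + C * 0) powr p * c) (at_right 0)"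
  proof (intro tendsto_mult tendsto_powr' tendsto_add tendsto_const tendsto_ident_at)
    have "\<forall>\<^sub>F r in at_right 0. 0 \<le> b + C * r"
      unfolding eventually_at_right_field using b C by (intro exI[of _ 1]) auto
    then show "b + C * 0 \<noteq> 0 \<or> 0 < p \<and> (\<forall>\<^sub>F r in at_right 0. 0 \<le> b + C * r)"
      using p by simp
  qed
  moreover have "\<forall>\<^sub>F r in at_right 0. a \<le> (b + C * r) powr p * c"
    using le by (auto simp: eventually_at_right_field intro: exI[of _ 1])
  ultimately have "a \<le> (b + C * 0) powr p * c"
    by (intro tendsto_lowerbound) auto
  then show ?thesis by simp
qed

text \<open>On a piece where \<phi> varies by at most \<open>r\<close>, the composed field is
  compared with the linear function whose gradient is frozen at one point, with an error of order
  \<open>C * r\<close>. Summation over pieces keeps the bound, and letting \<open>r\<close> tend to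
  0 removes the field-dependent \<open>C\<close>.\<close>

lemma measure_trig_field_le:
  assumes G: "trig_field W G D" and S: "S \<in> sets M" and b: "0 \<le> b" "\<And>x. x \<in> S \<Longrightarrow> norm (D (\<phi> x) $ j) \<le> b"
  shows "measure (\<Gamma> (\<lambda>x. G (\<phi> x) $ j)) S \<le> (real CARD('n) * b) powr p * measure \<Lambda> S"
proof -
  obtain C where fr: "freezes C G D j" using trig_field_freezes[OF G] by blast
  note frz = fr[unfolded freezes_def, THEN conjunct2, rule_format]
  have C: "0 \<le> C" using fr by (simp add: freezes_def)
  have GF: "(\<lambda>x. G (\<phi> x) $ j) \<in> F" by (rule trig_field_comp_in_F[OF G])
  have "measure (\<Gamma> (\<lambda>x. G (\<phi> x) $ j)) S \<le> (real CARD('n) * b + C * r) powr p * measure \<Lambda> S" if r: "0 < r" for r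
  proof (rule measure_le_of_small_pieces[where \<phi> = \<phi> and M = M and r = r])
    fix T x assume T: "T \<in> sets M" "T \<subseteq> S" "x \<in> T" and near: "\<And>y. y \<in> T \<Longrightarrow> norm (\<phi> y - \<phi> x) \<le> r"
    let ?l = "D (\<phi> x) $ j"
    have "energy_norm (\<lambda>x. G (\<phi> x) $ j) T \<le> energy_norm (\<lambda>z. ?l \<bullet> \<phi> z) T + energy_norm (\<lambda>z. G (\<phi> z) $ j - ?l \<bullet> \<phi> z) T"
      by (rule energy_norm_diff_le[OF GF inner_\<phi>_in_F T(1)])
    also have "\<dots> \<le> real CARD('n) * norm ?l * measure \<Lambda> T powr (1 / p) + C * r * measure \<Lambda> T powr (1 / p)"
      using near by (intro add_mono energy_norm_inner_le T frz r) auto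
    also have "\<dots> \<le> (real CARD('n) * b) * measure \<Lambda> T powr (1 / p) + C * r * measure \<Lambda> T powr (1 / p)"
      using b(2)[of x] T r C by (intro add_mono mult_right_mono mult_left_mono) auto
    also have "\<dots> = (real CARD('n) * b + C * r) * measure \<Lambda> T powr (1 / p)" by (simp add: distrib_right)
    finally have "energy_norm (\<lambda>x. G (\<phi> x) $ j) T powr p \<le> ((real CARD('n) * b + C * r) * measure \<Lambda> T powr (1 / p)) powr p"
      using p by (intro powr_mono2 energy_norm_nonneg) auto
    then show "measure (\<Gamma> (\<lambda>x. G (\<phi> x) $ j)) T \<le> (real CARD('n) * b + C * r) powr p * measure \<Lambda> T"
      using p b C r by (simp add: measure_eq_energy_norm powr_mult powr_powr)
  qed (use r S finite_\<Lambda> finite_\<Gamma>[OF GF] sets_\<Gamma>[OF GF] F_measurable[OF \<phi>] in auto)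
  from powr_limit_le[OF this] show ?thesis using b(1) C by simp
qed

lemma measure_trig_field_ge:
  assumes G: "trig_field W G D" and S: "S \<in> sets M" and b: "0 \<le> b" "\<And>x. x \<in> S \<Longrightarrow> b \<le> norm (D (\<phi> x) $ j)"
    and \<kappa>: "0 < \<kappa>" "\<And>l T. T \<in> sets M \<Longrightarrow> T \<subseteq> S \<Longrightarrow> \<kappa> * norm l * measure \<Lambda> T powr (1 / p) \<le> energy_norm (\<lambda>x. l \<bullet> \<phi> x) T"
  shows "(\<kappa> * b) powr p * measure \<Lambda> S \<le> measure (\<Gamma> (\<lambda>x. G (\<phi> x) $ j)) S"
proof (cases "b = 0")
  case True
  then show ?thesis using p by simp
next
  case False
  then have kb: "0 < \<kappa> * b" using b \<kappa> by simp
  obtain C where fr: "freezes C G D j" using trig_field_freezes[OF G] by blast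
  note frz = fr[unfolded freezes_def, THEN conjunct2, rule_format]
  have C: "0 \<le> C" using fr by (simp add: freezes_def)
  have GF: "(\<lambda>x. G (\<phi> x) $ j) \<in> F" by (rule trig_field_comp_in_F[OF G])
  have key: "measure \<Lambda> S \<le> (1 / (\<kappa> * b - C * r) powr p) * measure (\<Gamma> (\<lambda>x. G (\<phi> x) $ j)) S"
    if r: "0 < r" "C * r < \<kappa> * b" for r
  proof (rule measure_le_of_small_pieces[where \<phi> = \<phi> and M = M and r = r])
    fix T x assume T: "T \<in> sets M" "T \<subseteq> S" "x \<in> T" and near: "\<And>y. y \<in> T \<Longrightarrow> norm (\<phi> y - \<phi> x) \<le> r"
    let ?l = "D (\<phi> x) $ j"
    have "(\<kappa> * b) * measure \<Lambda> T powr (1 / p) \<le> (\<kappa> * norm ?l) * measure \<Lambda> T powr (1 / p)"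
      using b(2)[of x] T \<kappa> by (intro mult_right_mono mult_left_mono) auto
    also have "\<dots> \<le> energy_norm (\<lambda>z. ?l \<bullet> \<phi> z) T" by (rule \<kappa>(2)[OF T(1,2)])
    also have "\<dots> \<le> energy_norm (\<lambda>x. G (\<phi> x) $ j) T + energy_norm (\<lambda>z. ?l \<bullet> \<phi> z - G (\<phi> z) $ j) T"
      by (rule energy_norm_diff_le[OF inner_\<phi>_in_F GF T(1)])
    also have "\<dots> = energy_norm (\<lambda>x. G (\<phi> x) $ j) T + energy_norm (\<lambda>z. G (\<phi> z) $ j - ?l \<bullet> \<phi> z) T"
      by (simp only: energy_norm_minus_commute[OF GF inner_\<phi>_in_F T(1)])
    also have "\<dots> \<le> energy_norm (\<lambda>x. G (\<phi> x) $ j) T + C * r * measure \<Lambda> T powr (1 / p)"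
      using near by (intro add_left_mono frz r T) auto
    finally have "(\<kappa> * b - C * r) * measure \<Lambda> T powr (1 / p) \<le> energy_norm (\<lambda>x. G (\<phi> x) $ j) T"
      by (simp add: left_diff_distrib)
    then have "((\<kappa> * b - C * r) * measure \<Lambda> T powr (1 / p)) powr p \<le> energy_norm (\<lambda>x. G (\<phi> x) $ j) T powr p"
      using p r by (intro powr_mono2) auto
    then have "(\<kappa> * b - C * r) powr p * measure \<Lambda> T \<le> measure (\<Gamma> (\<lambda>x. G (\<phi> x) $ j)) T"
      using p r by (simp add: measure_eq_energy_norm powr_mult powr_powr)
    then show "measure \<Lambda> T \<le> (1 / (\<kappa> * b - C * r) powr p) * measure (\<Gamma> (\<lambda>x. G (\<phi> x) $ j)) T"
      using r by (simp add: pos_le_divide_eq mult.commute)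
  qed (use r S finite_\<Lambda> finite_\<Gamma>[OF GF] sets_\<Gamma>[OF GF] F_measurable[OF \<phi>] in auto)
  have "((\<lambda>r. (\<kappa> * b - C * r) powr p * measure \<Lambda> S) \<longlongrightarrow> (\<kappa> * b - C * 0) powr p * measure \<Lambda> S) (at_right 0)"
    using kb by (intro tendsto_mult tendsto_powr tendsto_diff tendsto_const tendsto_ident_at) auto
  moreover have "\<forall>\<^sub>F r in at_right 0. (\<kappa> * b - C * r) powr p * measure \<Lambda> S \<le> measure (\<Gamma> (\<lambda>x. G (\<phi> x) $ j)) S"
  proof -
    have lt: "C * r < \<kappa> * b" if "0 < r" "r < \<kappa> * b / (C + 1)" for r
    proof -
      have "C * r \<le> (C + 1) * r" using that by simp
      also have "\<dots> < \<kappa> * b" using that C by (simp add: pos_less_divide_eq mult.commute)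
      finally show ?thesis .
    qed
    have "(\<kappa> * b - C * r) powr p * measure \<Lambda> S \<le> measure (\<Gamma> (\<lambda>x. G (\<phi> x) $ j)) S"
      if "0 < r" "r < \<kappa> * b / (C + 1)" for r
      using key[OF that(1) lt[OF that]] lt[OF that] by (simp add: pos_le_divide_eq mult.commute)
    then show ?thesis
      unfolding eventually_at_right_field using kb C by (intro exI[of _ "\<kappa> * b / (C + 1)"]) auto
  qed
  ultimately have "(\<kappa> * b - C * 0) powr p * measure \<Lambda> S \<le> measure (\<Gamma> (\<lambda>x. G (\<phi> x) $ j)) S"
    by (intro tendsto_upperbound) auto
  then show ?thesis by simp
qed

end

section \<open>Absolute continuity\<close>

context energy_map
begin

lemma Lp_norm_le_const:
  assumes "f \<in> borel_measurable M" "\<And>x. \<bar>f x\<bar> \<le> c"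
  shows "Lp_norm p M f \<le> c"
proof -
  have c: "0 \<le> c" using assms(2) by (meson abs_ge_zero order_trans)
  have "(\<integral>x. \<bar>f x\<bar> powr p \<partial>M) \<le> (\<integral>x. c powr p \<partial>M)"
  proof (rule integral_mono')
    show "\<bar>f x\<bar> powr p \<le> c powr p" for x using assms(2)[of x] p by (intro powr_mono2) auto
  qed auto
  then have "(\<integral>x. \<bar>f x\<bar> powr p \<partial>M) \<le> c powr p" by (simp add: prob_space)
  then have "(\<integral>x. \<bar>f x\<bar> powr p \<partial>M) powr (1 / p) \<le> (c powr p) powr (1 / p)"
    using p by (intro powr_mono2) (auto intro: integral_nonneg_AE)
  then show ?thesis using p c by (simp add: Lp_norm_def powr_powr)
qed

text \<open>Lower semicontinuity along \<open>G\<^sub>m - G\<^sub>i \<rightarrow> G\<^sub>m\<close> bounds the energy of \<open>G\<^sub>m\<close> itself.\<close>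

lemma measure_le_of_differences:
  assumes G: "\<And>m. trig_field UNIV (G m) (D m)" and D: "\<And>m x. norm (D m x) \<le> 1"
    and small: "\<And>m x. norm (G m x) \<le> 1 / real (Suc m)" and S: "S \<in> sets M"
    and le: "\<And>i. m \<le> i \<Longrightarrow> measure (\<Gamma> (\<lambda>x. (G m (\<phi> x) - G i (\<phi> x)) $ j)) S \<le> c"
  shows "measure (\<Gamma> (\<lambda>x. G m (\<phi> x) $ j)) S \<le> c"
proof -
  define f where "f = (\<lambda>x. G m (\<phi> x) $ j)"
  define u where "u i = (\<lambda>x. (G m (\<phi> x) - G (m + i) (\<phi> x)) $ j)" for i
  have tf: "trig_field UNIV (\<lambda>x. G m x - G i x) (\<lambda>x. D m x - D i x)" for i
    by (rule trig_field_diff[OF G G])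
  have fF: "f \<in> F" unfolding f_def by (rule trig_field_comp_in_F[OF G])
  have uF: "u i \<in> F" for i unfolding u_def by (rule trig_field_comp_in_F[OF tf])
  have conv: "(\<lambda>i. Lp_norm p M (\<lambda>x. u i x - f x)) \<longlonglongrightarrow> 0"
  proof (rule tendsto_sandwich[OF _ _ tendsto_const LIMSEQ_inverse_real_of_nat])
    show "\<forall>\<^sub>F i in sequentially. 0 \<le> Lp_norm p M (\<lambda>x. u i x - f x)"
      by (simp add: Lp_norm_def)
    show "\<forall>\<^sub>F i in sequentially. Lp_norm p M (\<lambda>x. u i x - f x) \<le> inverse (real (Suc i))"
    proof (intro always_eventually allI Lp_norm_le_const)
      fix i x
      show "(\<lambda>x. u i x - f x) \<in> borel_measurable M" by (intro F_measurable F_diff uF fF)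
      have "\<bar>u i x - f x\<bar> = \<bar>G (m + i) (\<phi> x) $ j\<bar>" by (simp add: u_def f_def)
      also have "\<dots> \<le> norm (G (m + i) (\<phi> x))" by (rule component_le_norm_cart)
      also have "\<dots> \<le> 1 / real (Suc (m + i))" by (rule small)
      also have "\<dots> \<le> 1 / real (Suc i)" by (intro divide_left_mono) auto
      finally show "\<bar>u i x - f x\<bar> \<le> inverse (real (Suc i))" by (simp add: inverse_eq_divide)
    qed
  qed
  have bdd: "bdd_above (range (\<lambda>i. E (u i)))"
  proof (rule bdd_aboveI2)
    fix i
    have "norm ((D m y - D (m + i) y) $ j) \<le> 2" for y
      using order_trans[OF Finite_Cartesian_Product.norm_nth_le norm_triangle_ineq4, of "D m y" "D (m + i) y" j]
        D[of m y] D[of "m + i" y] by linarith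
    then show "E (u i) \<le> (real CARD('n) * 2) powr p * measure \<Lambda> (space M)"
      using measure_trig_field_le[OF tf, of "space M" 2 "m + i" j] \<Gamma>_total[OF uF, of i] by (simp add: u_def)
  qed
  have "f \<in> Lp_space p M" using fF F_subset by blast
  from lsc_le[OF this uF conv bdd S]
  have "emeasure (\<Gamma> f) S \<le> liminf (\<lambda>i. emeasure (\<Gamma> (u i)) S)" .
  also have "\<dots> \<le> ennreal c"
  proof (rule order_trans[OF Liminf_le_Limsup])
    show "limsup (\<lambda>i. emeasure (\<Gamma> (u i)) S) \<le> ennreal c"
    proof (rule Limsup_bounded)
      show "\<forall>\<^sub>F i in sequentially. emeasure (\<Gamma> (u i)) S \<le> ennreal c"
      proof (intro always_eventually allI)
        fix i
        have "measure (\<Gamma> (u i)) S \<le> c" unfolding u_def by (rule le) simp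
        then show "emeasure (\<Gamma> (u i)) S \<le> ennreal c"
          using finite_measure.emeasure_eq_measure[OF finite_\<Gamma>[OF uF], of i S] by (simp add: ennreal_leI)
      qed
    qed
  qed simp
  finally have "ennreal (measure (\<Gamma> f) S) \<le> ennreal c"
    using finite_measure.emeasure_eq_measure[OF finite_\<Gamma>[OF fF], of S] by simp
  moreover have "0 \<le> c" using le[of m] measure_nonneg order_trans by blast
  ultimately show ?thesis by (simp add: f_def)
qed

text \<open>\<nu> is the normalised image of \<Lambda> restricted to \<open>S\<close>. A divergence
  integral of at least \<open>c\<close> forces some row of the derivative to have size
  \<open>t\<close> on a set of measure at least \<open>t\<close>, so every field has a component of
  energy at least \<gamma>; the Cauchy property bounds all components of one late field by
  \<open>\<gamma> / 2\<close>.\<close>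

lemma null_of_uniformly_independent:
  assumes S: "S \<in> sets M" and K: "compact K" "K \<in> null_sets lborel" and SK: "\<And>x. x \<in> S \<Longrightarrow> \<phi> x \<in> K"
    and \<kappa>: "0 < \<kappa>"
      "\<And>l T. T \<in> sets M \<Longrightarrow> T \<subseteq> S \<Longrightarrow> \<kappa> * norm l * measure \<Lambda> T powr (1 / p) \<le> energy_norm (\<lambda>x. l \<bullet> \<phi> x) T"
  shows "measure \<Lambda> S = 0"
proof (rule ccontr)
  assume "measure \<Lambda> S \<noteq> 0"
  define a where "a = measure \<Lambda> S"
  have a: "0 < a" using \<open>measure \<Lambda> S \<noteq> 0\<close> by (simp add: a_def less_le)
  interpret \<Lambda>: finite_measure \<Lambda> by (rule finite_\<Lambda>)
  have \<phi>m [measurable]: "\<phi> \<in> borel_measurable \<Lambda>"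
    using \<phi>_measurable by (simp add: measurable_cong_sets[OF sets_energy_sum refl])
  have S\<Lambda> [measurable]: "S \<in> sets \<Lambda>" using S by simp
  define U where "U = uniform_measure \<Lambda> S"
  have US: "emeasure \<Lambda> S \<noteq> 0" "emeasure \<Lambda> S \<noteq> \<infinity>"
    using a by (simp_all add: \<Lambda>.emeasure_eq_measure a_def)
  interpret U: prob_space U unfolding U_def by (rule prob_space_uniform_measure[OF US])
  have \<phi>U: "\<phi> \<in> measurable U borel" unfolding U_def by simp
  define \<nu> where "\<nu> = distr U borel \<phi>"
  interpret \<nu>: prob_space \<nu> unfolding \<nu>_def by (rule U.prob_space_distr[OF \<phi>U])
  have \<nu>_sets: "sets \<nu> = sets borel" by (simp add: \<nu>_def)
  have "AE x in U. x \<in> S" unfolding U_def by (rule AE_uniform_measureI) (use S in auto)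
  then have conc: "AE y in \<nu>. y \<in> K"
    unfolding \<nu>_def using K(1) SK by (subst AE_distr_iff[OF \<phi>U]) (auto intro: borel_compact)
  have \<nu>_measure: "measure \<nu> B = measure \<Lambda> {x \<in> S. \<phi> x \<in> B} / a" if [measurable]: "B \<in> sets borel" for B
  proof -
    have "measure \<nu> B = measure U (\<phi> -` B \<inter> space M)"
      unfolding \<nu>_def by (subst measure_distr[OF \<phi>U]) (simp_all add: U_def)
    also have "\<dots> = measure \<Lambda> (S \<inter> (\<phi> -` B \<inter> space M)) / a"
      unfolding U_def a_def using measurable_sets[OF \<phi>m, of B]
      by (intro measure_uniform_measure[OF US]) simp
    also have "S \<inter> (\<phi> -` B \<inter> space M) = {x \<in> S. \<phi> x \<in> B}" using sets.sets_into_space[OF S] by auto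
    finally show ?thesis .
  qed
  define c where "c = 1 / (100 + 160 * real CARD('n))"
  have c: "0 < c" by (simp add: c_def add_pos_nonneg)
  obtain G D where G: "\<And>m. trig_field UNIV (G m) (D m)" and D: "\<And>m x. norm (D m x) \<le> 1"
    and small: "\<And>m x. norm (G m x) \<le> 1 / real (Suc m)" and tr: "\<And>m. c \<le> (\<integral>x. trace (D m x) \<partial>\<nu>)"
    and cauchy: "\<And>e. 0 < e \<Longrightarrow> \<exists>m0. \<forall>m\<ge>m0. \<forall>l\<ge>m. (\<integral>x. (norm (D m x - D l x))\<^sup>2 \<partial>\<nu>) \<le> e"
    using cauchy_test_fields[OF \<nu>.prob_space_axioms \<nu>_sets K conc, folded c_def] by blast
  have Dc: "continuous_on UNIV (D m)" for m using trig_field_continuous[OF G] by blast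
  have meas: "f \<in> borel_measurable \<nu>" if "continuous_on UNIV f" for f :: "real ^ 'n \<Rightarrow> real"
    using \<nu>_sets borel_measurable_continuous_onI[OF that] by (simp add: measurable_cong_sets[OF \<nu>_sets refl])
  have fin: "emeasure \<nu> X < \<top>" for X by (simp add: \<nu>.emeasure_eq_measure)
  \<comment> \<open>Chosen so that \<open>2 * CARD('n) * t = c\<close>: if each row reached size
    \<open>t\<close> only on measure below \<open>t\<close>, the trace would integrate to less than
    \<open>c\<close>.\<close>
  define t where "t = c / (2 * real CARD('n))"
  have t: "0 < t" using c by (simp add: t_def)
  define B where "B m j = {y. t \<le> norm (D m y $ j)}" for m j
  have B [measurable]: "B m j \<in> sets borel" for m j
    unfolding B_def by (intro borel_closed closed_Collect_le continuous_intros Dc)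
  have lower: "\<exists>j. (\<kappa> * t) powr p * (a * t) \<le> measure (\<Gamma> (\<lambda>x. G m (\<phi> x) $ j)) S" for m
  proof -
    have "\<exists>j. t \<le> measure \<nu> (B m j)"
    proof (rule ccontr)
      assume "\<nexists>j. t \<le> measure \<nu> (B m j)"
      then have less: "measure \<nu> (B m j) < t" for j by (simp add: not_le)
      have "c \<le> (\<integral>y. (\<Sum>j\<in>UNIV. t + indicator (B m j) y) \<partial>\<nu>)"
      proof (rule order_trans[OF tr integral_mono])
        show "integrable \<nu> (\<lambda>y. trace (D m y))"
        proof (rule \<nu>.integrable_const_bound[where B = "real CARD('n)"])
          have "\<bar>trace (D m y)\<bar> \<le> (\<Sum>j\<in>(UNIV :: 'n set). 1)" for y
            by (rule order_trans[OF abs_trace_le sum_mono])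
              (rule order_trans[OF Finite_Cartesian_Product.norm_nth_le D])
          then show "AE y in \<nu>. norm (trace (D m y)) \<le> real CARD('n)" by simp
        qed (unfold trace_def, intro meas continuous_intros Dc)
        show "integrable \<nu> (\<lambda>y. \<Sum>j\<in>UNIV. t + indicator (B m j) y)"
          using B \<nu>_sets fin by (intro Bochner_Integration.integrable_sum Bochner_Integration.integrable_add integrable_real_indicator) auto
        show "trace (D m y) \<le> (\<Sum>j\<in>UNIV. t + indicator (B m j) y)" for y
        proof -
          have "trace (D m y) \<le> (\<Sum>j\<in>UNIV. norm (D m y $ j))" using abs_trace_le[of "D m y"] by linarith
          also have "\<dots> \<le> (\<Sum>j\<in>UNIV. t + indicator (B m j) y)"
          proof (intro sum_mono)
            fix j
            have "norm (D m y $ j) \<le> 1" by (rule order_trans[OF Finite_Cartesian_Product.norm_nth_le D])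
            then show "norm (D m y $ j) \<le> t + indicator (B m j) y"
              using t by (auto simp: B_def indicator_def)
          qed
          finally show ?thesis .
        qed
      qed
      also have "\<dots> = (\<Sum>j\<in>UNIV. t + measure \<nu> (B m j))"
        using B \<nu>_sets fin
        by (subst Bochner_Integration.integral_sum)
          (auto simp: \<nu>.prob_space intro!: Bochner_Integration.integrable_add integrable_real_indicator)
      also have "\<dots> < (\<Sum>j\<in>(UNIV :: 'n set). t + t)"
        using less by (intro sum_strict_mono) auto
      also have "\<dots> = c" by (simp add: t_def)
      finally show False by simp
    qed
    then obtain j where j: "t \<le> measure \<nu> (B m j)" by blast
    define T where "T = {x \<in> S. \<phi> x \<in> B m j}"
    have "T = S \<inter> (\<phi> -` B m j \<inter> space M)" using sets.sets_into_space[OF S] by (auto simp: T_def)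
    then have T: "T \<in> sets M" using S measurable_sets[OF \<phi>_measurable B] by simp
    have "a * t \<le> measure \<Lambda> T" using j a \<nu>_measure[OF B, of m j] by (simp add: T_def field_simps)
    then have "(\<kappa> * t) powr p * (a * t) \<le> (\<kappa> * t) powr p * measure \<Lambda> T" by (rule mult_left_mono) simp
    also have "\<dots> \<le> measure (\<Gamma> (\<lambda>x. G m (\<phi> x) $ j)) T"
    proof (rule measure_trig_field_ge[OF G T _ _ \<kappa>(1)])
      show "\<kappa> * norm l * measure \<Lambda> V powr (1 / p) \<le> energy_norm (\<lambda>x. l \<bullet> \<phi> x) V"
        if "V \<in> sets M" "V \<subseteq> T" for l V
        by (rule \<kappa>(2)[OF that(1)]) (use that(2) in \<open>auto simp: T_def\<close>)
    qed (use t in \<open>auto simp: T_def B_def\<close>)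
    also have "\<dots> \<le> measure (\<Gamma> (\<lambda>x. G m (\<phi> x) $ j)) S"
    proof -
      have GF: "(\<lambda>x. G m (\<phi> x) $ j) \<in> F" by (rule trig_field_comp_in_F[OF G])
      show ?thesis
        by (rule finite_measure.finite_measure_mono[OF finite_\<Gamma>[OF GF]])
          (use S sets_\<Gamma>[OF GF] in \<open>auto simp: T_def\<close>)
    qed
    finally show ?thesis by blast
  qed
  define \<gamma> where "\<gamma> = (\<kappa> * t) powr p * (a * t)"
  have \<gamma>: "0 < \<gamma>" using \<kappa>(1) t a by (simp add: \<gamma>_def)
  define n where "n = real CARD('n)"
  have n: "1 \<le> n" by (simp add: n_def Suc_leI)
  \<comment> \<open>\<open>\<gamma> / 4\<close> is allotted to each of two parts of
    \<open>S\<close>. Where the difference of derivatives is below \<open>s\<close> the energy is at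
    most \<open>(n * s) powr p * a\<close>, which is \<open>\<gamma> / 4\<close>.\<close>
  define s where "s = (\<gamma> / (4 * a)) powr (1 / p) / n"
  have s: "0 < s" using \<gamma> a n by (simp add: s_def)
  have sp: "(n * s) powr p * a = \<gamma> / 4"
    using p \<gamma> a n by (simp add: s_def powr_powr)
  \<comment> \<open>By Chebyshev the other part has \<Lambda>-measure at most
    \<open>a * e / s\<^sup>2\<close>; there the difference of derivatives is only known to be at
    most 2, and the factor \<open>(n * 2) powr p\<close> brings the energy to
    \<open>\<gamma> / 4\<close>.\<close>
  define e where "e = \<gamma> * s\<^sup>2 / (4 * a * (n * 2) powr p)"
  have e: "0 < e" using \<gamma> s a n by (simp add: e_def)
  obtain m where m: "\<And>l. l \<ge> m \<Longrightarrow> (\<integral>x. (norm (D m x - D l x))\<^sup>2 \<partial>\<nu>) \<le> e"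
    using cauchy[OF e] by blast
  have upper: "measure (\<Gamma> (\<lambda>x. (G m (\<phi> x) - G l (\<phi> x)) $ j)) S \<le> \<gamma> / 2" if l: "m \<le> l" for l j
  proof -
    define H where "H y = D m y - D l y" for y
    have tf: "trig_field UNIV (\<lambda>x. G m x - G l x) H"
      unfolding H_def by (rule trig_field_diff[OF G G])
    have Hc: "continuous_on UNIV H" using trig_field_continuous[OF tf] by blast
    have H2: "norm (H y) \<le> 2" for y
      using norm_triangle_ineq4[of "D m y" "D l y"] D[of m y] D[of l y] by (simp add: H_def)
    define B' where "B' = {y. s \<le> norm (H y)}"
    have B' [measurable]: "B' \<in> sets borel"
      unfolding B'_def by (intro borel_closed closed_Collect_le continuous_intros Hc)
    define T where "T = {x \<in> S. \<phi> x \<in> B'}"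
    have "T = S \<inter> (\<phi> -` B' \<inter> space M)" using sets.sets_into_space[OF S] by (auto simp: T_def)
    then have T: "T \<in> sets M" using S measurable_sets[OF \<phi>_measurable B'] by simp
    have "s\<^sup>2 * measure \<nu> B' = (\<integral>y. s\<^sup>2 * indicator B' y \<partial>\<nu>)"
      using B' \<nu>_sets by simp
    also have "\<dots> \<le> (\<integral>y. (norm (H y))\<^sup>2 \<partial>\<nu>)"
    proof (rule integral_mono)
      show "integrable \<nu> (\<lambda>y. s\<^sup>2 * indicator B' y :: real)"
        using B' \<nu>_sets fin by (intro integrable_mult_right integrable_real_indicator) auto
      show "integrable \<nu> (\<lambda>y. (norm (H y))\<^sup>2)"
        using H2 power_mono[OF H2, of _ 2] by (intro \<nu>.integrable_const_bound[where B = "2\<^sup>2"] meas continuous_intros Hc) auto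
      show "s\<^sup>2 * indicator B' y \<le> (norm (H y))\<^sup>2" for y
        using s by (auto simp: B'_def indicator_def intro: power_mono)
    qed
    also have "\<dots> \<le> e" using m[OF l] by (simp add: H_def)
    finally have "measure \<nu> B' \<le> e / s\<^sup>2" using s by (simp add: pos_le_divide_eq mult.commute)
    then have "measure \<Lambda> T / a \<le> e / s\<^sup>2" using \<nu>_measure[OF B'] by (simp add: T_def)
    then have "measure \<Lambda> T \<le> a * (e / s\<^sup>2)" using a by (simp add: pos_divide_le_eq mult.commute)
    also have "\<dots> = \<gamma> / (4 * (n * 2) powr p)" using a s by (simp add: e_def)
    finally have mT: "measure \<Lambda> T \<le> \<gamma> / (4 * (n * 2) powr p)" .
    let ?g = "\<lambda>x. (G m (\<phi> x) - G l (\<phi> x)) $ j"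
    have gF: "?g \<in> F" by (rule trig_field_comp_in_F[OF tf])
    interpret \<Gamma>g: finite_measure "\<Gamma> ?g" by (rule finite_\<Gamma>[OF gF])
    have "measure (\<Gamma> ?g) T \<le> (n * 2) powr p * measure \<Lambda> T"
      unfolding n_def by (rule measure_trig_field_le[OF tf T])
        (auto intro: order_trans[OF Finite_Cartesian_Product.norm_nth_le H2])
    also have "\<dots> \<le> (n * 2) powr p * (\<gamma> / (4 * (n * 2) powr p))" using mT by (rule mult_left_mono) simp
    also have "\<dots> = \<gamma> / 4" using n by simp
    finally have 1: "measure (\<Gamma> ?g) T \<le> \<gamma> / 4" .
    have "measure (\<Gamma> ?g) (S - T) \<le> (n * s) powr p * measure \<Lambda> (S - T)"
      unfolding n_def
    proof (rule measure_trig_field_le[OF tf])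
      show "norm (H (\<phi> x) $ j) \<le> s" if "x \<in> S - T" for x
        using that by (intro order_trans[OF Finite_Cartesian_Product.norm_nth_le]) (auto simp: T_def B'_def)
    qed (use S T s in auto)
    also have "\<dots> \<le> (n * s) powr p * a"
      unfolding a_def using S T by (intro mult_left_mono \<Lambda>.finite_measure_mono) auto
    finally have 2: "measure (\<Gamma> ?g) (S - T) \<le> \<gamma> / 4" unfolding sp .
    have "measure (\<Gamma> ?g) S = measure (\<Gamma> ?g) T + measure (\<Gamma> ?g) (S - T)"
      using \<Gamma>g.finite_measure_Diff[of S T] S T sets_\<Gamma>[OF gF] by (auto simp: T_def)
    then show ?thesis using 1 2 by simp
  qed
  obtain j where "\<gamma> \<le> measure (\<Gamma> (\<lambda>x. G m (\<phi> x) $ j)) S" using lower[of m] unfolding \<gamma>_def by blast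
  moreover have "measure (\<Gamma> (\<lambda>x. G m (\<phi> x) $ j)) S \<le> \<gamma> / 2"
    by (rule measure_le_of_differences[OF G D small S upper])
  ultimately show False using \<gamma> by simp
qed

end

section \<open>From the lattice infimum to uniform independence\<close>

context energy_map
begin

text \<open>Makes the Radon-Nikodym derivatives in the definition of independence genuine
  densities.\<close>

lemma absolutely_continuous_inner: "absolutely_continuous \<Lambda> (\<Gamma> (\<lambda>x. l \<bullet> \<phi> x))"
  unfolding absolutely_continuous_def
proof
  fix S assume "S \<in> null_sets \<Lambda>"
  then have S: "S \<in> sets M" "measure \<Lambda> S = 0" by (auto simp: null_sets_def measure_def)
  have "energy_norm (\<lambda>x. l \<bullet> \<phi> x) S \<le> 0" using energy_norm_inner_le[OF S(1), of l] S(2) by simp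
  then have "measure (\<Gamma> (\<lambda>x. l \<bullet> \<phi> x)) S = 0"
    using energy_norm_nonneg[of "\<lambda>x. l \<bullet> \<phi> x" S] measure_eq_energy_norm[of "\<lambda>x. l \<bullet> \<phi> x" S] by simp
  then show "S \<in> null_sets (\<Gamma> (\<lambda>x. l \<bullet> \<phi> x))"
    using S finite_measure.emeasure_eq_measure[OF finite_\<Gamma>[OF inner_\<phi>_in_F]] sets_\<Gamma>[OF inner_\<phi>_in_F]
    by (simp add: null_sets_def)
qed

text \<open>The density bound is integrated over \<open>T\<close> for one unit vector at a time, so
  the exceptional null set may depend on the vector; homogeneity covers all other
  \<open>l\<close>.\<close>

lemma energy_norm_ge_of_RN_deriv:
  assumes S: "S \<in> sets M" and c: "0 < c" and GS: "\<And>x. x \<in> S \<Longrightarrow> ennreal c \<le> G x"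
    and G: "\<And>l. norm l = 1 \<Longrightarrow> AE x in \<Lambda>. G x \<le> RN_deriv \<Lambda> (\<Gamma> (\<lambda>x. l \<bullet> \<phi> x)) x"
    and T: "T \<in> sets M" "T \<subseteq> S"
  shows "c powr (1 / p) * norm l * measure \<Lambda> T powr (1 / p) \<le> energy_norm (\<lambda>x. l \<bullet> \<phi> x) T"
proof (cases "l = 0")
  case False
  define u where "u = (1 / norm l) *\<^sub>R l"
  have u: "norm u = 1" "l = norm l *\<^sub>R u" using False by (simp_all add: u_def)
  interpret \<Lambda>: finite_measure \<Lambda> by (rule finite_\<Lambda>)
  let ?N = "\<Gamma> (\<lambda>x. u \<bullet> \<phi> x)"
  interpret N: finite_measure ?N by (rule finite_\<Gamma>[OF inner_\<phi>_in_F])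
  have dens: "density \<Lambda> (RN_deriv \<Lambda> ?N) = ?N"
    by (rule \<Lambda>.density_RN_deriv[OF absolutely_continuous_inner]) (simp add: sets_\<Gamma>[OF inner_\<phi>_in_F])
  have "ennreal c * emeasure \<Lambda> T = (\<integral>\<^sup>+x. ennreal c * indicator T x \<partial>\<Lambda>)"
    using T by (simp add: nn_integral_cmult_indicator)
  also have "\<dots> \<le> (\<integral>\<^sup>+x. RN_deriv \<Lambda> ?N x * indicator T x \<partial>\<Lambda>)"
  proof (rule nn_integral_mono_AE)
    show "AE x in \<Lambda>. ennreal c * indicator T x \<le> RN_deriv \<Lambda> ?N x * indicator T x"
      using G[OF u(1)]
    proof (rule AE_mp, intro AE_I2 impI)
      fix x assume "G x \<le> RN_deriv \<Lambda> ?N x"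
      then show "ennreal c * indicator T x \<le> RN_deriv \<Lambda> ?N x * indicator T x"
        using GS[of x] T(2) by (auto simp: indicator_def intro: order_trans)
    qed
  qed
  also have "\<dots> = emeasure (density \<Lambda> (RN_deriv \<Lambda> ?N)) T"
    using T by (intro emeasure_density[symmetric]) auto
  also have "\<dots> = emeasure ?N T" by (simp only: dens)
  finally have "ennreal (c * measure \<Lambda> T) \<le> ennreal (measure ?N T)"
    using c by (simp add: \<Lambda>.emeasure_eq_measure N.emeasure_eq_measure ennreal_mult)
  then have "c * measure \<Lambda> T \<le> measure ?N T" by simp
  then have "(c * measure \<Lambda> T) powr (1 / p) \<le> measure ?N T powr (1 / p)"
    using p c by (intro powr_mono2) auto
  then have "norm l * (c powr (1 / p) * measure \<Lambda> T powr (1 / p)) \<le> norm l * energy_norm (\<lambda>x. u \<bullet> \<phi> x) T"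
    using c by (intro mult_left_mono) (auto simp: energy_norm_def powr_mult)
  also have "\<dots> = energy_norm (\<lambda>x. norm l * (u \<bullet> \<phi> x)) T"
    by (simp add: energy_norm_scale[OF inner_\<phi>_in_F T(1)])
  also have "(\<lambda>x. norm l * (u \<bullet> \<phi> x)) = (\<lambda>x. l \<bullet> \<phi> x)"
    using False by (simp add: u_def)
  finally show ?thesis by (simp add: mult_ac)
qed (simp add: energy_norm_nonneg)

text \<open>Inner regularity of the finite image measure reduces a null set to its compact subsets,
  on which test fields exist.\<close>

lemma null_preimage:
  assumes S: "S \<in> sets M" and c: "0 < c" and GS: "\<And>x. x \<in> S \<Longrightarrow> ennreal c \<le> G x"
    and G: "\<And>l. norm l = 1 \<Longrightarrow> AE x in \<Lambda>. G x \<le> RN_deriv \<Lambda> (\<Gamma> (\<lambda>x. l \<bullet> \<phi> x)) x"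
    and N: "N \<in> null_sets lborel" and SN: "\<And>x. x \<in> S \<Longrightarrow> \<phi> x \<in> N"
  shows "emeasure \<Lambda> S = 0"
proof -
  interpret \<Lambda>: finite_measure \<Lambda> by (rule finite_\<Lambda>)
  have \<phi>m: "\<phi> \<in> measurable (density \<Lambda> (indicator S)) borel"
    using \<phi>_measurable by (simp add: measurable_def)
  define \<mu> where "\<mu> = distr (density \<Lambda> (indicator S)) borel \<phi>"
  have \<mu>: "emeasure \<mu> B = emeasure \<Lambda> {x \<in> S. \<phi> x \<in> B}" if B: "B \<in> sets borel" for B
  proof -
    have V: "\<phi> -` B \<inter> space M \<in> sets M" using \<phi>_measurable B by (rule measurable_sets)
    have "emeasure \<mu> B = emeasure (density \<Lambda> (indicator S)) (\<phi> -` B \<inter> space M)"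
      unfolding \<mu>_def using emeasure_distr[OF \<phi>m B] by simp
    also have "\<dots> = emeasure \<Lambda> (S \<inter> (\<phi> -` B \<inter> space M))"
      using S V by (subst emeasure_restricted) auto
    also have "S \<inter> (\<phi> -` B \<inter> space M) = {x \<in> S. \<phi> x \<in> B}" using sets.sets_into_space[OF S] by auto
    finally show ?thesis .
  qed
  have Nb: "N \<in> sets borel" using N by auto
  have zero: "emeasure \<mu> K = 0" if K: "K \<subseteq> N" "compact K" for K
  proof -
    have Kb: "K \<in> sets borel" using K by (simp add: borel_compact)
    have K0: "K \<in> null_sets lborel" by (rule null_sets_subset[OF N _ K(1)]) (simp add: Kb)
    have "{x \<in> S. \<phi> x \<in> K} = S \<inter> (\<phi> -` K \<inter> space M)" using sets.sets_into_space[OF S] by auto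
    then have T: "{x \<in> S. \<phi> x \<in> K} \<in> sets M" using S measurable_sets[OF \<phi>_measurable Kb] by simp
    have "measure \<Lambda> {x \<in> S. \<phi> x \<in> K} = 0"
    proof (rule null_of_uniformly_independent[OF T K(2) K0])
      show "0 < c powr (1 / p)" using c by simp
      show "c powr (1 / p) * norm l * measure \<Lambda> T powr (1 / p) \<le> energy_norm (\<lambda>x. l \<bullet> \<phi> x) T"
        if "T \<in> sets M" "T \<subseteq> {x \<in> S. \<phi> x \<in> K}" for l T
        by (rule energy_norm_ge_of_RN_deriv[OF S c GS G that(1)]) (use that(2) in auto)
    qed simp
    then show ?thesis using \<mu>[OF Kb] by (simp add: \<Lambda>.emeasure_eq_measure)
  qed
  have "emeasure \<mu> N = (SUP K\<in>{K. K \<subseteq> N \<and> compact K}. emeasure \<mu> K)"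
  proof (rule inner_regular)
    show "emeasure \<mu> (space \<mu>) \<noteq> \<infinity>"
      using \<mu>[of UNIV] by (simp add: \<mu>_def \<Lambda>.emeasure_eq_measure)
  qed (use Nb in \<open>auto simp: \<mu>_def\<close>)
  also have "\<dots> = 0" using zero by (intro antisym SUP_least) auto
  finally have "emeasure \<mu> N = 0" .
  moreover have "{x \<in> S. \<phi> x \<in> N} = S" using SN by auto
  ultimately show ?thesis using \<mu>[OF Nb] by simp
qed

end

theorem theorem2p66:
  fixes p :: real
    and M :: "'a measure"
    and E :: "('a \<Rightarrow> real) \<Rightarrow> real"
    and F :: "('a \<Rightarrow> real) set"
    and \<Gamma> :: "('a \<Rightarrow> real) \<Rightarrow> 'a measure"
    and \<phi> :: "'a \<Rightarrow> real ^ 'n"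
    and A :: "'a set"
  assumes "1 < p"
    and "dirichlet_structure p M E F \<Gamma>"
    and "\<And>i. (\<lambda>x. \<phi> x $ i) \<in> F"
    and "A \<in> sets M"
    and "p_independent M \<Gamma> \<phi> A"
  shows "absolutely_continuous lborel
           (distr (density (energy_sum M \<Gamma> \<phi>) (indicator A)) borel \<phi>)"
proof -
  interpret energy_map p M E F \<Gamma> \<phi>
    using assms(1-3) by (intro energy_map.intro energy_map_axioms.intro)
  obtain G where lat: "is_lattice_inf \<Lambda>
        ((\<lambda>l. RN_deriv \<Lambda> (\<Gamma> (\<lambda>x. \<Sum>i\<in>UNIV. l $ i * \<phi> x $ i))) ` sphere (0 :: real ^ 'n) 1) G"
    and pos: "AE x in \<Lambda>. x \<in> A \<longrightarrow> 0 < G x"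
    using assms(5) by (auto simp: p_independent_def)
  have Gm: "G \<in> borel_measurable M"
    using lat by (simp add: is_lattice_inf_def measurable_cong_sets[OF sets_energy_sum refl])
  have G: "AE x in \<Lambda>. G x \<le> RN_deriv \<Lambda> (\<Gamma> (\<lambda>x. l \<bullet> \<phi> x)) x" if "norm l = 1" for l
    using lat that by (auto simp: is_lattice_inf_def inner_vec_def)
  show ?thesis
    unfolding absolutely_continuous_def
  proof
    fix N :: "(real ^ 'n) set" assume N: "N \<in> null_sets lborel"
    then have Nb: "N \<in> sets borel" by auto
    have V: "\<phi> -` N \<inter> space M \<in> sets M" using \<phi>_measurable Nb by (rule measurable_sets)
    define S where "S = A \<inter> (\<phi> -` N \<inter> space M)"
    have S: "S \<in> sets M" using V assms(4) by (simp add: S_def)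
    \<comment> \<open>On \<open>T k\<close> the lattice infimum has the positive lower bound that
      uniform independence asks for, and these sets exhaust \<open>S\<close> up to a \<Lambda>-null
      set because \<open>G\<close> is positive almost everywhere on \<open>A\<close>.\<close>
    define T where "T k = {x \<in> S. ennreal (1 / real (Suc k)) \<le> G x}" for k
    have "T k = S \<inter> {x \<in> space M. ennreal (1 / real (Suc k)) \<le> G x}" for k
      using sets.sets_into_space[OF S] by (auto simp: T_def)
    moreover have "{x \<in> space M. ennreal (1 / real (Suc k)) \<le> G x} \<in> sets M" for k
      using Gm by measurable
    ultimately have T: "T k \<in> sets M" for k using S by simp
    have "emeasure \<Lambda> (T k) = 0" for k
      by (rule null_preimage[OF T _ _ G N, of "1 / real (Suc k)"]) (auto simp: T_def S_def)
    then have "AE x in \<Lambda>. x \<notin> T k" for k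
      using T by (intro AE_not_in) (auto simp: null_sets_def)
    then have "AE x in \<Lambda>. \<forall>k. x \<notin> T k" by (simp add: AE_all_countable)
    with pos have "AE x in \<Lambda>. x \<notin> S"
    proof eventually_elim
      case (elim x)
      show ?case
      proof
        assume x: "x \<in> S"
        then have "0 < G x" using elim by (simp add: S_def)
        have "\<exists>k. ennreal (1 / real (Suc k)) \<le> G x"
        proof (cases "G x")
          case (real r)
          then have "0 < r" using \<open>0 < G x\<close> by simp
          then obtain k where "inverse (real (Suc k)) < r" using reals_Archimedean by blast
          then have "ennreal (1 / real (Suc k)) \<le> ennreal r" by (intro ennreal_leI) (simp add: inverse_eq_divide)
          then show ?thesis using real by metis
        qed simp
        then show False using elim x by (auto simp: T_def)
      qed
    qed
    then have "emeasure \<Lambda> S = 0"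
      using S by (subst (asm) AE_iff_measurable[of S]) (auto dest: sets.sets_into_space)
    moreover have "\<phi> \<in> measurable (density \<Lambda> (indicator A)) borel"
      using \<phi>_measurable by (simp add: measurable_def)
    then have "emeasure (distr (density \<Lambda> (indicator A)) borel \<phi>) N = emeasure \<Lambda> S"
      using V assms(4) by (subst emeasure_distr[OF _ Nb]) (auto simp: emeasure_restricted S_def)
    ultimately have "emeasure (distr (density \<Lambda> (indicator A)) borel \<phi>) N = 0" by simp
    then show "N \<in> null_sets (distr (density \<Lambda> (indicator A)) borel \<phi>)"
      using Nb by (simp add: null_sets_def)
  qed
qed

end
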